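(* Let $a\in(0,1)$ and let $(\mathbb{S}^{3},\varphi,\xi,\eta,g)$ be the unit $3$-sphere with the deformed Sasakian structure of parameter $a$ described in the context. Put $$A=\sqrt{\frac{3-2a-2\sqrt{(a-1)(a-2)}}{a}},\qquad B=\sqrt{\frac{3-2a+2\sqrt{(a-1)(a-2)}}{a}}.$$ Let $S_{\bar\gamma}$ be a proper-biharmonic Hopf cylinder in $(\mathbb{S}^{3},\varphi,\xi,\eta,g)$. Then there exists an orthonormal system $\{e_{1},e_{3}\}$ of constant vectors in the Euclidean space $(\mathbb{R}^{4},\langle\cdot,\cdot\rangle)$, with $e_{3}$ orthogonal to $Je_{1}$, such that $S_{\bar\gamma}$, thought of as a surface in $\mathbb{R}^{4}$, has the parametric equation $$x(u,v)=\sqrt{\tfrac{B}{A+B}}\cos\!\big(Au+\tfrac{1}{a}v\big)e_{1}-\sqrt{\tfrac{B}{A+B}}\sin\!\big(Au+\tfrac{1}{a}v\big)Je_{1}+\sqrt{\tfrac{A}{A+B}}\cos\!\big(Bu-\tfrac{1}{a}v\big)e_{3}+\sqrt{\tfrac{A}{A+B}}\sin\!\big(Bu-\tfrac{1}{a}v\big)Je_{3},$$ with $u$ ranging over an interval and $v$ over $\mathbb{R}$.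
   Context: All manifolds, metrics and maps are smooth. Identify $\mathbb{C}^2$ with $\mathbb{R}^4$, with standard Euclidean inner product $\langle\cdot,\cdot\rangle$ and complex structure $J(x_{1},x_{2},y_{1},y_{2})=(-y_{1},-y_{2},x_{1},x_{2})$. Let $\mathbb{S}^{3}=\{z\in\mathbb{C}^{2}:\|z\|=1\}$ with its standard metric $g_{0}$ induced from $\langle\cdot,\cdot\rangle$. On $\mathbb{S}^3$ set $\xi_{0}(z)=-Jz$, $\eta_0(X)=g_0(X,\xi_0)$, and $\varphi_{0}=s\circ J$, where $s:T_{z}\mathbb{C}^{2}\to T_{z}\mathbb{S}^{3}$ is the orthogonal projection. For a constant $a\in(0,1)$ the deformed structure is $$\eta=a\eta_{0},\quad \xi=\tfrac1a\xi_{0},\quad \varphi=\varphi_{0},\quad g=a\,g_{0}+a(a-1)\,\eta_{0}\otimes\eta_{0}.$$ $(\mathbb{S}^3,\varphi,\xi,\eta,g)$ is a Sasakian space form of constant $\varphi$-sectional curvature $c=\frac4a-3>1$. Let $\pi:(\mathbb{S}^{3},g)\to\mathbb{C}P^{1}$ be the Boothby-Wang (Hopf) fibration, i.e. the projection onto the space of orbits of $\xi$, where $\mathbb{C}P^1$ carries the metric making $\pi$ a Riemannian submersion; this metric has constant holomorphic sectional curvature $c+3=\frac4a$. For a curve $\bar\gamma:I\to\mathbb{C}P^{1}$ ($I\subset\mathbb{R}$ an interval) parametrized by arc length, the Hopf cylinder over $\bar\gamma$ is $S_{\bar\gamma}=\pi^{-1}(\bar\gamma)$, a surface in $\mathbb{S}^3$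 endowed with the metric induced by $g$. For a smooth map $\phi:(M,g_M)\to(N,h)$ of Riemannian manifolds, the tension field is $\tau(\phi)=\mathrm{trace}\,\nabla d\phi$ and the bitension field is $\tau_{2}(\phi)=-\Delta\tau(\phi)-\mathrm{trace}\,R^{N}(d\phi,\tau(\phi))d\phi$, where $\Delta$ is the rough Laplacian $\Delta=-\mathrm{trace}(\nabla^\phi\nabla^\phi-\nabla^\phi_{\nabla})$ on sections of $\phi^{-1}TN$ and $R^N(X,Y)=[\nabla_X,\nabla_Y]-\nabla_{[X,Y]}$. The map $\phi$ is harmonic if $\tau(\phi)=0$, biharmonic if $\tau_2(\phi)=0$ (equivalently, $\phi$ is a critical point of the bienergy $E_2(\phi)=\frac12\int_M|\tau(\phi)|^2\nu_{g_M}$), and proper-biharmonic if it is biharmonic and not harmonic. A submanifold is proper-biharmonic if its inclusion, with the induced metric, is a proper-biharmonic map; here the ambient manifold is $(\mathbb{S}^3,g)$. *)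

theory Defs
  imports "HOL-Analysis.Analysis"
begin

section \<open>Smooth maps between Euclidean spaces\<close>

abbreviation D :: "('a::real_normed_vector \<Rightarrow> 'b::real_normed_vector) \<Rightarrow> 'a \<Rightarrow> 'a \<Rightarrow> 'b" where
  "D f p \<equiv> frechet_derivative f (at p)"

text \<open>Only meant for open sets \<open>S\<close>; \<open>Ck k S f\<close> says that all iterated directional derivatives of
  \<open>f\<close> of order less than \<open>k\<close> are differentiable on \<open>S\<close> and those of order \<open>k\<close> are continuous.\<close>

primrec Ck ::
  "nat \<Rightarrow> 'a::real_normed_vector set \<Rightarrow> ('a \<Rightarrow> 'b::real_normed_vector) \<Rightarrow> bool" where
  "Ck 0 S f \<longleftrightarrow> continuous_on S f"
| "Ck (Suc k) S f \<longleftrightarrow>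
     (\<forall>x\<in>S. f differentiable (at x)) \<and> (\<forall>v. Ck k S (\<lambda>x. D f x v))"

definition smooth_map_on ::
  "'a::real_normed_vector set \<Rightarrow> ('a \<Rightarrow> 'b::real_normed_vector) \<Rightarrow> bool" where
  "smooth_map_on S f \<longleftrightarrow> (\<forall>k. Ck k S f)"

section \<open>Riemannian geometry in coordinates\<close>

text \<open>A metric on an open subset of a Euclidean space assigns to every point a bilinear form.
  Coordinate vector fields are the constant vector fields.\<close>

type_synonym 'a metric = "'a \<Rightarrow> 'a \<Rightarrow> 'a \<Rightarrow> real"

text \<open>The covariant derivative of the constant field \<open>y\<close> in the direction \<open>x\<close> for the
  Levi-Civita connection, given by the Koszul formula (the brackets of constant fields vanish).
  In components this is \<open>\<Gamma>\<^sup>k\<^sub>i\<^sub>j x\<^sup>i y\<^sup>j\<close>.\<close>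

definition christoffel :: "'a::euclidean_space metric \<Rightarrow> 'a \<Rightarrow> 'a \<Rightarrow> 'a \<Rightarrow> 'a" where
  "christoffel G p x y = (THE w. \<forall>z.
     2 * G p w z = D (\<lambda>q. G q y z) p x + D (\<lambda>q. G q x z) p y - D (\<lambda>q. G q x y) p z)"

definition levi_civita ::
  "'a::euclidean_space metric \<Rightarrow> ('a \<Rightarrow> 'a) \<Rightarrow> ('a \<Rightarrow> 'a) \<Rightarrow> 'a \<Rightarrow> 'a" where
  "levi_civita G X Y p = D Y p (X p) + christoffel G p (X p) (Y p)"

definition lie_bracket ::
  "('a::euclidean_space \<Rightarrow> 'a) \<Rightarrow> ('a \<Rightarrow> 'a) \<Rightarrow> 'a \<Rightarrow> 'a" where
  "lie_bracket X Y p = D Y p (X p) - D X p (Y p)"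

definition curvature_field ::
  "'a::euclidean_space metric \<Rightarrow> ('a \<Rightarrow> 'a) \<Rightarrow> ('a \<Rightarrow> 'a) \<Rightarrow> ('a \<Rightarrow> 'a) \<Rightarrow> 'a \<Rightarrow> 'a" where
  "curvature_field G X Y Z p =
     levi_civita G X (levi_civita G Y Z) p - levi_civita G Y (levi_civita G X Z) p
     - levi_civita G (lie_bracket X Y) Z p"

text \<open>\<open>R(x,y)z\<close> for tangent vectors at \<open>p\<close>; being tensorial, it may be computed from
  the constant extensions of \<open>x\<close>, \<open>y\<close>, \<open>z\<close>.\<close>

definition curvature :: "'a::euclidean_space metric \<Rightarrow> 'a \<Rightarrow> 'a \<Rightarrow> 'a \<Rightarrow> 'a \<Rightarrow> 'a" where
  "curvature G p x y z = curvature_field G (\<lambda>_. x) (\<lambda>_. y) (\<lambda>_. z) p"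

text \<open>The trace \<open>\<Sum>\<^sub>i\<^sub>j G\<^sup>i\<^sup>j b(e\<^sub>i,e\<^sub>j)\<close> of a bilinear map \<open>b\<close> with respect to \<open>G\<close>: the vector
  \<open>w = \<Sum>\<^sub>j G\<^sup>i\<^sup>j e\<^sub>j\<close> is the one dual to the coordinate covector \<open>z \<mapsto> i \<bullet> z\<close>.\<close>

definition metric_trace ::
  "'a::euclidean_space metric \<Rightarrow> 'a \<Rightarrow> ('a \<Rightarrow> 'a \<Rightarrow> 'b::real_vector) \<Rightarrow> 'b" where
  "metric_trace G p b = (\<Sum>i\<in>Basis. b i (THE w. \<forall>z. G p w z = i \<bullet> z))"

section \<open>Tension and bitension field of a map\<close>

text \<open>Below, \<open>G\<close> is the metric of the domain, \<open>H\<close> the metric of the target, and \<open>f\<close> the map.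
  \<open>pullback_conn H f V p x\<close> is \<open>(\<nabla>\<^sup>f\<^sub>x V)(p)\<close> for a vector field \<open>V\<close> along \<open>f\<close>.\<close>

definition pullback_conn ::
  "'b::euclidean_space metric \<Rightarrow> ('a::euclidean_space \<Rightarrow> 'b) \<Rightarrow> ('a \<Rightarrow> 'b) \<Rightarrow> 'a \<Rightarrow> 'a \<Rightarrow> 'b" where
  "pullback_conn H f V p x = D V p x + christoffel H (f p) (D f p x) (V p)"

definition tension_field ::
  "'a::euclidean_space metric \<Rightarrow> 'b::euclidean_space metric \<Rightarrow> ('a \<Rightarrow> 'b) \<Rightarrow> 'a \<Rightarrow> 'b" where
  "tension_field G H f p = metric_trace G p
     (\<lambda>x y. pullback_conn H f (\<lambda>q. D f q y) p x - D f p (christoffel G p x y))"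

definition rough_laplacian ::
  "'a::euclidean_space metric \<Rightarrow> 'b::euclidean_space metric \<Rightarrow> ('a \<Rightarrow> 'b) \<Rightarrow> ('a \<Rightarrow> 'b) \<Rightarrow> 'a \<Rightarrow> 'b"
  where
  "rough_laplacian G H f V p = - metric_trace G p
     (\<lambda>x y. pullback_conn H f (\<lambda>q. pullback_conn H f V q y) p x
            - pullback_conn H f V p (christoffel G p x y))"

definition bitension_field ::
  "'a::euclidean_space metric \<Rightarrow> 'b::euclidean_space metric \<Rightarrow> ('a \<Rightarrow> 'b) \<Rightarrow> 'a \<Rightarrow> 'b" where
  "bitension_field G H f p =
     - rough_laplacian G H f (tension_field G H f) p
     - metric_trace G p
         (\<lambda>x y. curvature H (f p) (D f p x) (tension_field G H f p) (D f p y))"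

section \<open>Immersed submanifolds of a manifold embedded in Euclidean space\<close>

definition local_param ::
  "'e::euclidean_space set \<Rightarrow> 'n::euclidean_space set \<times> ('n \<Rightarrow> 'e) \<Rightarrow> bool" where
  "local_param N = (\<lambda>(U, \<psi>). open U \<and> smooth_map_on U \<psi> \<and> inj_on \<psi> U \<and>
     (\<forall>p\<in>U. inj (D \<psi> p)) \<and> \<psi> ` U \<subseteq> N)"

definition induced_metric ::
  "('e::euclidean_space) metric \<Rightarrow> ('n::euclidean_space \<Rightarrow> 'e) \<Rightarrow> 'n metric" where
  "induced_metric g \<psi> p x y = g (\<psi> p) (D \<psi> p x) (D \<psi> p y)"

text \<open>\<open>coordinate_rep \<P> N W X \<psi> f\<close>: the inclusion of an immersed submanifold of \<open>N\<close>, whose local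
  parametrizations are the elements of \<open>\<P>\<close>, is represented by \<open>f\<close> in the parametrization
  \<open>(W, X)\<close> of the submanifold and some local parametrization \<open>\<psi>\<close> of \<open>N\<close>. As \<open>\<psi>\<close> is required to be
  an immersion into \<open>N\<close>, the type \<open>'n\<close> is to be chosen with \<open>DIM('n)\<close> the dimension of \<open>N\<close>.\<close>

definition coordinate_rep ::
  "('m::euclidean_space set \<times> ('m \<Rightarrow> 'e::euclidean_space)) set \<Rightarrow> 'e set \<Rightarrow>
   'm set \<Rightarrow> ('m \<Rightarrow> 'e) \<Rightarrow> ('n::euclidean_space \<Rightarrow> 'e) \<Rightarrow> ('m \<Rightarrow> 'n) \<Rightarrow> bool" where
  "coordinate_rep \<P> N W X \<psi> f \<longleftrightarrow> (W, X) \<in> \<P> \<and> smooth_map_on W f \<and>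
     (\<exists>U. local_param N (U, \<psi>) \<and> f ` W \<subseteq> U) \<and> (\<forall>w\<in>W. X w = \<psi> (f w))"

definition harmonic_submanifold ::
  "'n::euclidean_space itself \<Rightarrow> 'e::euclidean_space set \<Rightarrow> 'e metric \<Rightarrow>
   ('m::euclidean_space set \<times> ('m \<Rightarrow> 'e)) set \<Rightarrow> bool" where
  "harmonic_submanifold _ N g \<P> \<longleftrightarrow>
     (\<forall>W X (\<psi> :: 'n \<Rightarrow> 'e) f. coordinate_rep \<P> N W X \<psi> f \<longrightarrow>
        (\<forall>w\<in>W. tension_field (induced_metric g X) (induced_metric g \<psi>) f w = 0))"

definition biharmonic_submanifold ::
  "'n::euclidean_space itself \<Rightarrow> 'e::euclidean_space set \<Rightarrow> 'e metric \<Rightarrow>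
   ('m::euclidean_space set \<times> ('m \<Rightarrow> 'e)) set \<Rightarrow> bool" where
  "biharmonic_submanifold _ N g \<P> \<longleftrightarrow>
     (\<forall>W X (\<psi> :: 'n \<Rightarrow> 'e) f. coordinate_rep \<P> N W X \<psi> f \<longrightarrow>
        (\<forall>w\<in>W. bitension_field (induced_metric g X) (induced_metric g \<psi>) f w = 0))"

definition proper_biharmonic_submanifold ::
  "'n::euclidean_space itself \<Rightarrow> 'e::euclidean_space set \<Rightarrow> 'e metric \<Rightarrow>
   ('m::euclidean_space set \<times> ('m \<Rightarrow> 'e)) set \<Rightarrow> bool" where
  "proper_biharmonic_submanifold T N g \<P> \<longleftrightarrow>
     biharmonic_submanifold T N g \<P> \<and> \<not> harmonic_submanifold T N g \<P>"

section \<open>The deformed Sasakian structure on the three-sphere\<close>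

text \<open>The coordinates of \<open>real ^ 4\<close> are \<open>(x\<^sub>1, x\<^sub>2, y\<^sub>1, y\<^sub>2)\<close>.\<close>

definition JJ :: "real ^ 4 \<Rightarrow> real ^ 4" where
  "JJ z = vector [- z $ 3, - z $ 4, z $ 1, z $ 2]"

abbreviation S3 :: "(real ^ 4) set" where
  "S3 \<equiv> sphere 0 1"

definition xi0 :: "real ^ 4 \<Rightarrow> real ^ 4" where
  "xi0 z = - JJ z"

definition eta0 :: "real ^ 4 \<Rightarrow> real ^ 4 \<Rightarrow> real" where
  "eta0 z X = X \<bullet> xi0 z"

definition phi :: "real ^ 4 \<Rightarrow> real ^ 4 \<Rightarrow> real ^ 4" where
  "phi z X = JJ X - (JJ X \<bullet> z) *\<^sub>R z"

definition xi :: "real \<Rightarrow> real ^ 4 \<Rightarrow> real ^ 4" where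
  "xi a z = (1 / a) *\<^sub>R xi0 z"

definition eta :: "real \<Rightarrow> real ^ 4 \<Rightarrow> real ^ 4 \<Rightarrow> real" where
  "eta a z X = a * eta0 z X"

definition gS :: "real \<Rightarrow> (real ^ 4) metric" where
  "gS a z X Y = a * (X \<bullet> Y) + a * (a - 1) * (eta0 z X * eta0 z Y)"

section \<open>The Hopf fibration and Hopf cylinders\<close>

text \<open>Points of the complex projective line are the orbits of \<open>xi a\<close>; \<open>hopf a\<close> sends a point to
  the range of the integral curve through it.\<close>

definition hopf :: "real \<Rightarrow> real ^ 4 \<Rightarrow> (real ^ 4) set" where
  "hopf a z = {c s | c s. c 0 = z \<and> (\<forall>t. (c has_vector_derivative xi a (c t)) (at t))}"

text \<open>Since the Hopf fibration is a surjective submersion, a curve in the orbit space is smooth iff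
  locally it is the projection of smooth curves in the sphere, and since it is a Riemannian
  submersion, the speed of the projected curve is the length of the horizontal part of the
  velocity of any such lift.\<close>

definition local_lift ::
  "real \<Rightarrow> real set \<Rightarrow> (real \<Rightarrow> (real ^ 4) set) \<Rightarrow> real set \<Rightarrow> (real \<Rightarrow> real ^ 4) \<Rightarrow> bool" where
  "local_lift a I \<gamma> T c \<longleftrightarrow> open T \<and> smooth_map_on T c \<and> c ` T \<subseteq> S3 \<and>
     (\<forall>s \<in> T \<inter> I. \<gamma> s = hopf a (c s))"

definition horizontal_part :: "real \<Rightarrow> real ^ 4 \<Rightarrow> real ^ 4 \<Rightarrow> real ^ 4" where
  "horizontal_part a z X = X - eta a z X *\<^sub>R xi a z"

definition projected_speed :: "real \<Rightarrow> (real \<Rightarrow> real ^ 4) \<Rightarrow> real \<Rightarrow> real" where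
  "projected_speed a c t =
     (let h = horizontal_part a (c t) (vector_derivative c (at t)) in sqrt (gS a (c t) h h))"

definition arc_length_curve :: "real \<Rightarrow> real set \<Rightarrow> (real \<Rightarrow> (real ^ 4) set) \<Rightarrow> bool" where
  "arc_length_curve a I \<gamma> \<longleftrightarrow>
     is_interval I \<and> interior I \<noteq> {} \<and>
     (\<forall>t\<in>I. \<exists>T c. t \<in> T \<and> local_lift a I \<gamma> T c) \<and>
     (\<forall>T c. local_lift a I \<gamma> T c \<longrightarrow> (\<forall>t \<in> T \<inter> I. projected_speed a c t = 1))"

definition hopf_cylinder ::
  "real \<Rightarrow> real set \<Rightarrow> (real \<Rightarrow> (real ^ 4) set) \<Rightarrow> (real ^ 4) set" where
  "hopf_cylinder a I \<gamma> = {z \<in> S3. hopf a z \<in> \<gamma> ` I}"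

text \<open>Local parametrizations of the Hopf cylinder as an immersed surface. The function \<open>t\<close> singles
  out the sheet if the curve is not injective: \<open>w \<mapsto> (t w, X w)\<close> parametrizes
  the pulled back bundle \<open>{(t, z). hopf a z = \<gamma> t}\<close>.\<close>

definition hopf_cylinder_params ::
  "real \<Rightarrow> real set \<Rightarrow> (real \<Rightarrow> (real ^ 4) set) \<Rightarrow> ((real ^ 2) set \<times> (real ^ 2 \<Rightarrow> real ^ 4)) set" where
  "hopf_cylinder_params a I \<gamma> = {(W, X). local_param S3 (W, X) \<and>
     (\<exists>t. smooth_map_on W t \<and> t ` W \<subseteq> I \<and> (\<forall>w\<in>W. hopf a (X w) = \<gamma> (t w)))}"

definition proper_biharmonic_hopf_cylinder ::
  "real \<Rightarrow> real set \<Rightarrow> (real \<Rightarrow> (real ^ 4) set) \<Rightarrow> bool" where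
  "proper_biharmonic_hopf_cylinder a I \<gamma> \<longleftrightarrow>
     proper_biharmonic_submanifold TYPE(real ^ 3) S3 (gS a) (hopf_cylinder_params a I \<gamma>)"

section \<open>Compatibility of the structure tensors\<close>

lemma JJ_nth [simp]:
  "JJ z $ 1 = - z $ 3" "JJ z $ 2 = - z $ 4" "JJ z $ 3 = z $ 1" "JJ z $ 4 = z $ 2"
  by (simp_all add: JJ_def vector_def)

lemma JJ_inner [simp]: "JJ x \<bullet> JJ y = x \<bullet> y"
  by (simp add: inner_vec_def sum_4)

lemma norm_JJ [simp]: "norm (JJ x) = norm x"
  by (simp add: norm_eq_sqrt_inner)

lemma inner_JJ_right: "x \<bullet> JJ y = - (JJ x \<bullet> y)"
  by (simp add: inner_vec_def sum_4)

lemma JJ_JJ [simp]: "JJ (JJ x) = - x"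
  by (simp add: vec_eq_iff forall_4)

lemma gS_phi:
  assumes "z \<in> S3" "X \<bullet> z = 0" "Y \<bullet> z = 0"
  shows "gS a z (phi z X) (phi z Y) = gS a z X Y - eta a z X * eta a z Y"
proof -
  have zz: "z \<bullet> z = 1"
    using assms by (simp add: dot_square_norm)
  have zJ: "z \<bullet> JJ z = 0"
    by (simp add: inner_vec_def sum_4)
  have e: "eta0 z (phi z V) = 0" if "V \<bullet> z = 0" for V
    using that zJ by (simp add: eta0_def xi0_def phi_def inner_diff_left)
  have "phi z X \<bullet> phi z Y = X \<bullet> Y - (JJ X \<bullet> z) * (JJ Y \<bullet> z)"
    using zz by (simp add: phi_def inner_diff_left inner_diff_right inner_commute)
  moreover have "eta0 z V = JJ V \<bullet> z" for V
    by (simp add: eta0_def xi0_def inner_JJ_right)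
  ultimately have "phi z X \<bullet> phi z Y = X \<bullet> Y - eta0 z X * eta0 z Y"
    by simp
  then show ?thesis
    by (simp add: gS_def eta_def e assms) (simp add: ring_distribs)
qed

lemma eta_xi: "a \<noteq> 0 \<Longrightarrow> z \<in> S3 \<Longrightarrow> eta a z (xi a z) = 1"
  by (simp add: eta_def eta0_def xi_def xi0_def dot_square_norm)

lemma gS_xi: "a \<noteq> 0 \<Longrightarrow> z \<in> S3 \<Longrightarrow> gS a z X (xi a z) = eta a z X"
  by (simp add: gS_def eta_def eta0_def xi_def xi0_def dot_square_norm field_simps)

end

theory Submission
  imports Defs
begin

text \<open>Let \<open>i\<close> act on the Euclidean space as \<open>JJ\<close>. The Hopf fibre through \<open>z\<close> consists of the points
  \<open>rot \<theta> z\<close>, that is, \<open>exp(-i\<theta>) z\<close>. A curve in the orbit space has, near every parameter, a horizontal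
  lift \<open>c\<close>. As \<open>c\<close>, \<open>i c\<close>, \<open>c'\<close>, \<open>i c'\<close> is an orthogonal frame and unit speed of the projection means
  \<open>|c'|\<^sup>2 = 1/a\<close>, the lift satisfies \<open>c'' = - \<lambda> i c' - c/a\<close>, where the function \<open>\<lambda>\<close> is, up to sign, the
  geodesic curvature of the projected curve (lemma \<open>frame\<close>).

  The cylinder is parametrized by \<open>X(s,t) = exp(-it/a) c(s)\<close>. In these coordinates the induced metric is
  flat, the tension field is \<open>- \<lambda> i X\<^sub>s\<close> (\<open>tension_X\<close>), and the bitension field is \<open>exp(-it/a)\<close> times
  \<open>(- \<lambda>'' + \<lambda>\<^sup>3 - (4/a - 4) \<lambda>) i c' - 3 \<lambda> \<lambda>' c' + (2/a) \<lambda>' i c\<close> (\<open>bitension_X\<close>). The last summand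
  makes \<open>\<lambda>\<close> constant if the cylinder is biharmonic, and then the first one gives \<open>\<lambda> = 0\<close> or
  \<open>\<lambda>\<^sup>2 = 4/a - 4\<close>. So the lift solves a linear equation with constant coefficients, whence
  \<open>c(s) = exp(-iAs) p + exp(iBs) q\<close> with \<open>A - B = \<lambda>\<close> and \<open>A B = 1/a\<close>; the lengths of \<open>p\<close> and \<open>q\<close> and their Hermitian
  orthogonality follow from the initial values of a horizontal curve in the sphere
  (\<open>constant_curvature_solution\<close>). For \<open>\<lambda> = 0\<close> every parametrization of the cylinder has vanishing
  tension (\<open>harmonic_if_lam_zero\<close>), which is excluded by properness. Otherwise \<open>A\<close> and \<open>B\<close> are the two
  constants of the theorem up to order, and reversing the curve exchanges them.

  Two points need care. The tension and bitension fields are defined by Christoffel symbols in charts of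
  the sphere. Pushing vector fields forward to the Euclidean space turns the Levi-Civita connection into
  the derivative plus an explicit bilinear map \<open>conn_form\<close> that depends only on the point of the sphere
  (\<open>pullback_conn_chart\<close>, \<open>curvature_chart\<close>); all calculations are done there. Secondly, lifts exist only
  locally. Two of the explicit solutions that project to the same curve on some interval differ by a
  constant phase and therefore project to the same curve everywhere (\<open>sol_agree\<close>), so that
  the connectedness of the parameter interval yields one solution for the whole curve
  (\<open>global_solution\<close>).\<close>

section \<open>Calculus of smooth maps\<close>

lemma D_unique: "(f has_derivative f') (at p) \<Longrightarrow> D f p = f'"
  using frechet_derivative_at by metis

lemma has_D: "f differentiable (at p) \<Longrightarrow> (f has_derivative D f p) (at p)"
  by (simp add: frechet_derivative_works)

lemma D_cong_open:
  assumes "open S" "p \<in> S" "\<And>q. q \<in> S \<Longrightarrow> f q = g q"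
  shows "D f p = D g p"
proof -
  have "(f has_derivative f') (at p) \<longleftrightarrow> (g has_derivative f') (at p)" for f'
    using assms has_derivative_transform_within_open[of f f' p UNIV S g]
      has_derivative_transform_within_open[of g f' p UNIV S f] by auto
  then show ?thesis by (simp add: frechet_derivative_def)
qed

lemma differentiable_cong_open:
  assumes "open S" "p \<in> S" "\<And>q. q \<in> S \<Longrightarrow> f q = g q" "f differentiable (at p)"
  shows "g differentiable (at p)"
  using assms has_derivative_transform_within_open[of f _ p UNIV S g]
  unfolding differentiable_def by blast

lemma Ck_cong:
  assumes "open S" "\<And>q. q \<in> S \<Longrightarrow> f q = g q" "Ck k S f"
  shows "Ck k S g"
  using assms(2,3)
proof (induction k arbitrary: f g)
  case 0
  then show ?case by (simp cong: continuous_on_cong)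
next
  case (Suc k)
  have "Ck k S (\<lambda>x. D g x v)" for v
    using Suc.IH[of "\<lambda>x. D f x v" "\<lambda>x. D g x v"] D_cong_open[OF assms(1)] Suc.prems
    by (metis Ck.simps(2))
  then show ?case
    using Suc.prems differentiable_cong_open[OF assms(1)] by (metis Ck.simps(2))
qed

lemma Ck_Suc_imp: "Ck (Suc k) S f \<Longrightarrow> Ck k S f"
proof (induction k arbitrary: f)
  case 0
  then show ?case
    by (auto simp: intro!: differentiable_imp_continuous_on differentiable_at_imp_differentiable_on)
next
  case (Suc k)
  then show ?case by (metis Ck.simps(2))
qed

lemma Ck_subset: "S \<subseteq> T \<Longrightarrow> Ck k T f \<Longrightarrow> Ck k S f"
proof (induction k arbitrary: f)
  case 0
  then show ?case using continuous_on_subset by auto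
qed auto

lemma Ck_const: "Ck k S (\<lambda>_. c)"
  by (induction k arbitrary: c) auto

lemma Ck_linear:
  assumes "bounded_linear f" shows "Ck k S f"
proof (cases k)
  case 0
  then show ?thesis using assms by (simp add: linear_continuous_on)
next
  case (Suc m)
  have "D f x v = f v" for x v
    using D_unique[OF bounded_linear_imp_has_derivative[OF assms]] by simp
  then show ?thesis
    using Suc assms bounded_linear_imp_differentiable by (auto simp: Ck_const)
qed

lemma Ck_add: "open S \<Longrightarrow> Ck k S f \<Longrightarrow> Ck k S g \<Longrightarrow> Ck k S (\<lambda>x. f x + g x)"
proof (induction k arbitrary: f g)
  case 0
  then show ?case by (auto intro: continuous_intros)
next
  case (Suc k)
  have d: "((\<lambda>x. f x + g x) has_derivative (\<lambda>v. D f x v + D g x v)) (at x)" if "x \<in> S" for x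
    using that Suc.prems by (intro has_derivative_add has_D) auto
  have "Ck k S (\<lambda>x. D (\<lambda>x. f x + g x) x v)" for v
  proof (rule Ck_cong[OF Suc.prems(1)])
    show "Ck k S (\<lambda>x. D f x v + D g x v)" using Suc by auto
    show "D f x v + D g x v = D (\<lambda>x. f x + g x) x v" if "x \<in> S" for x
      using D_unique[OF d[OF that]] by simp
  qed
  then show ?case using d by (auto simp: differentiable_def)
qed

lemma Ck_bilinear:
  assumes b: "bounded_bilinear b" and S: "open S"
  shows "Ck k S f \<Longrightarrow> Ck k S g \<Longrightarrow> Ck k S (\<lambda>x. b (f x) (g x))"
proof (induction k arbitrary: f g)
  case 0
  then show ?case by (auto intro: bounded_bilinear.continuous_on[OF b])
next
  case (Suc k)
  have d: "((\<lambda>x. b (f x) (g x)) has_derivative (\<lambda>v. b (f x) (D g x v) + b (D f x v) (g x))) (at x)"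
    if "x \<in> S" for x
    using that Suc.prems by (intro bounded_bilinear.FDERIV[OF b] has_D) auto
  have "Ck k S (\<lambda>x. D (\<lambda>x. b (f x) (g x)) x v)" for v
  proof (rule Ck_cong[OF S])
    show "Ck k S (\<lambda>x. b (f x) (D g x v) + b (D f x v) (g x))"
      using Suc Ck_Suc_imp[OF Suc.prems(1)] Ck_Suc_imp[OF Suc.prems(2)] by (intro Ck_add[OF S]) auto
    show "b (f x) (D g x v) + b (D f x v) (g x) = D (\<lambda>x. b (f x) (g x)) x v" if "x \<in> S" for x
      using D_unique[OF d[OF that]] by simp
  qed
  then show ?case using d by (auto simp: differentiable_def)
qed

lemma Ck_sum: "open S \<Longrightarrow> (\<And>i. i \<in> A \<Longrightarrow> Ck k S (f i)) \<Longrightarrow> Ck k S (\<lambda>x. \<Sum>i\<in>A. f i x)"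
  by (induction A rule: infinite_finite_induct) (auto simp: Ck_const intro: Ck_add)

lemma linear_Basis_expand:
  assumes "linear (L::'a::euclidean_space \<Rightarrow> 'b::real_vector)"
  shows "L v = (\<Sum>i\<in>Basis. (v \<bullet> i) *\<^sub>R L i)"
proof -
  have "L v = L (\<Sum>i\<in>Basis. (v \<bullet> i) *\<^sub>R i)" by (simp add: euclidean_representation)
  also have "\<dots> = (\<Sum>i\<in>Basis. (v \<bullet> i) *\<^sub>R L i)"
    using assms by (simp add: linear_sum linear_scale)
  finally show ?thesis .
qed

text \<open>By the chain rule a directional derivative of the composite is a sum, over an orthonormal basis,
  of products of first derivatives of the two maps. These have one order of differentiability
  less, so that the rules for sums and products carry the induction.\<close>

lemma Ck_compose:
  fixes g :: "'a::real_normed_vector \<Rightarrow> 'b::euclidean_space"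
    and f :: "'b \<Rightarrow> 'c::real_normed_vector"
  assumes S: "open S" and gS: "g ` S \<subseteq> T"
  shows "Ck k T f \<Longrightarrow> Ck k S g \<Longrightarrow> Ck k S (\<lambda>x. f (g x))"
proof (induction k arbitrary: f)
  case 0
  then show ?case using gS by (auto intro: continuous_on_compose2)
next
  case (Suc k)
  have d: "((\<lambda>x. f (g x)) has_derivative (\<lambda>v. D f (g x) (D g x v))) (at x)" if "x \<in> S" for x
    using that Suc.prems gS has_derivative_compose[OF has_D[of g x] has_D[of f "g x"]] by auto
  have "Ck k S (\<lambda>x. D (\<lambda>x. f (g x)) x v)" for v
  proof (rule Ck_cong[OF S])
    show "Ck k S (\<lambda>x. \<Sum>i\<in>Basis. (D g x v \<bullet> i) *\<^sub>R D f (g x) i)"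
    proof (intro Ck_sum[OF S] Ck_bilinear[OF bounded_bilinear_scaleR S]
        Ck_bilinear[OF bounded_bilinear_inner S] Ck_const)
      show "Ck k S (\<lambda>x. D g x v)" using Suc.prems by simp
      show "Ck k S (\<lambda>x. D f (g x) i)" for i
        using Suc.prems Ck_Suc_imp[OF Suc.prems(2)] Suc.IH[of "\<lambda>y. D f y i"] by simp
    qed
    show "(\<Sum>i\<in>Basis. (D g x v \<bullet> i) *\<^sub>R D f (g x) i) = D (\<lambda>x. f (g x)) x v" if "x \<in> S" for x
    proof -
      have "f differentiable (at (g x))" using Suc.prems that gS by auto
      from linear_Basis_expand[OF linear_frechet_derivative[OF this], of "D g x v"]
      show ?thesis unfolding D_unique[OF d[OF that]] by (rule sym)
    qed
  qed
  then show ?case using d by (auto simp: differentiable_def)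
qed

lemma Ck_sin_cos: "Ck k UNIV (sin::real\<Rightarrow>real) \<and> Ck k UNIV (cos::real\<Rightarrow>real)"
proof (induction k)
  case 0
  then show ?case by (auto intro: continuous_intros)
next
  case (Suc k)
  have s: "(sin has_derivative (\<lambda>v. v * cos x)) (at x)" for x :: real
    by (auto intro!: derivative_eq_intros)
  have c: "(cos has_derivative (\<lambda>v. v * - sin x)) (at x)" for x :: real
    by (auto intro!: derivative_eq_intros)
  have "Ck k UNIV (\<lambda>x::real. v * cos x)" "Ck k UNIV (\<lambda>x::real. (-v) * sin x)" for v :: real
    using Suc by (intro Ck_bilinear[OF bounded_bilinear_mult] Ck_const open_UNIV; blast)+
  moreover have "D sin x v = v * cos x" "D cos x v = (-v) * sin x" for x v :: real
    using D_unique[OF s] D_unique[OF c] by simp_all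
  ultimately show ?case
    using differentiableI[OF s] differentiableI[OF c] by simp
qed

text \<open>All exponents are treated at once because differentiation lowers the exponent by one.\<close>

lemma Ck_powr: "Ck k {0<..} (\<lambda>x::real. x powr r)"
proof (induction k arbitrary: r)
  case 0
  then show ?case by (auto intro!: continuous_intros)
next
  case (Suc k)
  have d: "((\<lambda>x. x powr r) has_derivative (\<lambda>v. (v * r) * x powr (r - 1))) (at x)" if "x > 0" for x :: real
  proof -
    have "(\<lambda>v. (v * r) * x powr (r - 1)) = (*) (r * x powr (r - 1))" by (auto simp: mult_ac)
    then show ?thesis
      using has_real_derivative_powr[OF that, of r] by (simp add: has_field_derivative_def)
  qed
  have "Ck k {0<..} (\<lambda>x. D (\<lambda>x. x powr r) x v)" for v
  proof (rule Ck_cong)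
    show "Ck k {0<..} (\<lambda>x. (v * r) * x powr (r - 1))"
      by (intro Ck_bilinear[OF bounded_bilinear_mult] Ck_const Suc) auto
    show "(v * r) * x powr (r - 1) = D (\<lambda>x. x powr r) x v" if "x \<in> {0<..}" for x
      using D_unique[OF d] that by simp
  qed auto
  then show ?case using d by (auto simp: differentiable_def)
qed

lemma smooth_subset: "smooth_map_on T f \<Longrightarrow> S \<subseteq> T \<Longrightarrow> smooth_map_on S f"
  unfolding smooth_map_on_def by (blast intro: Ck_subset)

lemma smooth_const: "smooth_map_on S (\<lambda>_. c)"
  by (simp add: smooth_map_on_def Ck_const)

lemma smooth_linear: "bounded_linear f \<Longrightarrow> smooth_map_on S f"
  by (simp add: smooth_map_on_def Ck_linear)

lemma smooth_add:
  "open S \<Longrightarrow> smooth_map_on S f \<Longrightarrow> smooth_map_on S g \<Longrightarrow> smooth_map_on S (\<lambda>x. f x + g x)"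
  by (simp add: smooth_map_on_def Ck_add)

lemma smooth_bilinear:
  "bounded_bilinear b \<Longrightarrow> open S \<Longrightarrow> smooth_map_on S f \<Longrightarrow> smooth_map_on S g
    \<Longrightarrow> smooth_map_on S (\<lambda>x. b (f x) (g x))"
  by (simp add: smooth_map_on_def Ck_bilinear)

lemmas smooth_mult = smooth_bilinear[OF bounded_bilinear_mult]
lemmas smooth_scaleR = smooth_bilinear[OF bounded_bilinear_scaleR]
lemmas smooth_inner = smooth_bilinear[OF bounded_bilinear_inner]

lemma smooth_compose:
  fixes g :: "'a::real_normed_vector \<Rightarrow> 'b::euclidean_space"
  shows "open S \<Longrightarrow> smooth_map_on T f \<Longrightarrow> smooth_map_on S g \<Longrightarrow> g ` S \<subseteq> T
    \<Longrightarrow> smooth_map_on S (\<lambda>x. f (g x))"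
  unfolding smooth_map_on_def using Ck_compose by blast

lemma smooth_compose_linear:
  fixes g :: "'a::real_normed_vector \<Rightarrow> 'b::euclidean_space"
  assumes "open S" "bounded_linear L" "smooth_map_on S g"
  shows "smooth_map_on S (\<lambda>x. L (g x))"
  using smooth_compose[OF assms(1) smooth_linear[OF assms(2), of UNIV] assms(3)] by simp

lemma smooth_diff:
  fixes g :: "'a::real_normed_vector \<Rightarrow> 'b::euclidean_space"
  assumes "open S" "smooth_map_on S f" "smooth_map_on S g"
  shows "smooth_map_on S (\<lambda>x. f x - g x)"
  using smooth_add[OF assms(1,2) smooth_compose_linear[OF assms(1) _ assms(3), of uminus]]
  by (simp add: bounded_linear_minus bounded_linear_ident)

lemma smooth_sin_cos:
  assumes "open S" "smooth_map_on S (f::'a::real_normed_vector \<Rightarrow> real)"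
  shows "smooth_map_on S (\<lambda>x. sin (f x))" "smooth_map_on S (\<lambda>x. cos (f x))"
  using smooth_compose[OF assms(1) _ assms(2), of UNIV] Ck_sin_cos
  by (auto simp: smooth_map_on_def)

lemma smooth_powr:
  assumes "open S" "smooth_map_on S (f::'a::real_normed_vector \<Rightarrow> real)" "\<And>x. x \<in> S \<Longrightarrow> f x > 0"
  shows "smooth_map_on S (\<lambda>x. f x powr r)"
  using smooth_compose[OF assms(1) _ assms(2), of "{0<..}" "\<lambda>y. y powr r"] Ck_powr assms(3)
  by (force simp: smooth_map_on_def)

lemma smooth_differentiable: "smooth_map_on S f \<Longrightarrow> p \<in> S \<Longrightarrow> f differentiable (at p)"
  unfolding smooth_map_on_def by (drule spec[of _ "Suc 0"]) simp

lemma smooth_has_D: "smooth_map_on S f \<Longrightarrow> p \<in> S \<Longrightarrow> (f has_derivative D f p) (at p)"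
  using has_D smooth_differentiable by blast

lemma smooth_continuous: "smooth_map_on S f \<Longrightarrow> continuous_on S f"
  unfolding smooth_map_on_def by (drule spec[of _ 0]) simp

lemma smooth_D: "smooth_map_on S f \<Longrightarrow> smooth_map_on S (\<lambda>x. D f x v)"
  unfolding smooth_map_on_def
proof
  fix k assume "\<forall>k. Ck k S f"
  then have "Ck (Suc k) S f" by blast
  then show "Ck k S (\<lambda>x. D f x v)" by simp
qed

lemma D_real_scale:
  assumes "(f::real \<Rightarrow> 'a::real_normed_vector) differentiable (at x)"
  shows "D f x v = v *\<^sub>R D f x 1"
  using linear_scale[OF linear_frechet_derivative[OF assms], of v 1] by simp

lemma smooth_if_vector_derivative:
  fixes f :: "real \<Rightarrow> 'a::euclidean_space"
  assumes "open S" "\<And>x. x \<in> S \<Longrightarrow> (f has_vector_derivative f' x) (at x)" "smooth_map_on S f'"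
  shows "smooth_map_on S f"
proof -
  have "Ck k S f" for k
  proof (cases k)
    case 0
    then show ?thesis
      using assms(2) by (auto intro!: continuous_at_imp_continuous_on has_vector_derivative_continuous)
  next
    case (Suc m)
    have "Ck m S (\<lambda>x. D f x v)" for v
    proof (rule Ck_cong[OF assms(1)])
      show "Ck m S (\<lambda>x. v *\<^sub>R f' x)"
        using assms by (intro Ck_bilinear[OF bounded_bilinear_scaleR] Ck_const)
          (auto simp: smooth_map_on_def)
      show "v *\<^sub>R f' x = D f x v" if "x \<in> S" for x
        using D_unique[OF assms(2)[OF that, unfolded has_vector_derivative_def]] by simp
    qed
    then show ?thesis using assms(2) Suc
      by (auto simp: has_vector_derivative_def differentiable_def)
  qed
  then show ?thesis by (simp add: smooth_map_on_def)
qed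

lemma smooth_vector_derivative:
  fixes f :: "real \<Rightarrow> 'a::real_normed_vector"
  assumes "smooth_map_on S f" "x \<in> S"
  shows "(f has_vector_derivative D f x 1) (at x)"
proof -
  have "(f has_derivative D f x) (at x)" using smooth_has_D[OF assms] .
  moreover have "D f x = (\<lambda>v. v *\<^sub>R D f x 1)"
    by (rule ext) (rule D_real_scale[OF smooth_differentiable[OF assms]])
  ultimately show ?thesis unfolding has_vector_derivative_def by simp
qed

text \<open>The second difference of a scalar function over a small parallelogram is the mixed derivative
  at some point of it, by two applications of the mean value theorem. As the second difference is
  symmetric in the two directions, so is a continuous second derivative.\<close>

lemma second_difference_mean_value:
  fixes f :: "'a::real_normed_vector \<Rightarrow> real"
  assumes f: "\<And>s t. 0 \<le> s \<Longrightarrow> s \<le> h \<Longrightarrow> 0 \<le> t \<Longrightarrow> t \<le> h \<Longrightarrow> f differentiable (at (p + s *\<^sub>R u + t *\<^sub>R v))"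
    and f': "\<And>s t. 0 \<le> s \<Longrightarrow> s \<le> h \<Longrightarrow> 0 \<le> t \<Longrightarrow> t \<le> h \<Longrightarrow>
      (\<lambda>q. D f q u) differentiable (at (p + s *\<^sub>R u + t *\<^sub>R v))"
    and h: "h > 0"
  shows "\<exists>s t. 0 < s \<and> s < h \<and> 0 < t \<and> t < h \<and>
    f (p + h *\<^sub>R u + h *\<^sub>R v) - f (p + h *\<^sub>R u) - f (p + h *\<^sub>R v) + f p
      = h * h * D (\<lambda>q. D f q u) (p + s *\<^sub>R u + t *\<^sub>R v) v"
proof -
  define \<phi> where "\<phi> s = f (p + s *\<^sub>R u + h *\<^sub>R v) - f (p + s *\<^sub>R u + 0 *\<^sub>R v)" for s
  have "(\<phi> has_real_derivative (D f (p + s *\<^sub>R u + h *\<^sub>R v) u - D f (p + s *\<^sub>R u + 0 *\<^sub>R v) u)) (at s)"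
    if "0 \<le> s" "s \<le> h" for s
  proof -
    have l: "((\<lambda>s. p + s *\<^sub>R u + t *\<^sub>R v) has_derivative (\<lambda>k. k *\<^sub>R u)) (at s)" for t
      by (auto intro!: derivative_eq_intros)
    have "((\<lambda>s. f (p + s *\<^sub>R u + t *\<^sub>R v)) has_derivative (\<lambda>k. D f (p + s *\<^sub>R u + t *\<^sub>R v) (k *\<^sub>R u))) (at s)"
      if "0 \<le> t" "t \<le> h" for t
      using has_derivative_compose[OF l has_D[OF f]] that \<open>0 \<le> s\<close> \<open>s \<le> h\<close> by blast
    moreover have "D f (p + s *\<^sub>R u + t *\<^sub>R v) (k *\<^sub>R u) = D f (p + s *\<^sub>R u + t *\<^sub>R v) u * k"
      if "0 \<le> t" "t \<le> h" for t k
      using linear_scale[OF linear_frechet_derivative[OF f]] that \<open>0 \<le> s\<close> \<open>s \<le> h\<close> by simp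
    ultimately have "((\<lambda>s. f (p + s *\<^sub>R u + t *\<^sub>R v)) has_real_derivative D f (p + s *\<^sub>R u + t *\<^sub>R v) u) (at s)"
      if "0 \<le> t" "t \<le> h" for t
      using that unfolding has_field_derivative_def by simp
    from this[of h] this[of 0] show ?thesis
      using h unfolding \<phi>_def by (intro DERIV_diff) auto
  qed
  then obtain s where s: "0 < s" "s < h" and
    e1: "\<phi> h - \<phi> 0 = (h - 0) * (D f (p + s *\<^sub>R u + h *\<^sub>R v) u - D f (p + s *\<^sub>R u + 0 *\<^sub>R v) u)"
    using MVT2[OF h, of \<phi> "\<lambda>s. D f (p + s *\<^sub>R u + h *\<^sub>R v) u - D f (p + s *\<^sub>R u + 0 *\<^sub>R v) u"] by metis
  define \<theta> where "\<theta> t = D f (p + s *\<^sub>R u + t *\<^sub>R v) u" for t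
  have "(\<theta> has_real_derivative D (\<lambda>q. D f q u) (p + s *\<^sub>R u + t *\<^sub>R v) v) (at t)"
    if "0 \<le> t" "t \<le> h" for t
  proof -
    have l: "((\<lambda>t. p + s *\<^sub>R u + t *\<^sub>R v) has_derivative (\<lambda>k. k *\<^sub>R v)) (at t)"
      by (auto intro!: derivative_eq_intros)
    have f1: "(\<lambda>q. D f q u) differentiable (at (p + s *\<^sub>R u + t *\<^sub>R v))" using f' that s by simp
    have "D (\<lambda>q. D f q u) (p + s *\<^sub>R u + t *\<^sub>R v) (k *\<^sub>R v)
      = D (\<lambda>q. D f q u) (p + s *\<^sub>R u + t *\<^sub>R v) v * k" for k
      using linear_scale[OF linear_frechet_derivative[OF f1]] by simp
    then show ?thesis
      using has_derivative_compose[OF l has_D[OF f1]] unfolding has_field_derivative_def \<theta>_def by simp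
  qed
  then obtain t where t: "0 < t" "t < h" and
    e2: "\<theta> h - \<theta> 0 = (h - 0) * D (\<lambda>q. D f q u) (p + s *\<^sub>R u + t *\<^sub>R v) v"
    using MVT2[OF h, of \<theta> "\<lambda>t. D (\<lambda>q. D f q u) (p + s *\<^sub>R u + t *\<^sub>R v) v"] by metis
  have "f (p + h *\<^sub>R u + h *\<^sub>R v) - f (p + h *\<^sub>R u) - f (p + h *\<^sub>R v) + f p = \<phi> h - \<phi> 0"
    by (simp add: \<phi>_def)
  also have "\<dots> = h * h * D (\<lambda>q. D f q u) (p + s *\<^sub>R u + t *\<^sub>R v) v"
    using e1 e2 by (simp add: \<theta>_def)
  finally show ?thesis using s t by blast
qed

lemma second_derivative_symmetric_real:
  fixes f :: "'a::real_normed_vector \<Rightarrow> real"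
  assumes S: "open S" "p \<in> S" and f: "Ck 2 S f"
  shows "D (\<lambda>q. D f q u) p v = D (\<lambda>q. D f q v) p u"
proof -
  have f1: "f differentiable (at q)" "(\<lambda>q. D f q w) differentiable (at q)" if "q \<in> S" for q w
    using f that by (auto simp: numeral_2_eq_2)
  have cont: "continuous_on S (\<lambda>q. D (\<lambda>q. D f q w) q w')" for w w'
    using f by (simp add: numeral_2_eq_2)
  have lim: "(D (\<lambda>q. D f q w) p w' - D (\<lambda>q. D f q w') p w) \<le> e" if "e > 0" for e w w'
  proof -
    obtain d1 where d1: "d1 > 0" "\<And>q. q \<in> S \<Longrightarrow> dist q p < d1 \<Longrightarrow>
        dist (D (\<lambda>q. D f q w) q w') (D (\<lambda>q. D f q w) p w') < e / 2"
      using cont[of w w'] S(2) \<open>e > 0\<close> unfolding continuous_on_iff by (meson half_gt_zero)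
    obtain d2 where d2: "d2 > 0" "\<And>q. q \<in> S \<Longrightarrow> dist q p < d2 \<Longrightarrow>
        dist (D (\<lambda>q. D f q w') q w) (D (\<lambda>q. D f q w') p w) < e / 2"
      using cont[of w' w] S(2) \<open>e > 0\<close> unfolding continuous_on_iff by (meson half_gt_zero)
    obtain d3 where d3: "d3 > 0" "ball p d3 \<subseteq> S" using S open_contains_ball by blast
    define d where "d = min d1 (min d2 d3)"
    define h where "h = d / (2 * (norm w + norm w' + 1))"
    have n: "norm w + norm w' + 1 > 0" by (smt (verit) norm_ge_zero)
    have dpos: "d > 0" using d1 d2 d3 by (simp add: d_def)
    have h: "h > 0" using dpos n by (simp add: h_def)
    have near: "dist (p + s *\<^sub>R w + t *\<^sub>R w') p < d" if "0 \<le> s" "s \<le> h" "0 \<le> t" "t \<le> h" for s t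
    proof -
      have "dist (p + s *\<^sub>R w + t *\<^sub>R w') p \<le> s * norm w + t * norm w'"
        using that norm_triangle_ineq[of "s *\<^sub>R w" "t *\<^sub>R w'"] by (simp add: dist_norm algebra_simps)
      also have "\<dots> \<le> h * norm w + h * norm w'" using that by (intro add_mono mult_right_mono) auto
      also have "\<dots> \<le> h * (norm w + norm w' + 1)" using h by (simp add: algebra_simps)
      also have "\<dots> = d / 2" using n unfolding h_def by (simp add: field_split_simps)
      finally show ?thesis using dpos by simp
    qed
    have inS: "p + s *\<^sub>R w + t *\<^sub>R w' \<in> S" if "0 \<le> s" "s \<le> h" "0 \<le> t" "t \<le> h" for s t
      using near[OF that] d3(2) by (auto simp: d_def dist_commute)
    have inS': "p + s *\<^sub>R w' + t *\<^sub>R w \<in> S" if "0 \<le> s" "s \<le> h" "0 \<le> t" "t \<le> h" for s t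
      using inS[of t s] that by (simp add: algebra_simps)
    obtain s t where st: "0 < s" "s < h" "0 < t" "t < h" and
      e1: "f (p + h *\<^sub>R w + h *\<^sub>R w') - f (p + h *\<^sub>R w) - f (p + h *\<^sub>R w') + f p
        = h * h * D (\<lambda>q. D f q w) (p + s *\<^sub>R w + t *\<^sub>R w') w'"
      using second_difference_mean_value[of h f p w w'] f1 inS h by blast
    obtain s' t' where st': "0 < s'" "s' < h" "0 < t'" "t' < h" and
      e2: "f (p + h *\<^sub>R w' + h *\<^sub>R w) - f (p + h *\<^sub>R w') - f (p + h *\<^sub>R w) + f p
        = h * h * D (\<lambda>q. D f q w') (p + s' *\<^sub>R w' + t' *\<^sub>R w) w"
      using second_difference_mean_value[of h f p w' w] f1 inS' h by blast
    have "h * h * D (\<lambda>q. D f q w) (p + s *\<^sub>R w + t *\<^sub>R w') w'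
      = h * h * D (\<lambda>q. D f q w') (p + s' *\<^sub>R w' + t' *\<^sub>R w) w"
      using e1 e2 by (simp add: algebra_simps)
    then have eq: "D (\<lambda>q. D f q w) (p + s *\<^sub>R w + t *\<^sub>R w') w' = D (\<lambda>q. D f q w') (p + s' *\<^sub>R w' + t' *\<^sub>R w) w"
      using h by simp
    have 1: "dist (D (\<lambda>q. D f q w) (p + s *\<^sub>R w + t *\<^sub>R w') w') (D (\<lambda>q. D f q w) p w') < e / 2"
      using st near inS by (intro d1(2)) (auto simp: d_def)
    have "dist (p + s' *\<^sub>R w' + t' *\<^sub>R w) p < d"
      using near[of t' s'] st' by (simp add: algebra_simps)
    then have 2: "dist (D (\<lambda>q. D f q w') (p + s' *\<^sub>R w' + t' *\<^sub>R w) w) (D (\<lambda>q. D f q w') p w) < e / 2"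
      using st' inS' by (intro d2(2)) (auto simp: d_def)
    show ?thesis using 1 2 unfolding eq dist_real_def abs_less_iff by linarith
  qed
  have "D (\<lambda>q. D f q u) p v \<le> D (\<lambda>q. D f q v) p u"
    using lim[of _ u v] by (metis add.commute diff_le_eq field_le_epsilon)
  moreover have "D (\<lambda>q. D f q v) p u \<le> D (\<lambda>q. D f q u) p v"
    using lim[of _ v u] by (metis add.commute diff_le_eq field_le_epsilon)
  ultimately show ?thesis by simp
qed

lemma D_bounded_linear_compose:
  assumes "bounded_linear L" "f differentiable (at p)"
  shows "D (\<lambda>q. L (f q)) p v = L (D f p v)"
  using D_unique[OF bounded_linear.has_derivative[OF assms(1) has_D[OF assms(2)]]] by simp

text \<open>The scalar case is applied to the components of the map.\<close>

lemma second_derivative_symmetric: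
  fixes f :: "'a::real_normed_vector \<Rightarrow> 'b::euclidean_space"
  assumes S: "open S" "p \<in> S" and f: "smooth_map_on S f"
  shows "D (\<lambda>q. D f q u) p v = D (\<lambda>q. D f q v) p u"
proof (rule euclidean_eqI)
  fix b :: 'b
  let ?L = "\<lambda>y::'b. y \<bullet> b"
  have L: "bounded_linear ?L" by (rule bounded_linear_inner_left)
  have s: "smooth_map_on S (\<lambda>q. ?L (f q))" using smooth_compose_linear[OF S(1) L f] .
  have e: "D (\<lambda>q. D f q w) p w' \<bullet> b = D (\<lambda>q. D (\<lambda>q. ?L (f q)) q w) p w'" for w w'
  proof -
    have "D (\<lambda>q. ?L (f q)) q w = ?L (D f q w)" if "q \<in> S" for q
      using smooth_differentiable[OF f that] D_bounded_linear_compose[OF L] by blast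
    then have "D (\<lambda>q. D (\<lambda>q. ?L (f q)) q w) p w' = D (\<lambda>q. ?L (D f q w)) p w'"
      using D_cong_open[OF S, of "\<lambda>q. D (\<lambda>q. ?L (f q)) q w" "\<lambda>q. ?L (D f q w)"] by simp
    also have "\<dots> = ?L (D (\<lambda>q. D f q w) p w')"
      by (rule D_bounded_linear_compose[OF L smooth_differentiable[OF smooth_D[OF f] S(2)]])
    finally show ?thesis by simp
  qed
  show "D (\<lambda>q. D f q u) p v \<bullet> b = D (\<lambda>q. D f q v) p u \<bullet> b"
    unfolding e using s by (intro second_derivative_symmetric_real[OF S]) (simp add: smooth_map_on_def)
qed

section \<open>The Levi-Civita connection of the deformed sphere in ambient terms\<close>

text \<open>This gives meaning to the definite descriptions in \<open>christoffel\<close> and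
  \<open>metric_trace\<close>.\<close>

lemma bilinear_positive_definite_representation:
  fixes b :: "'a::euclidean_space \<Rightarrow> 'a \<Rightarrow> real"
  assumes b: "bilinear b" and pos: "\<And>x. x \<noteq> 0 \<Longrightarrow> b x x > 0" and l: "linear l"
  shows "\<exists>!w. \<forall>z. b w z = l z"
proof -
  define B where "B w = (\<Sum>i\<in>Basis. b w i *\<^sub>R i)" for w
  have lin1: "linear (\<lambda>w. b w z)" and lin2: "linear (b z)" for z using b by (auto simp: bilinear_def)
  have Bi: "B w \<bullet> z = b w z" for w z
    using linear_Basis_expand[OF lin2, of w z] by (simp add: B_def inner_sum_left) (simp add: inner_commute mult.commute)
  have "linear B"
    by (rule linearI) (simp_all add: B_def linear_add[OF lin1] linear_scale[OF lin1]
        scaleR_left_distrib sum.distrib scaleR_sum_right)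
  moreover have "inj B"
  proof (rule linear_injective_0[OF \<open>linear B\<close>, THEN iffD2], intro allI impI)
    fix w assume "B w = 0"
    then have "b w w = 0" using Bi[of w w] by simp
    then show "w = 0" using pos by force
  qed
  ultimately have s: "surj B" using linear_injective_imp_surjective by blast
  have un: "w = w'" if "\<forall>z. b w z = l z" "\<forall>z. b w' z = l z" for w w'
  proof -
    have "B w = B w'" using that by (simp add: B_def)
    then show ?thesis using \<open>inj B\<close> by (simp add: inj_eq)
  qed
  define y where "y = (\<Sum>i\<in>Basis. l i *\<^sub>R i)"
  obtain w where "B w = y" using s by (metis surjD)
  then have "b w z = l z" for z
    using Bi[of w z] linear_Basis_expand[OF l, of z]
    by (simp add: y_def inner_sum_left) (simp add: inner_commute mult.commute)
  then show ?thesis using un by blast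
qed

lemma linear_JJ: "linear JJ"
  by (rule linearI) (auto simp: vec_eq_iff forall_4)

lemma bounded_linear_JJ: "bounded_linear JJ"
  using linear_JJ linear_conv_bounded_linear by blast

lemmas JJ_add = linear_add[OF linear_JJ] and JJ_scaleR = linear_scale[OF linear_JJ]
  and JJ_diff = linear_diff[OF linear_JJ] and JJ_minus = linear_neg[OF linear_JJ]
  and JJ_zero = linear_0[OF linear_JJ]

lemmas JJ_simps [simp] = JJ_add JJ_scaleR JJ_diff JJ_minus JJ_zero

lemma inner_JJ_self [simp]: "z \<bullet> JJ z = 0" "JJ z \<bullet> z = 0"
  by (simp_all add: inner_vec_def sum_4)

lemma JJ_has_derivative: "(f has_derivative f') F \<Longrightarrow> ((\<lambda>x. JJ (f x)) has_derivative (\<lambda>v. JJ (f' v))) F"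
  by (rule bounded_linear.has_derivative[OF bounded_linear_JJ])

lemma inner_JJ_left: "JJ x \<bullet> y = - (x \<bullet> JJ y)"
  by (simp add: inner_JJ_right)

lemma inner_S3: "z \<in> S3 \<Longrightarrow> z \<bullet> z = 1"
  by (simp add: dot_square_norm)

text \<open>For a point \<open>z\<close> of the sphere and tangent vectors \<open>u\<close>,
  \<open>v\<close>, the first summand corrects the Euclidean derivative to the Levi-Civita
  connection of the round sphere, and the remaining ones are the difference between the
  connections of the deformed and of the round metric. The last multiple of \<open>z\<close>
  makes this difference tangent to the sphere.\<close>

definition conn_form :: "real \<Rightarrow> real ^ 4 \<Rightarrow> real ^ 4 \<Rightarrow> real ^ 4 \<Rightarrow> real ^ 4" where
  "conn_form a z u v = (u \<bullet> v) *\<^sub>R z + (a - 1) *\<^sub>R ((v \<bullet> JJ z) *\<^sub>R JJ u + (u \<bullet> JJ z) *\<^sub>R JJ v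
     + (2 * (v \<bullet> JJ z) * (u \<bullet> JJ z)) *\<^sub>R z)"

text \<open>The covariant derivative in the direction \<open>x\<close> of a vector field \<open>V\<close>
  along the map \<open>X\<close> into the sphere; no chart of the sphere enters.\<close>

definition ambient_cov :: "real \<Rightarrow> ('m::euclidean_space \<Rightarrow> real ^ 4) \<Rightarrow> ('m \<Rightarrow> real ^ 4) \<Rightarrow> 'm \<Rightarrow> 'm \<Rightarrow> real ^ 4" where
  "ambient_cov a X V p x = D V p x + conn_form a (X p) (D X p x) (V p)"

lemma gS_expand: "gS a z u v = a * (u \<bullet> v) + a * (a - 1) * ((u \<bullet> JJ z) * (v \<bullet> JJ z))"
  by (simp add: gS_def eta0_def xi0_def)

lemma gS_add_left: "gS a z (x + y) w = gS a z x w + gS a z y w"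
  and gS_diff_left: "gS a z (x - y) w = gS a z x w - gS a z y w"
  and gS_scale_left: "gS a z (r *\<^sub>R x) w = r * gS a z x w"
  and gS_add_right: "gS a z w (x + y) = gS a z w x + gS a z w y"
  and gS_scale_right: "gS a z w (r *\<^sub>R x) = r * gS a z w x"
  by (simp_all add: gS_expand algebra_simps inner_diff_left)

text \<open>The multiples of \<open>z\<close> disappear, and \<open>conn_form\<close> without them is
  orthogonal to \<open>JJ z\<close>, where the metric would differ from \<open>a\<close> times
  the Euclidean product.\<close>

lemma gS_conn_form:
  assumes "z \<in> S3" "u \<bullet> z = 0" "v \<bullet> z = 0" "w \<bullet> z = 0"
  shows "gS a z (conn_form a z u v) w = a * (a - 1) * ((v \<bullet> JJ z) * (JJ u \<bullet> w) + (u \<bullet> JJ z) * (JJ v \<bullet> w))"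
  using assms by (simp add: gS_expand conn_form_def inner_add_left inner_commute[of z])

lemma conn_form_inner_base:
  assumes "z \<in> S3"
  shows "conn_form a z u v \<bullet> z = u \<bullet> v"
  using inner_S3[OF assms]
  by (simp add: conn_form_def inner_add_left inner_JJ_left[of u z] inner_JJ_left[of v z])

text \<open>The only negative contribution, the one of \<open>JJ z\<close>, is bounded by the Cauchy-Schwarz
  inequality.\<close>

lemma gS_pos:
  assumes a: "0 < a" "a < 1" and z: "z \<in> S3" and x: "x \<noteq> 0"
  shows "gS a z x x > 0"
proof -
  have "(x \<bullet> JJ z)\<^sup>2 \<le> x \<bullet> x"
    using Cauchy_Schwarz_ineq[of x "JJ z"] inner_S3[OF z] by simp
  then have "(1 - a) * (x \<bullet> JJ z)\<^sup>2 \<le> (1 - a) * (x \<bullet> x)" using a by (intro mult_left_mono) auto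
  moreover have "a * (x \<bullet> x) > 0" using a x by simp
  ultimately have "x \<bullet> x - (1 - a) * (x \<bullet> JJ z)\<^sup>2 > 0" by (simp add: algebra_simps)
  then have "a * (x \<bullet> x - (1 - a) * (x \<bullet> JJ z)\<^sup>2) > 0" using a by simp
  then show ?thesis by (simp add: gS_expand power2_eq_square algebra_simps)
qed

lemma gS_has_derivative:
  assumes "(X has_derivative X') (at p)" "(V has_derivative V') (at p)" "(Y has_derivative Y') (at p)"
  shows "((\<lambda>q. gS a (X q) (V q) (Y q)) has_derivative (\<lambda>x.
      a * (V p \<bullet> Y' x + V' x \<bullet> Y p) + a * (a - 1) *
       ((V p \<bullet> JJ (X p)) * (Y p \<bullet> JJ (X' x) + Y' x \<bullet> JJ (X p))
        + (V p \<bullet> JJ (X' x) + V' x \<bullet> JJ (X p)) * (Y p \<bullet> JJ (X p))))) (at p)"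
  unfolding gS_expand
  by (intro has_derivative_add has_derivative_mult_right has_derivative_mult has_derivative_inner
      assms JJ_has_derivative)

lemma local_param_properties:
  assumes "local_param N (W, X)"
  shows "open W" "smooth_map_on W X" "inj_on X W" "\<And>p. p \<in> W \<Longrightarrow> inj (D X p)"
    "\<And>p. p \<in> W \<Longrightarrow> X p \<in> N"
  using assms by (auto simp: local_param_def)

lemma D_inner_zero:
  fixes V Y :: "'m::real_normed_vector \<Rightarrow> 'b::real_inner"
  assumes "open W" "p \<in> W" "\<And>q. q \<in> W \<Longrightarrow> V q \<bullet> Y q = k"
    and "V differentiable (at p)" "Y differentiable (at p)"
  shows "D V p u \<bullet> Y p = - (V p \<bullet> D Y p u)"
proof -
  have "((\<lambda>q. V q \<bullet> Y q) has_derivative (\<lambda>x. V p \<bullet> D Y p x + D V p x \<bullet> Y p)) (at p)"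
    by (intro has_derivative_inner has_D assms)
  from D_unique[OF this] have "V p \<bullet> D Y p u + D V p u \<bullet> Y p = D (\<lambda>q. V q \<bullet> Y q) p u" by simp
  also have "D (\<lambda>q. V q \<bullet> Y q) p = D (\<lambda>q. k) p"
    by (rule D_cong_open[OF assms(1,2)]) (rule assms(3))
  finally show ?thesis by simp
qed

lemma D_tangent:
  assumes "open W" "p \<in> W" "X differentiable (at p)" "\<And>q. q \<in> W \<Longrightarrow> X q \<in> S3"
  shows "D X p u \<bullet> X p = 0"
proof -
  have "X q \<bullet> X q = 1" if "q \<in> W" for q using assms(4)[OF that] by (rule inner_S3)
  then have "D X p u \<bullet> X p = - (X p \<bullet> D X p u)"
    using D_inner_zero[OF assms(1,2) _ assms(3) assms(3)] by blast
  then show ?thesis by (simp add: inner_commute)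
qed

lemma cov_tangent:
  assumes "open W" "p \<in> W" "X differentiable (at p)" "\<And>q. q \<in> W \<Longrightarrow> X q \<in> S3"
    "V differentiable (at p)" "\<And>q. q \<in> W \<Longrightarrow> V q \<bullet> X q = 0"
  shows "ambient_cov a X V p x \<bullet> X p = 0"
  using D_inner_zero[OF assms(1,2,6,5,3), of x] conn_form_inner_base[OF assms(4)[OF assms(2)]]
  by (simp add: ambient_cov_def inner_add_left inner_commute[of "V p"])

text \<open>Differentiating the metric coefficients produces second derivatives of \<open>X\<close>, of
  which the symmetry leaves one twice, and derivatives of \<open>JJ X\<close>, of which the
  skewness of \<open>JJ\<close> leaves those in \<open>gS_conn_form\<close>.\<close>

lemma Koszul_ambient:
  fixes a :: real
  assumes W: "open W" "p \<in> W" and X: "smooth_map_on W X" "\<And>q. q \<in> W \<Longrightarrow> X q \<in> S3"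
  defines "G \<equiv> induced_metric (gS a) X"
  shows "D (\<lambda>q. G q v z) p u + D (\<lambda>q. G q u z) p v - D (\<lambda>q. G q u v) p z
    = 2 * gS a (X p) (ambient_cov a X (\<lambda>q. D X q v) p u) (D X p z)"
proof -
  have dX: "(X has_derivative D X p) (at p)" using smooth_has_D[OF X(1) W(2)] .
  have dD: "((\<lambda>q. D X q w) has_derivative D (\<lambda>q. D X q w) p) (at p)" for w
    using smooth_has_D[OF smooth_D[OF X(1)] W(2)] .
  have tan: "D X p w \<bullet> X p = 0" for w
    using D_tangent[OF W smooth_differentiable[OF X(1) W(2)] X(2)] .
  have sym: "D (\<lambda>q. D X q w) p w' = D (\<lambda>q. D X q w') p w" for w w'
    using second_derivative_symmetric[OF W X(1)] .
  have e: "D (\<lambda>q. G q w w') p x = a * (D X p w \<bullet> D (\<lambda>q. D X q w') p x + D (\<lambda>q. D X q w) p x \<bullet> D X p w') + a * (a - 1) *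
       ((D X p w \<bullet> JJ (X p)) * (D X p w' \<bullet> JJ (D X p x) + D (\<lambda>q. D X q w') p x \<bullet> JJ (X p))
        + (D X p w \<bullet> JJ (D X p x) + D (\<lambda>q. D X q w) p x \<bullet> JJ (X p)) * (D X p w' \<bullet> JJ (X p)))" for w w' x
    unfolding G_def induced_metric_def using D_unique[OF gS_has_derivative[OF dX dD dD]] by simp
  define xu xv xz where "xu = D X p u" "xv = D X p v" "xz = D X p z"
  define xuv xuz xvz where "xuv = D (\<lambda>q. D X q v) p u" "xuz = D (\<lambda>q. D X q z) p u" "xvz = D (\<lambda>q. D X q z) p v"
  have s: "D (\<lambda>q. D X q u) p v = xuv" "D (\<lambda>q. D X q u) p z = xuz" "D (\<lambda>q. D X q v) p z = xvz"
    "D (\<lambda>q. D X q v) p u = xuv" "D (\<lambda>q. D X q z) p u = xuz" "D (\<lambda>q. D X q z) p v = xvz"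
    using sym unfolding xuv_xuz_xvz_def by auto
  have J: "x \<bullet> JJ y = - (y \<bullet> JJ x)" for x y
    using inner_JJ_right[of x y] inner_commute[of "JJ x" y] by simp
  have c: "xuz \<bullet> xv = xv \<bullet> xuz" "xvz \<bullet> xu = xu \<bullet> xvz" "xuv \<bullet> xz = xz \<bullet> xuv"
    by (rule inner_commute)+
  have g: "gS a (X p) (ambient_cov a X (\<lambda>q. D X q v) p u) xz =
     a * (xuv \<bullet> xz) + a * (a - 1) * ((xuv \<bullet> JJ (X p)) * (xz \<bullet> JJ (X p)))
     + a * (a - 1) * ((xv \<bullet> JJ (X p)) * (xz \<bullet> JJ xu) + (xu \<bullet> JJ (X p)) * (xz \<bullet> JJ xv))"
    unfolding ambient_cov_def gS_add_left using gS_conn_form[OF X(2)[OF W(2)] tan tan tan, of a u v z]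
    by (simp add: xu_xv_xz_def s gS_expand inner_commute)
  show ?thesis
    unfolding e s xu_xv_xz_def[symmetric] g c J[of xv xu] J[of xu xz] J[of xv xz]
    by (simp add: algebra_simps)
qed

context
  fixes a :: real
  assumes a: "0 < a" "a < 1"
begin

lemma induced_metric_bilinear:
  assumes "local_param S3 (W, X)" "p \<in> W"
  shows "bilinear (induced_metric (gS a) X p)"
    "x \<noteq> 0 \<Longrightarrow> induced_metric (gS a) X p x x > 0"
proof -
  have l: "linear (D X p)"
    using linear_frechet_derivative[OF smooth_differentiable[OF local_param_properties(2)[OF assms(1)] assms(2)]] .
  show "bilinear (induced_metric (gS a) X p)"
    unfolding bilinear_def induced_metric_def
    by (auto intro!: linearI simp: linear_add[OF l] linear_scale[OF l] gS_add_left gS_add_right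
        gS_scale_left gS_scale_right)
  show "induced_metric (gS a) X p x x > 0" if "x \<noteq> 0"
    unfolding induced_metric_def
    using gS_pos[OF a local_param_properties(5)[OF assms]] local_param_properties(4)[OF assms] that linear_injective_0[OF l] by blast
qed

lemma induced_metric_representation:
  assumes "local_param S3 (W, X)" "p \<in> W" "linear l"
  shows "\<exists>!w. \<forall>z. induced_metric (gS a) X p w z = l z"
  using bilinear_positive_definite_representation induced_metric_bilinear[OF assms(1,2)] assms(3) by blast

lemma linear_gS_right: "linear (gS a z w)"
  by (rule linearI) (auto simp: gS_add_right gS_scale_right)

text \<open>The Gauss formula: for a submanifold of arbitrary dimension only the tangential part of the
  ambient covariant derivative is determined by the induced connection.\<close>

lemma christoffel_gS:
  assumes P: "local_param S3 (W, X)" "p \<in> W"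
  shows "gS a (X p) (D X p (christoffel (induced_metric (gS a) X) p u v)) (D X p z)
    = gS a (X p) (ambient_cov a X (\<lambda>q. D X q v) p u) (D X p z)"
proof -
  let ?l = "\<lambda>z. gS a (X p) (ambient_cov a X (\<lambda>q. D X q v) p u) (D X p z)"
  have "linear ?l"
    using linear_compose[OF linear_frechet_derivative[OF smooth_differentiable[OF local_param_properties(2)[OF P(1)] P(2)]] linear_gS_right]
    by (simp add: o_def)
  note r = theI'[OF induced_metric_representation[OF P this]]
  let ?G = "induced_metric (gS a) X"
  have K: "D (\<lambda>q. ?G q v z) p u + D (\<lambda>q. ?G q u z) p v - D (\<lambda>q. ?G q u v) p z = 2 * ?l z" for z
    by (rule Koszul_ambient[OF local_param_properties(1)[OF P(1)] P(2) local_param_properties(2)[OF P(1)] local_param_properties(5)[OF P(1)]])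
  have "christoffel ?G p u v = (THE w. \<forall>z. ?G p w z = ?l z)"
    unfolding christoffel_def K by simp
  then have "?G p (christoffel ?G p u v) z = ?l z" using r by simp
  then show ?thesis by (simp add: induced_metric_def)
qed

end

lemma range_D_chart:
  fixes \<psi> :: "real ^ 3 \<Rightarrow> real ^ 4"
  assumes "local_param S3 (U, \<psi>)" "q \<in> U" "w \<bullet> \<psi> q = 0"
  shows "\<exists>v. w = D \<psi> q v"
proof -
  have l: "linear (D \<psi> q)"
    using linear_frechet_derivative[OF smooth_differentiable[OF local_param_properties(2)[OF assms(1)] assms(2)]] .
  have sub: "range (D \<psi> q) \<subseteq> {x. \<psi> q \<bullet> x = 0}"
    using D_tangent[OF local_param_properties(1)[OF assms(1)] assms(2) smooth_differentiable[OF local_param_properties(2)[OF assms(1)] assms(2)]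
        local_param_properties(5)[OF assms(1)]] by (auto simp: inner_commute)
  have "\<psi> q \<noteq> 0" using local_param_properties(5)[OF assms(1,2)] by auto
  then have "dim {x. \<psi> q \<bullet> x = 0} = 3" by (simp add: dim_hyperplane)
  moreover have "dim (range (D \<psi> q)) = 3"
    using dim_image_eq[OF l, of UNIV] local_param_properties(4)[OF assms(1,2)] by simp
  ultimately have "range (D \<psi> q) = {x. \<psi> q \<bullet> x = 0}"
    using sub by (intro subspace_dim_equal) (auto intro: subspace_hyperplane linear_subspace_image[OF l])
  then show ?thesis using assms(3) by (auto simp: inner_commute)
qed

text \<open>If the submanifold is the sphere itself, the ambient covariant derivative is already tangent.\<close>

lemma christoffel_chart:
  fixes \<psi> :: "real ^ 3 \<Rightarrow> real ^ 4"
  assumes a: "0 < a" "a < 1" and P: "local_param S3 (U, \<psi>)" "q \<in> U"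
  shows "D \<psi> q (christoffel (induced_metric (gS a) \<psi>) q u v) = ambient_cov a \<psi> (\<lambda>q. D \<psi> q v) q u"
proof -
  let ?c = "ambient_cov a \<psi> (\<lambda>q. D \<psi> q v) q u" and ?d = "D \<psi> q (christoffel (induced_metric (gS a) \<psi>) q u v)"
  note f = local_param_properties[OF P(1)]
  have l: "linear (D \<psi> q)" using linear_frechet_derivative[OF smooth_differentiable[OF f(2) P(2)]] .
  have "?c \<bullet> \<psi> q = 0"
    using D_tangent[OF f(1) _ smooth_differentiable[OF f(2)] f(5)] smooth_differentiable[OF f(2) P(2)]
      smooth_differentiable[OF smooth_D[OF f(2)] P(2)] f(5)
    by (intro cov_tangent[OF f(1) P(2)]) auto
  then obtain y where y: "?c = D \<psi> q y" using range_D_chart[OF P] by blast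
  have "gS a (\<psi> q) (?d - ?c) (D \<psi> q z) = 0" for z
    using christoffel_gS[OF a P] by (simp add: gS_diff_left)
  moreover have "?d - ?c = D \<psi> q (christoffel (induced_metric (gS a) \<psi>) q u v - y)"
    using y by (simp add: linear_diff[OF l])
  ultimately have "gS a (\<psi> q) (?d - ?c) (?d - ?c) = 0" by metis
  then show ?thesis using gS_pos[OF a f(5)[OF P(2)], of "?d - ?c"] by force
qed

text \<open>The derivative of a chart is applied to a moving vector at a moving point. Expanding the vector
  in a basis separates the two dependences, and the product rule applies.\<close>

lemma D_along_has_derivative:
  fixes f :: "'m::euclidean_space \<Rightarrow> 'n::euclidean_space" and \<psi> :: "'n \<Rightarrow> 'e::euclidean_space"
  assumes U: "open U" "smooth_map_on U \<psi>" "f p \<in> U"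
    and f: "f differentiable (at p)" and V: "V differentiable (at p)"
    and ev: "open W" "p \<in> W" "f ` W \<subseteq> U"
  shows "((\<lambda>q. D \<psi> (f q) (V q)) has_derivative
     (\<lambda>x. D (\<lambda>y. D \<psi> y (V p)) (f p) (D f p x) + D \<psi> (f p) (D V p x))) (at p)"
proof -
  have l: "linear (D \<psi> y)" if "y \<in> U" for y
    using linear_frechet_derivative[OF smooth_differentiable[OF U(2) that]] .
  have d: "((\<lambda>q. \<Sum>i\<in>Basis. (V q \<bullet> i) *\<^sub>R D \<psi> (f q) i) has_derivative
     (\<lambda>x. \<Sum>i\<in>Basis. (V p \<bullet> i) *\<^sub>R D (\<lambda>y. D \<psi> y i) (f p) (D f p x) + (D V p x \<bullet> i) *\<^sub>R D \<psi> (f p) i)) (at p)"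
    by (intro has_derivative_sum has_derivative_scaleR has_derivative_inner_left has_D V
       has_derivative_compose[OF has_D[OF f] smooth_has_D[OF smooth_D[OF U(2)] U(3)]])
  have "(\<Sum>i\<in>Basis. (v \<bullet> i) *\<^sub>R D (\<lambda>y. D \<psi> y i) (f p) w) = D (\<lambda>y. D \<psi> y v) (f p) w" for v w
  proof -
    have "linear (\<lambda>v. D (\<lambda>y. D \<psi> y v) (f p) w)"
    proof (rule linearI)
      have sd: "((\<lambda>y. D \<psi> y v) has_derivative D (\<lambda>y. D \<psi> y v) (f p)) (at (f p))" for v
        using smooth_has_D[OF smooth_D[OF U(2)] U(3)] .
      show "D (\<lambda>y. D \<psi> y (v + v')) (f p) w = D (\<lambda>y. D \<psi> y v) (f p) w + D (\<lambda>y. D \<psi> y v') (f p) w" for v v'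
        using D_unique[OF has_derivative_add[OF sd[of v] sd[of v']]]
          D_cong_open[OF U(1,3), of "\<lambda>y. D \<psi> y (v + v')" "\<lambda>y. D \<psi> y v + D \<psi> y v'"]
        by (simp add: linear_add[OF l])
      show "D (\<lambda>y. D \<psi> y (r *\<^sub>R v)) (f p) w = r *\<^sub>R D (\<lambda>y. D \<psi> y v) (f p) w" for r v
        using D_unique[OF has_derivative_scaleR_right[OF sd[of v], of r]]
          D_cong_open[OF U(1,3), of "\<lambda>y. D \<psi> y (r *\<^sub>R v)" "\<lambda>y. r *\<^sub>R D \<psi> y v"]
        by (simp add: linear_scale[OF l])
    qed
    from linear_Basis_expand[OF this, of v] show ?thesis by simp
  qed
  moreover have "(\<Sum>i\<in>Basis. (v \<bullet> i) *\<^sub>R D \<psi> y i) = D \<psi> y v" if "y \<in> U" for y v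
    using linear_Basis_expand[OF l[OF that], of v] by simp
  ultimately have d': "((\<lambda>q. \<Sum>i\<in>Basis. (V q \<bullet> i) *\<^sub>R D \<psi> (f q) i) has_derivative
      (\<lambda>x. D (\<lambda>y. D \<psi> y (V p)) (f p) (D f p x) + D \<psi> (f p) (D V p x))) (at p)"
    using d U(3) by (simp add: sum.distrib)
  have "(\<Sum>i\<in>Basis. (V q \<bullet> i) *\<^sub>R D \<psi> (f q) i) = D \<psi> (f q) (V q)" if "q \<in> W" for q
    using linear_Basis_expand[OF l, of "f q" "V q"] that ev(3) by (simp add: image_subset_iff)
  then show ?thesis
    by (rule has_derivative_transform_within_open[OF d' ev(1,2)])
qed

text \<open>The bridge between the coordinate definitions and calculations in the Euclidean space: the
  right-hand side no longer mentions the chart.\<close>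

lemma pullback_conn_chart:
  fixes \<psi> :: "real ^ 3 \<Rightarrow> real ^ 4" and f :: "'m::euclidean_space \<Rightarrow> real ^ 3"
  assumes a: "0 < a" "a < 1" and P: "local_param S3 (U, \<psi>)"
    and W: "open W" "p \<in> W" "f ` W \<subseteq> U" and f: "f differentiable (at p)"
    and X: "\<And>q. q \<in> W \<Longrightarrow> X q = \<psi> (f q)" and V: "V differentiable (at p)"
  shows "D \<psi> (f p) (pullback_conn (induced_metric (gS a) \<psi>) f V p x)
      = ambient_cov a X (\<lambda>q. D \<psi> (f q) (V q)) p x"
    and "(\<lambda>q. D \<psi> (f q) (V q)) differentiable (at p)"
proof -
  have fp: "f p \<in> U" using W by auto
  note F = local_param_properties[OF P]
  have l: "linear (D \<psi> (f p))" using linear_frechet_derivative[OF smooth_differentiable[OF F(2) fp]] .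
  note d = D_along_has_derivative[OF F(1,2) fp f V W]
  show "(\<lambda>q. D \<psi> (f q) (V q)) differentiable (at p)" using d by (rule differentiableI)
  have "D X p = D (\<lambda>q. \<psi> (f q)) p" by (rule D_cong_open[OF W(1,2) X])
  also have "\<dots> = (\<lambda>x. D \<psi> (f p) (D f p x))"
    by (rule D_unique[OF has_derivative_compose[OF has_D[OF f] smooth_has_D[OF F(2) fp]]])
  finally have DX: "D X p x = D \<psi> (f p) (D f p x)" for x by simp
  show "D \<psi> (f p) (pullback_conn (induced_metric (gS a) \<psi>) f V p x)
      = ambient_cov a X (\<lambda>q. D \<psi> (f q) (V q)) p x"
    unfolding pullback_conn_def linear_add[OF l] christoffel_chart[OF a P fp]
    by (simp add: ambient_cov_def D_unique[OF d] DX X[OF W(2)])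
qed

section \<open>Tension, curvature and bitension in ambient terms\<close>

lemma cov_cong_open:
  assumes "open W" "p \<in> W" "\<And>q. q \<in> W \<Longrightarrow> V q = V' q"
  shows "ambient_cov a X V p x = ambient_cov a X V' p x"
  using D_cong_open[OF assms] assms(2,3) by (simp add: ambient_cov_def)

lemma cov_zero:
  assumes "V differentiable (at p)" "X differentiable (at p)"
  shows "ambient_cov a X V p 0 = 0"
  using linear_0[OF linear_frechet_derivative[OF assms(1)]] linear_0[OF linear_frechet_derivative[OF assms(2)]]
  by (simp add: ambient_cov_def conn_form_def)

lemma linear_metric_trace:
  assumes "linear L"
  shows "L (metric_trace G p b) = metric_trace G p (\<lambda>x y. L (b x y))"
  by (simp add: metric_trace_def linear_sum[OF assms])

text \<open>A chart with a linear left inverse allows one to recover a vector field in coordinates, and its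
  differentiability, from its push-forward.\<close>

lemma D_left_inverse:
  fixes P :: "'b::euclidean_space \<Rightarrow> 'a::euclidean_space"
  assumes "open U" "smooth_map_on U \<psi>" "bounded_linear P" "\<And>q. q \<in> U \<Longrightarrow> P (\<psi> q) = q" "q \<in> U"
  shows "P (D \<psi> q v) = v"
proof -
  have "P (D \<psi> q v) = D (\<lambda>q. P (\<psi> q)) q v"
    by (rule D_bounded_linear_compose[symmetric, OF assms(3) smooth_differentiable[OF assms(2,5)]])
  also have "D (\<lambda>q. P (\<psi> q)) q = D (\<lambda>q. q) q"
    by (rule D_cong_open[OF assms(1,5,4)])
  finally show ?thesis by simp
qed

lemma smooth_JJ: "open S \<Longrightarrow> smooth_map_on S V \<Longrightarrow> smooth_map_on S (\<lambda>q. JJ (V q))"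
  by (rule smooth_compose_linear[OF _ bounded_linear_JJ])

lemma smooth_conn_form:
  assumes "open S" "smooth_map_on S X" "smooth_map_on S u" "smooth_map_on S v"
  shows "smooth_map_on S (\<lambda>q. conn_form a (X q) (u q) (v q))"
  unfolding conn_form_def
  by (intro smooth_add smooth_scaleR smooth_inner smooth_mult smooth_const smooth_JJ assms)

lemma smooth_cov:
  assumes "open W" "smooth_map_on W X" "smooth_map_on W V"
  shows "smooth_map_on W (\<lambda>q. ambient_cov a X V q x)"
  unfolding ambient_cov_def by (intro smooth_add smooth_conn_form smooth_D assms)

lemma smooth_sum:
  "open S \<Longrightarrow> (\<And>i. i \<in> A \<Longrightarrow> smooth_map_on S (f i)) \<Longrightarrow> smooth_map_on S (\<lambda>x. \<Sum>i\<in>A. f i x)"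
  by (simp add: smooth_map_on_def Ck_sum)

lemma conn_form_add_right: "conn_form a z u (v + w) = conn_form a z u v + conn_form a z u w"
  by (simp add: conn_form_def algebra_simps)

text \<open>The derivative of \<open>conn_form a z u v\<close> with respect to the point \<open>z\<close> in
  the direction \<open>x\<close>.\<close>

definition conn_form_deriv :: "real \<Rightarrow> real ^ 4 \<Rightarrow> real ^ 4 \<Rightarrow> real ^ 4 \<Rightarrow> real ^ 4 \<Rightarrow> real ^ 4" where
  "conn_form_deriv a z x u v = (u \<bullet> v) *\<^sub>R x + (a - 1) *\<^sub>R ((v \<bullet> JJ x) *\<^sub>R JJ u + (u \<bullet> JJ x) *\<^sub>R JJ v
     + (2 * ((v \<bullet> JJ x) * (u \<bullet> JJ z) + (v \<bullet> JJ z) * (u \<bullet> JJ x))) *\<^sub>R z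
     + (2 * (v \<bullet> JJ z) * (u \<bullet> JJ z)) *\<^sub>R x)"

text \<open>The curvature tensor of the connection given by the derivative plus \<open>conn_form\<close>;
  the terms with derivatives of vector fields cancel by the symmetry of second derivatives and
  of \<open>conn_form\<close>.\<close>

definition ambient_curvature :: "real \<Rightarrow> real ^ 4 \<Rightarrow> real ^ 4 \<Rightarrow> real ^ 4 \<Rightarrow> real ^ 4 \<Rightarrow> real ^ 4" where
  "ambient_curvature a z x y w = conn_form_deriv a z x y w - conn_form_deriv a z y x w + conn_form a z x (conn_form a z y w) - conn_form a z y (conn_form a z x w)"

lemma conn_form_has_derivative:
  assumes "(X has_derivative X') (at p)" "(u has_derivative u') (at p)" "(v has_derivative v') (at p)"
  shows "((\<lambda>q. conn_form a (X q) (u q) (v q)) has_derivative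
    (\<lambda>x. conn_form_deriv a (X p) (X' x) (u p) (v p) + conn_form a (X p) (u' x) (v p) + conn_form a (X p) (u p) (v' x))) (at p)"
proof -
  note d = has_derivative_add[OF has_derivative_scaleR[OF has_derivative_inner[OF assms(2,3)] assms(1)]
    has_derivative_scaleR_right[of _ _ _ "a - 1", OF has_derivative_add[OF has_derivative_add[OF
      has_derivative_scaleR[OF has_derivative_inner[OF assms(3) JJ_has_derivative[OF assms(1)]] JJ_has_derivative[OF assms(2)]]
      has_derivative_scaleR[OF has_derivative_inner[OF assms(2) JJ_has_derivative[OF assms(1)]] JJ_has_derivative[OF assms(3)]]]
      has_derivative_scaleR[OF has_derivative_mult[OF has_derivative_mult_right[of _ _ _ 2, OF has_derivative_inner[OF assms(3) JJ_has_derivative[OF assms(1)]]]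
         has_derivative_inner[OF assms(2) JJ_has_derivative[OF assms(1)]]] assms(1)]]]]
  show ?thesis unfolding conn_form_def
    by (rule has_derivative_eq_rhs[OF d]) (simp add: fun_eq_iff conn_form_deriv_def algebra_simps)
qed

context
  fixes a :: real
  assumes a: "0 < a" "a < 1"
begin

text \<open>If \<open>G\<close> is the metric induced by \<open>X\<close>, the right-hand side is the trace
  of the second fundamental form.\<close>

lemma tension_chart:
  fixes \<psi> :: "real ^ 3 \<Rightarrow> real ^ 4" and f :: "'m::euclidean_space \<Rightarrow> real ^ 3"
  assumes P: "local_param S3 (U, \<psi>)" and W: "open W" "p \<in> W" "f ` W \<subseteq> U" and f: "smooth_map_on W f"
    and X: "\<And>q. q \<in> W \<Longrightarrow> X q = \<psi> (f q)"
  shows "D \<psi> (f p) (tension_field G (induced_metric (gS a) \<psi>) f p)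
    = metric_trace G p (\<lambda>x y. ambient_cov a X (\<lambda>q. D X q y) p x - D X p (christoffel G p x y))"
proof -
  note F = local_param_properties[OF P]
  have DX: "D X q x = D \<psi> (f q) (D f q x)" if q: "q \<in> W" for q x
  proof -
    have fq: "f q \<in> U" using q W by auto
    have "D X q = D (\<lambda>q. \<psi> (f q)) q" by (rule D_cong_open[OF W(1) q X])
    also have "\<dots> = (\<lambda>x. D \<psi> (f q) (D f q x))"
      by (rule D_unique[OF has_derivative_compose[OF smooth_has_D[OF f q] smooth_has_D[OF F(2) fq]]])
    finally show ?thesis by simp
  qed
  have fp: "f p \<in> U" using W by auto
  have l: "linear (D \<psi> (f p))" using linear_frechet_derivative[OF smooth_differentiable[OF F(2) fp]] .
  have "D \<psi> (f p) (pullback_conn (induced_metric (gS a) \<psi>) f (\<lambda>q. D f q y) p x) = ambient_cov a X (\<lambda>q. D X q y) p x" for x y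
  proof -
    have "D \<psi> (f p) (pullback_conn (induced_metric (gS a) \<psi>) f (\<lambda>q. D f q y) p x)
      = ambient_cov a X (\<lambda>q. D \<psi> (f q) (D f q y)) p x"
      by (rule pullback_conn_chart(1)[OF a P W smooth_differentiable[OF f W(2)] X
            smooth_differentiable[OF smooth_D[OF f] W(2)]])
    also have "\<dots> = ambient_cov a X (\<lambda>q. D X q y) p x" by (rule cov_cong_open[OF W(1,2)]) (simp add: DX)
    finally show ?thesis .
  qed
  then show ?thesis
    by (simp add: tension_field_def linear_metric_trace[OF l] linear_diff[OF l] DX[OF W(2)])
qed

text \<open>The iterated covariant derivatives of coordinate fields are evaluated with
  \<open>pullback_conn_chart\<close> for the identity map; the left inverse \<open>P\<close>
  provides the differentiability of the inner derivative.\<close>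

lemma curvature_chart:
  fixes \<psi> :: "real ^ 3 \<Rightarrow> real ^ 4"
  assumes P: "local_param S3 (U, \<psi>)" and inv: "bounded_linear P" "\<And>q. q \<in> U \<Longrightarrow> P (\<psi> q) = q"
    and p: "p \<in> U"
  shows "D \<psi> p (curvature (induced_metric (gS a) \<psi>) p x y z) = ambient_curvature a (\<psi> p) (D \<psi> p x) (D \<psi> p y) (D \<psi> p z)"
proof -
  note F = local_param_properties[OF P]
  let ?H = "induced_metric (gS a) \<psi>"
  let ?dz = "\<lambda>q. D \<psi> q z"
  define Z where "Z y q = christoffel ?H q y z" for y q
  define C where "C y q = ambient_cov a \<psi> ?dz q y" for y q
  have l: "linear (D \<psi> p)" using linear_frechet_derivative[OF smooth_differentiable[OF F(2) p]] .
  have ZC: "D \<psi> q (Z y q) = C y q" if "q \<in> U" for q y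
    unfolding Z_def C_def by (rule christoffel_chart[OF a P that])
  have smC: "smooth_map_on U (C y)" for y
    unfolding C_def by (intro smooth_cov F smooth_D)
  have Zd: "Z y differentiable (at p)" for y
  proof (rule differentiable_cong_open[OF F(1) p])
    show "(\<lambda>q. P (C y q)) differentiable (at p)"
      using smooth_differentiable[OF smooth_compose_linear[OF F(1) inv(1) smC] p] .
    show "P (C y q) = Z y q" if "q \<in> U" for q
      using D_left_inverse[OF F(1,2) inv that] ZC[OF that] by metis
  qed
  have inner: "levi_civita ?H (\<lambda>_. y) (\<lambda>_. z) = Z y" for y
    by (rule ext) (simp add: levi_civita_def Z_def)
  have outer: "D \<psi> p (levi_civita ?H (\<lambda>_. x) (Z y) p) = ambient_cov a \<psi> (C y) p x" for x y
  proof -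
    have "levi_civita ?H (\<lambda>_. x) (Z y) p = pullback_conn ?H (\<lambda>q. q) (Z y) p x"
      by (simp add: levi_civita_def pullback_conn_def)
    also have "D \<psi> p \<dots> = ambient_cov a \<psi> (\<lambda>q. D \<psi> q (Z y q)) p x"
      by (rule pullback_conn_chart(1)[OF a P F(1) p _ _ _ Zd]) auto
    also have "\<dots> = ambient_cov a \<psi> (C y) p x" by (rule cov_cong_open[OF F(1) p]) (rule ZC)
    finally show ?thesis .
  qed
  have "D \<psi> p (levi_civita ?H (lie_bracket (\<lambda>_. x) (\<lambda>_. y)) (\<lambda>_. z) p) = D \<psi> p (christoffel ?H p 0 z)"
    by (simp add: levi_civita_def lie_bracket_def)
  also have "\<dots> = 0"
    unfolding christoffel_chart[OF a P p]
    by (rule cov_zero[OF smooth_differentiable[OF smooth_D[OF F(2)] p] smooth_differentiable[OF F(2) p]])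
  finally have br: "D \<psi> p (levi_civita ?H (lie_bracket (\<lambda>_. x) (\<lambda>_. y)) (\<lambda>_. z) p) = 0" .
  have DC: "D (C y) p x = D (\<lambda>q. D ?dz q y) p x + (conn_form_deriv a (\<psi> p) (D \<psi> p x) (D \<psi> p y) (?dz p)
      + conn_form a (\<psi> p) (D (\<lambda>q. D \<psi> q y) p x) (?dz p) + conn_form a (\<psi> p) (D \<psi> p y) (D ?dz p x))" for x y
    unfolding C_def ambient_cov_def
    using D_unique[OF has_derivative_add[OF smooth_has_D[OF smooth_D[OF smooth_D[OF F(2)]] p]
        conn_form_has_derivative[OF smooth_has_D[OF F(2) p] smooth_has_D[OF smooth_D[OF F(2)] p] smooth_has_D[OF smooth_D[OF F(2)] p]]]]
    by simp
  have "D \<psi> p (curvature ?H p x y z) = ambient_cov a \<psi> (C y) p x - ambient_cov a \<psi> (C x) p y"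
    by (simp add: curvature_def curvature_field_def inner linear_diff[OF l] outer br)
  also have "\<dots> = ambient_curvature a (\<psi> p) (D \<psi> p x) (D \<psi> p y) (D \<psi> p z)"
    using second_derivative_symmetric[OF F(1) p smooth_D[OF F(2)], of z x y]
      second_derivative_symmetric[OF F(1) p F(2), of x y]
    unfolding ambient_curvature_def ambient_cov_def[of a \<psi> "C x" p y] ambient_cov_def[of a \<psi> "C y" p x] DC
    by (simp add: C_def ambient_cov_def conn_form_add_right)
  finally show ?thesis .
qed

end

lemma metric_trace_flat:
  assumes "\<And>x y. G p x y = x \<bullet> y"
  shows "metric_trace G p b = (\<Sum>i\<in>Basis. b i i)"
proof -
  have "(THE w. \<forall>z. G p w z = i \<bullet> z) = i" for i
    using assms by (intro the_equality) (auto simp: vector_eq_rdot)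
  then show ?thesis by (simp add: metric_trace_def)
qed

lemma christoffel_flat:
  assumes "open W" "p \<in> W" "\<And>q x y. q \<in> W \<Longrightarrow> G q x y = x \<bullet> y"
  shows "christoffel G p x y = 0"
proof -
  have "D (\<lambda>q. G q u v) p = D (\<lambda>q. u \<bullet> v) p" for u v
    by (rule D_cong_open[OF assms(1,2)]) (rule assms(3))
  then have "D (\<lambda>q. G q u v) p w = 0" for u v w by simp
  then have "christoffel G p x y = (THE w. \<forall>z. w \<bullet> z = 0)"
    by (simp add: christoffel_def assms(3)[OF assms(2)])
  also have "\<dots> = 0" by (rule the_equality) (simp, metis inner_eq_zero_iff)
  finally show ?thesis .
qed

text \<open>In coordinates in which \<open>G\<close> is the standard metric, traces are sums over the
  standard basis, and the Christoffel symbols of the domain vanish. The field \<open>T\<close>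
  is the push-forward of the tension field.\<close>

lemma bitension_flat:
  fixes \<psi> :: "real ^ 3 \<Rightarrow> real ^ 4" and f :: "'m::euclidean_space \<Rightarrow> real ^ 3"
  assumes a: "0 < a" "a < 1" and P: "local_param S3 (U, \<psi>)"
    and inv: "bounded_linear P" "\<And>q. q \<in> U \<Longrightarrow> P (\<psi> q) = q"
    and W: "open W" "p \<in> W" "f ` W \<subseteq> U" and f: "smooth_map_on W f"
    and X: "\<And>q. q \<in> W \<Longrightarrow> X q = \<psi> (f q)" "smooth_map_on W X"
    and G: "\<And>q x y. q \<in> W \<Longrightarrow> G q x y = x \<bullet> y"
  defines "T \<equiv> \<lambda>q. \<Sum>i\<in>Basis. ambient_cov a X (\<lambda>q. D X q i) q i"
  shows "D \<psi> (f p) (bitension_field G (induced_metric (gS a) \<psi>) f p)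
    = (\<Sum>i\<in>Basis. ambient_cov a X (\<lambda>q. ambient_cov a X T q i) p i - ambient_curvature a (X p) (D X p i) (T p) (D X p i))"
proof -
  note F = local_param_properties[OF P]
  let ?H = "induced_metric (gS a) \<psi>"
  let ?\<tau> = "tension_field G ?H f"
  have fU: "f q \<in> U" if "q \<in> W" for q using that W by auto
  have l: "linear (D \<psi> (f p))" using linear_frechet_derivative[OF smooth_differentiable[OF F(2) fU[OF W(2)]]] .
  have fd: "f differentiable (at q)" if "q \<in> W" for q using smooth_differentiable[OF f that] .
  have chr: "christoffel G q x y = 0" if "q \<in> W" for q x y
    using christoffel_flat[OF W(1) that G] .
  have Xd: "X differentiable (at q)" if "q \<in> W" for q using smooth_differentiable[OF X(2) that] .
  have X0: "D X q 0 = 0" if "q \<in> W" for q using linear_0[OF linear_frechet_derivative[OF Xd[OF that]]] .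
  have DX: "D \<psi> (f p) (D f p x) = D X p x" for x
  proof -
    have "D X p = D (\<lambda>q. \<psi> (f q)) p" by (rule D_cong_open[OF W(1,2) X(1)])
    also have "\<dots> = (\<lambda>x. D \<psi> (f p) (D f p x))"
      by (rule D_unique[OF has_derivative_compose[OF smooth_has_D[OF f W(2)] smooth_has_D[OF F(2) fU[OF W(2)]]]])
    finally show ?thesis by simp
  qed
  have smT: "smooth_map_on W T" unfolding T_def by (intro smooth_sum smooth_cov smooth_D W X)
  have \<tau>T: "D \<psi> (f q) (?\<tau> q) = T q" if "q \<in> W" for q
    using tension_chart[OF a P W(1) that W(3) f X(1), where G=G]
    by (simp add: metric_trace_flat[of G q, OF G[OF that]] chr[OF that] X0[OF that] T_def)
  have diff: "V differentiable (at q)" if "q \<in> W" "smooth_map_on W V'" "\<And>q. q \<in> W \<Longrightarrow> D \<psi> (f q) (V q) = V' q"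
    for V V' q
  proof (rule differentiable_cong_open[OF W(1) that(1)])
    show "(\<lambda>q. P (V' q)) differentiable (at q)"
      using smooth_differentiable[OF smooth_compose_linear[OF W(1) inv(1) that(2)] that(1)] .
    show "P (V' q) = V q" if "q \<in> W" for q
      using D_left_inverse[OF F(1,2) inv fU[OF that]] \<open>\<And>q. q \<in> W \<Longrightarrow> D \<psi> (f q) (V q) = V' q\<close>[OF that] by metis
  qed
  have conn: "D \<psi> (f q) (pullback_conn ?H f V q x) = ambient_cov a X V' q x"
    if "q \<in> W" "smooth_map_on W V'" "\<And>q. q \<in> W \<Longrightarrow> D \<psi> (f q) (V q) = V' q" for V V' q x
  proof -
    have "D \<psi> (f q) (pullback_conn ?H f V q x) = ambient_cov a X (\<lambda>q. D \<psi> (f q) (V q)) q x"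
      by (rule pullback_conn_chart(1)[OF a P W(1) that(1) W(3) fd[OF that(1)] X(1) diff[OF that]])
    also have "\<dots> = ambient_cov a X V' q x" by (rule cov_cong_open[OF W(1) that(1,3)])
    finally show ?thesis .
  qed
  have c1: "D \<psi> (f q) (pullback_conn ?H f ?\<tau> q x) = ambient_cov a X T q x" if "q \<in> W" for q x
    using conn[OF that smT \<tau>T] .
  have c2: "D \<psi> (f p) (pullback_conn ?H f (\<lambda>q. pullback_conn ?H f ?\<tau> q x) p x) = ambient_cov a X (\<lambda>q. ambient_cov a X T q x) p x" for x
    using conn[OF W(2) smooth_cov[OF W(1) X(2) smT] c1] .
  have "D \<psi> (f p) (pullback_conn ?H f ?\<tau> p 0) = 0"
    using c1[OF W(2)] cov_zero[OF smooth_differentiable[OF smT W(2)] Xd[OF W(2)]] by simp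
  then have c0: "pullback_conn ?H f ?\<tau> p 0 = 0"
    using D_left_inverse[OF F(1,2) inv fU[OF W(2)]] linear_0[OF bounded_linear.linear[OF inv(1)]] by metis
  have Rc: "D \<psi> (f p) (curvature ?H (f p) (D f p x) (?\<tau> p) (D f p x)) = ambient_curvature a (X p) (D X p x) (T p) (D X p x)" for x
    using curvature_chart[OF a P inv fU[OF W(2)]] by (simp add: DX \<tau>T[OF W(2)] X(1)[OF W(2)])
  show ?thesis
    by (simp add: bitension_field_def rough_laplacian_def metric_trace_flat[of G p, OF G[OF W(2)]] chr[OF W(2)]
       linear_diff[OF l] linear_sum[OF l] linear_neg[OF l] c2 c0 Rc sum_subtractf)
qed

section \<open>Hopf cylinders over curves with a horizontal lift\<close>

lemma smooth_immersion_locally_injective: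
  fixes X :: "'n::euclidean_space \<Rightarrow> 'm::euclidean_space"
  assumes W: "open W" "p \<in> W" and X: "smooth_map_on W X" and inj: "inj (D X p)"
  obtains r where "r > 0" "ball p r \<subseteq> W" "inj_on X (ball p r)"
proof -
  have l: "linear (D X q)" if "q \<in> W" for q
    using linear_frechet_derivative[OF smooth_differentiable[OF X that]] .
  obtain L where L: "bounded_linear L" "\<And>v. L (D X p v) = v"
    using linear_injective_left_inverse[OF l[OF W(2)] inj] linear_conv_bounded_linear
    by (auto simp: fun_eq_iff)
  define h where "h q = (\<Sum>i\<in>Basis. norm (D X q i - D X p i))" for q
  have "continuous_on W h"
    unfolding h_def by (intro continuous_intros smooth_continuous[OF smooth_D[OF X]])
  then have hc: "\<exists>d>0. ball p d \<subseteq> W \<and> (\<forall>q. dist p q < d \<longrightarrow> h q < e)" if e: "e > 0" for e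
  proof -
    obtain d1 where d1: "d1 > 0" "\<And>q. q \<in> W \<Longrightarrow> dist q p < d1 \<Longrightarrow> dist (h q) (h p) < e"
      using \<open>continuous_on W h\<close>[unfolded continuous_on_iff, rule_format, OF W(2) e] by blast
    obtain d2 where d2: "d2 > 0" "ball p d2 \<subseteq> W" using W open_contains_ball by blast
    have "h p = 0" by (simp add: h_def)
    then have "h q < e" if "dist p q < min d1 d2" for q
      using d1(2)[of q] d2(2) that by (auto simp: dist_commute dist_real_def)
    moreover have "ball p (min d1 d2) \<subseteq> W" using d2(2) by auto
    moreover have "min d1 d2 > 0" using d1 d2 by simp
    ultimately show ?thesis by blast
  qed
  show thesis
  proof (rule has_derivative_locally_injective[OF W(2,1) L(1)])
    show "L \<circ> D X p = id" using L(2) by auto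
    show "(X has_derivative D X q) (at q)" if "q \<in> W" for q using smooth_has_D[OF X that] .
    show "\<exists>d>0. \<forall>q. dist p q < d \<longrightarrow> onorm (\<lambda>v. D X q v - D X p v) < e" if e: "e > 0" for e
    proof -
      obtain d where d: "d > 0" "ball p d \<subseteq> W" "\<And>q. dist p q < d \<Longrightarrow> h q < e"
        using hc[OF e] by blast
      have "onorm (\<lambda>v. D X q v - D X p v) \<le> h q" if "dist p q < d" for q
      proof (rule onorm_bound)
        show "0 \<le> h q" by (simp add: h_def sum_nonneg)
        fix v
        have qW: "q \<in> W" using that d(2) by auto
        have "D X q v - D X p v = (\<Sum>i\<in>Basis. (v \<bullet> i) *\<^sub>R (D X q i - D X p i))"
          unfolding scaleR_diff_right sum_subtractf
            linear_Basis_expand[OF l[OF qW], of v, symmetric] linear_Basis_expand[OF l[OF W(2)], of v, symmetric] ..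
        also have "norm \<dots> \<le> (\<Sum>i\<in>Basis. norm (D X q i - D X p i) * norm v)"
        proof (rule sum_norm_le)
          show "norm ((v \<bullet> i) *\<^sub>R (D X q i - D X p i)) \<le> norm (D X q i - D X p i) * norm v"
            if "i \<in> Basis" for i
            using mult_right_mono[OF Basis_le_norm[OF that, of v], of "norm (D X q i - D X p i)"]
            by (simp add: mult.commute)
        qed
        finally show "norm (D X q v - D X p v) \<le> h q * norm v" by (simp add: h_def sum_distrib_right)
      qed
      then have "\<forall>q. dist p q < d \<longrightarrow> onorm (\<lambda>v. D X q v - D X p v) < e"
        using d(3) le_less_trans by blast
      then show ?thesis using d(1) by blast
    qed
  qed (use that in blast)
qed

lemma orthonormal_4_expansion:
  fixes b1 b2 b3 b4 v :: "real ^ 4"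
  assumes "norm b1 = 1" "norm b2 = 1" "norm b3 = 1" "norm b4 = 1"
    "b1 \<bullet> b2 = 0" "b1 \<bullet> b3 = 0" "b1 \<bullet> b4 = 0" "b2 \<bullet> b3 = 0" "b2 \<bullet> b4 = 0" "b3 \<bullet> b4 = 0"
  shows "v = (v \<bullet> b1) *\<^sub>R b1 + (v \<bullet> b2) *\<^sub>R b2 + (v \<bullet> b3) *\<^sub>R b3 + (v \<bullet> b4) *\<^sub>R b4"
proof -
  let ?S = "{b1, b2, b3, b4}"
  have n: "b1 \<bullet> b1 = 1" "b2 \<bullet> b2 = 1" "b3 \<bullet> b3 = 1" "b4 \<bullet> b4 = 1"
    using assms by (simp_all add: dot_square_norm)
  have s: "b2 \<bullet> b1 = 0" "b3 \<bullet> b1 = 0" "b4 \<bullet> b1 = 0" "b3 \<bullet> b2 = 0" "b4 \<bullet> b2 = 0" "b4 \<bullet> b3 = 0"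
    using assms by (simp_all add: inner_commute)
  have "pairwise orthogonal ?S"
    using assms s by (auto simp: pairwise_def orthogonal_def)
  moreover have "0 \<notin> ?S" using n by auto
  ultimately have "independent ?S" by (rule pairwise_orthogonal_independent)
  moreover have "card ?S = 4"
  proof -
    have "b1 \<noteq> b2" "b1 \<noteq> b3" "b1 \<noteq> b4" "b2 \<noteq> b3" "b2 \<noteq> b4" "b3 \<noteq> b4" using assms n by auto
    then show ?thesis by auto
  qed
  ultimately have span: "span ?S = UNIV"
    using card_ge_dim_independent[of ?S UNIV] by (simp add: top.extremum_unique)
  let ?w = "v - ((v \<bullet> b1) *\<^sub>R b1 + (v \<bullet> b2) *\<^sub>R b2 + (v \<bullet> b3) *\<^sub>R b3 + (v \<bullet> b4) *\<^sub>R b4)"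
  have "orthogonal ?w y" if "y \<in> ?S" for y
    using that n s assms(5-10) by (auto simp: orthogonal_def inner_diff_left inner_add_left)
  then have "orthogonal ?w ?w" using span orthogonal_to_span[of ?w ?S ?w] by simp
  then show ?thesis by (simp add: orthogonal_self)
qed

text \<open>The open hemisphere around \<open>b4\<close> is a graph over the equatorial unit ball. The
  inverse of this chart is the restriction of an orthogonal projection, hence linear as
  \<open>curvature_chart\<close> and \<open>bitension_flat\<close> demand.\<close>

lemma hemisphere_chart:
  fixes b1 b2 b3 b4 :: "real ^ 4"
  assumes on: "norm b1 = 1" "norm b2 = 1" "norm b3 = 1" "norm b4 = 1"
    "b1 \<bullet> b2 = 0" "b1 \<bullet> b3 = 0" "b1 \<bullet> b4 = 0" "b2 \<bullet> b3 = 0" "b2 \<bullet> b4 = 0" "b3 \<bullet> b4 = 0"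
  obtains U :: "(real ^ 3) set" and \<psi> :: "real ^ 3 \<Rightarrow> real ^ 4" and P
  where "local_param S3 (U, \<psi>)" "bounded_linear P" "\<And>q. q \<in> U \<Longrightarrow> P (\<psi> q) = q"
    "\<And>v. v \<in> S3 \<Longrightarrow> v \<bullet> b4 > 0 \<Longrightarrow> P v \<in> U \<and> \<psi> (P v) = v"
proof -
  have n: "b1 \<bullet> b1 = 1" "b2 \<bullet> b2 = 1" "b3 \<bullet> b3 = 1" "b4 \<bullet> b4 = 1"
    using on by (simp_all add: dot_square_norm)
  have s: "b2 \<bullet> b1 = 0" "b3 \<bullet> b1 = 0" "b4 \<bullet> b1 = 0" "b3 \<bullet> b2 = 0" "b4 \<bullet> b2 = 0" "b4 \<bullet> b3 = 0"
    using on by (simp_all add: inner_commute)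
  define U where "U = ball (0 :: real ^ 3) 1"
  define \<psi> where "\<psi> p = (p $ 1) *\<^sub>R b1 + (p $ 2) *\<^sub>R b2 + (p $ 3) *\<^sub>R b3 + ((1 - p \<bullet> p) powr (1/2)) *\<^sub>R b4"
    for p :: "real ^ 3"
  define P where "P v = (vector [v \<bullet> b1, v \<bullet> b2, v \<bullet> b3] :: real ^ 3)" for v
  have P_nth: "P v $ 1 = v \<bullet> b1" "P v $ 2 = v \<bullet> b2" "P v $ 3 = v \<bullet> b3" for v
    by (simp_all add: P_def)
  have "linear P"
    by (rule linearI) (simp_all add: vec_eq_iff forall_3 P_nth inner_add_left)
  then have P: "bounded_linear P" using linear_conv_bounded_linear by blast
  have inU: "p \<in> U \<longleftrightarrow> p \<bullet> p < 1" for p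
    by (simp add: U_def norm_eq_sqrt_inner real_sqrt_lt_1_iff)
  have dot: "p \<bullet> p = (p $ 1)\<^sup>2 + (p $ 2)\<^sup>2 + (p $ 3)\<^sup>2" for p :: "real ^ 3"
    by (simp add: inner_vec_def sum_3 power2_eq_square)
  have Pinv: "P (\<psi> q) = q" for q
    using n s on by (simp add: vec_eq_iff forall_3 P_nth \<psi>_def inner_add_left)
  have oU: "open U" by (simp add: U_def)
  have nth: "smooth_map_on U (\<lambda>p. p $ i)" for i
    by (rule smooth_linear[OF bounded_linear_vec_nth])
  have idm: "smooth_map_on U (\<lambda>p. p)" by (rule smooth_linear[OF bounded_linear_ident])
  have root: "smooth_map_on U (\<lambda>p. (1 - p \<bullet> p) powr (1/2))"
    by (rule smooth_powr[OF oU smooth_diff[OF oU smooth_const smooth_inner[OF oU idm idm]]])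
      (use inU in force)
  have sm: "smooth_map_on U \<psi>"
    unfolding \<psi>_def by (intro smooth_add smooth_scaleR oU nth root smooth_const)
  have norm1: "\<psi> q \<in> S3" if "q \<in> U" for q
  proof -
    have "\<psi> q \<bullet> \<psi> q = q \<bullet> q + ((1 - q \<bullet> q) powr (1/2))\<^sup>2"
      unfolding \<psi>_def using n s on by (simp add: inner_add_left inner_add_right dot power2_eq_square)
    also have "((1 - q \<bullet> q) powr (1/2))\<^sup>2 = 1 - q \<bullet> q"
      using that inU[of q] by (simp add: powr_half_sqrt)
    finally show ?thesis by (simp add: norm_eq_sqrt_inner)
  qed
  have "inj (D \<psi> p)" if "p \<in> U" for p
    using D_left_inverse[OF oU sm P Pinv that] by (metis injI)
  moreover have "inj_on \<psi> U" by (metis Pinv inj_onI)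
  ultimately have "local_param S3 (U, \<psi>)"
    using oU sm norm1 by (auto simp: local_param_def)
  moreover have "P v \<in> U \<and> \<psi> (P v) = v" if v: "v \<in> S3" "v \<bullet> b4 > 0" for v
  proof -
    note e = orthonormal_4_expansion[OF on, of v]
    have "v \<bullet> v = (v \<bullet> b1)\<^sup>2 + (v \<bullet> b2)\<^sup>2 + (v \<bullet> b3)\<^sup>2 + (v \<bullet> b4)\<^sup>2"
      using arg_cong[OF e, of "inner v"] by (simp add: inner_add_right power2_eq_square)
    then have PP: "1 - P v \<bullet> P v = (v \<bullet> b4)\<^sup>2"
      using inner_S3[OF v(1)] by (simp add: dot P_nth)
    then have "P v \<in> U" using v(2) unfolding inU by (smt (verit) zero_less_power)
    moreover have "((v \<bullet> b4)\<^sup>2) powr (1/2) = v \<bullet> b4" using v(2) by (simp add: powr_half_sqrt)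
    then have "\<psi> (P v) = v" unfolding \<psi>_def PP P_nth using e by simp
    ultimately show ?thesis by blast
  qed
  ultimately show thesis using that P Pinv by blast
qed

text \<open>Multiplication by \<open>exp (- i \<theta>)\<close> if \<open>JJ\<close> is multiplication by
  \<open>i\<close>. The sign agrees with that of the field \<open>xi0\<close>.\<close>

definition rot :: "real \<Rightarrow> real ^ 4 \<Rightarrow> real ^ 4" where
  "rot \<theta> v = cos \<theta> *\<^sub>R v - sin \<theta> *\<^sub>R JJ v"

lemma rot_add: "rot \<theta> (u + v) = rot \<theta> u + rot \<theta> v"
  and rot_diff: "rot \<theta> (u - v) = rot \<theta> u - rot \<theta> v"
  and rot_scaleR: "rot \<theta> (r *\<^sub>R v) = r *\<^sub>R rot \<theta> v"
  and rot_minus: "rot \<theta> (- v) = - rot \<theta> v"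
  and rot_JJ: "rot \<theta> (JJ v) = JJ (rot \<theta> v)"
  and rot_0 [simp]: "rot 0 v = v"
  and rot_zero [simp]: "rot \<theta> 0 = 0"
  by (simp_all add: rot_def algebra_simps)

lemma rot_inner [simp]: "rot \<theta> u \<bullet> rot \<theta> v = u \<bullet> v"
proof -
  have "rot \<theta> u \<bullet> rot \<theta> v = cos \<theta> * (cos \<theta> * (u \<bullet> v)) + sin \<theta> * (sin \<theta> * (u \<bullet> v))"
    by (simp add: rot_def inner_diff_left inner_diff_right inner_JJ_left[of u v])
      (simp add: algebra_simps)
  also have "\<dots> = (cos \<theta> * cos \<theta> + sin \<theta> * sin \<theta>) * (u \<bullet> v)"
    by (simp only: distrib_right mult.assoc)
  finally show ?thesis by simp
qed

lemma norm_rot [simp]: "norm (rot \<theta> v) = norm v"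
  by (simp add: norm_eq_sqrt_inner)

lemma rot_rot: "rot \<theta> (rot \<omega> v) = rot (\<theta> + \<omega>) v"
  by (simp add: rot_def cos_add sin_add algebra_simps)

lemma rot_conn_form: "conn_form a (rot \<theta> z) (rot \<theta> u) (rot \<theta> v) = rot \<theta> (conn_form a z u v)"
  by (simp add: conn_form_def rot_add rot_scaleR rot_JJ[symmetric])

lemma rot_has_derivative:
  assumes "(\<theta> has_derivative \<theta>') (at w)" "(k has_derivative k') (at w)"
  shows "((\<lambda>w. rot (\<theta> w) (k w)) has_derivative (\<lambda>x. rot (\<theta> w) (k' x) - \<theta>' x *\<^sub>R JJ (rot (\<theta> w) (k w)))) (at w)"
  using assms unfolding rot_def
  by (auto intro!: derivative_eq_intros JJ_has_derivative simp: algebra_simps)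

lemma sum_Basis_2:
  fixes g :: "real ^ 2 \<Rightarrow> 'b::comm_monoid_add"
  shows "(\<Sum>i\<in>Basis. g i) = g (axis 1 1) + g (axis 2 1)"
proof -
  have B: "(Basis :: (real ^ 2) set) = {axis 1 1, axis 2 1}"
    by (auto simp: Basis_vec_def UNIV_2)
  have "axis 1 1 \<noteq> (axis 2 1 :: real ^ 2)" by (simp add: axis_eq_axis)
  then show ?thesis unfolding B by (subst sum.insert) auto
qed

text \<open>Horizontal curves in the sphere whose projection to the orbit space has unit speed.\<close>

locale horizontal_curve =
  fixes a :: real and T :: "real set" and c :: "real \<Rightarrow> real ^ 4"
  assumes a: "0 < a" "a < 1" and T: "open T"
    and c: "smooth_map_on T c" "\<And>s. s \<in> T \<Longrightarrow> c s \<in> S3"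
    and hor: "\<And>s. s \<in> T \<Longrightarrow> D c s 1 \<bullet> JJ (c s) = 0"
    and speed: "\<And>s. s \<in> T \<Longrightarrow> a * (D c s 1 \<bullet> D c s 1) = 1"
begin

text \<open>In the notation of the introduction, \<open>lam\<close> is \<open>\<lambda>\<close>. It is the
  geodesic curvature of the projected curve with respect to the normal \<open>- JJ c1\<close>.\<close>

definition "c1 s = D c s 1"
definition "c2 s = D c1 s 1"
definition "lam s = - a * (c2 s \<bullet> JJ (c1 s))"

lemma smooth_c1: "smooth_map_on T c1" and smooth_c2: "smooth_map_on T c2"
  unfolding c1_def c2_def by (intro smooth_D c)+

lemma smooth_lam: "smooth_map_on T lam"
  unfolding lam_def by (intro smooth_mult smooth_const smooth_inner smooth_JJ smooth_c1 smooth_c2 T)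

lemma c_deriv: "s \<in> T \<Longrightarrow> (c has_vector_derivative c1 s) (at s)"
  "s \<in> T \<Longrightarrow> (c1 has_vector_derivative c2 s) (at s)"
  using smooth_vector_derivative[OF c(1)] smooth_vector_derivative[OF smooth_c1]
  by (simp_all only: c1_def[symmetric] c2_def[symmetric])

text \<open>The inner products of the second derivative with the frame \<open>c\<close>, \<open>JJ
  c\<close>, \<open>c1\<close>, \<open>JJ c1\<close> come from differentiating the relations
  between \<open>c\<close> and \<open>c1\<close>; only the last one is free, and
  \<open>lam\<close> measures it.\<close>

lemma frame:
  assumes s: "s \<in> T"
  shows "c s \<bullet> c s = 1" "c1 s \<bullet> c s = 0" "c1 s \<bullet> JJ (c s) = 0" "c1 s \<bullet> c1 s = 1 / a"
    "c s \<bullet> c1 s = 0" "JJ (c s) \<bullet> c1 s = 0" "c s \<bullet> JJ (c1 s) = 0" "JJ (c1 s) \<bullet> c s = 0"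
    "c2 s = - (lam s *\<^sub>R JJ (c1 s)) - (1 / a) *\<^sub>R c s"
proof -
  have cd: "c differentiable (at s)" "c1 differentiable (at s)"
    using smooth_differentiable[OF c(1) s] smooth_differentiable[OF smooth_c1 s] by auto
  have cc: "c t \<bullet> c t = 1" if "t \<in> T" for t using inner_S3[OF c(2)[OF that]] .
  have tan: "c1 t \<bullet> c t = 0" if "t \<in> T" for t
    unfolding c1_def using D_tangent[OF T that smooth_differentiable[OF c(1) that] c(2)] .
  have h: "c1 t \<bullet> JJ (c t) = 0" if "t \<in> T" for t unfolding c1_def using hor[OF that] .
  have sp: "c1 t \<bullet> c1 t = 1 / a" if "t \<in> T" for t
    unfolding c1_def using speed[OF that] a by (simp add: field_simps)
  show 1: "c s \<bullet> c s = 1" "c1 s \<bullet> c s = 0" "c1 s \<bullet> JJ (c s) = 0" "c1 s \<bullet> c1 s = 1 / a"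
    using cc tan h sp s by auto
  show 2: "c s \<bullet> c1 s = 0" "JJ (c s) \<bullet> c1 s = 0" using 1 by (simp_all add: inner_commute)
  show 3: "c s \<bullet> JJ (c1 s) = 0" using 2 by (simp add: inner_JJ_right)
  then show 4: "JJ (c1 s) \<bullet> c s = 0" by (simp add: inner_commute)
  have e1: "c2 s \<bullet> c s = - (1 / a)"
    using D_inner_zero[OF T s tan cd(2,1), of 1] 1 by (simp add: c2_def c1_def)
  have e3: "c2 s \<bullet> c1 s = 0"
    using D_inner_zero[OF T s sp cd(2,2), of 1] by (simp add: c2_def inner_commute)
  have "((\<lambda>t. JJ (c t)) has_derivative (\<lambda>v. JJ (D c s v))) (at s)"
    using JJ_has_derivative[OF has_D[OF cd(1)]] .
  from differentiableI[OF this] D_unique[OF this]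
  have "(\<lambda>t. JJ (c t)) differentiable (at s)" "D (\<lambda>t. JJ (c t)) s 1 = JJ (c1 s)"
    by (simp_all add: c1_def)
  then have e2: "c2 s \<bullet> JJ (c s) = 0"
    using D_inner_zero[OF T s h cd(2), of 1] by (simp add: c2_def)
  let ?r = "sqrt a"
  have r: "?r * ?r = a" using a by simp
  have r0: "?r \<noteq> 0" using a by simp
  have nrm: "norm (c1 s) = 1 / ?r" using 1 a by (simp add: norm_eq_sqrt_inner real_sqrt_divide)
  have "c2 s = (c2 s \<bullet> c s) *\<^sub>R c s + (c2 s \<bullet> JJ (c s)) *\<^sub>R JJ (c s) + (c2 s \<bullet> (?r *\<^sub>R c1 s)) *\<^sub>R (?r *\<^sub>R c1 s)
     + (c2 s \<bullet> (?r *\<^sub>R JJ (c1 s))) *\<^sub>R (?r *\<^sub>R JJ (c1 s))"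
    by (rule orthonormal_4_expansion) (use 1 2 3 4 nrm a in \<open>simp_all add: norm_eq_sqrt_inner inner_commute\<close>)
  also have "\<dots> = - (1 / a) *\<^sub>R c s + (a * (c2 s \<bullet> JJ (c1 s))) *\<^sub>R JJ (c1 s)"
    using e1 e2 e3 a by (simp add: r mult.assoc[symmetric])
  finally show "c2 s = - (lam s *\<^sub>R JJ (c1 s)) - (1 / a) *\<^sub>R c s"
    by (simp add: lam_def)
qed

text \<open>The flow of the Reeb field \<open>xi a\<close> at time \<open>t\<close> is \<open>rot (t /
  a)\<close>, so the second coordinate is arc length along the fibres.\<close>

definition X :: "real ^ 2 \<Rightarrow> real ^ 4" where "X w = rot (w $ 2 / a) (c (w $ 1))"
definition W where "W = {w :: real ^ 2. w $ 1 \<in> T}"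

lemma open_W: "open W"
  unfolding W_def using open_vimage[OF T, of "\<lambda>w::real^2. w $ 1"]
  by (simp add: vimage_def continuous_on_component)

lemma X_S3: "w \<in> W \<Longrightarrow> X w \<in> S3"
  using c(2) by (simp add: X_def W_def)

lemma smooth_rot_field:
  assumes "smooth_map_on T k"
  shows "smooth_map_on W (\<lambda>w. rot (w $ 2 / a) (k (w $ 1)))"
proof -
  have k: "smooth_map_on W (\<lambda>w. k (w $ 1))"
    by (rule smooth_compose[OF open_W assms smooth_linear[OF bounded_linear_vec_nth]]) (auto simp: W_def)
  have l: "smooth_map_on W (\<lambda>w. w $ 2 / a)"
    by (rule smooth_linear) (rule bounded_linear_compose[OF bounded_linear_divide bounded_linear_vec_nth])
  show ?thesis unfolding rot_def
    by (intro smooth_diff smooth_scaleR smooth_sin_cos smooth_JJ open_W l k)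
qed

lemma smooth_X: "smooth_map_on W X"
  unfolding X_def by (rule smooth_rot_field[OF c(1)])

lemma D_rot_field:
  assumes "w \<in> W" "(k has_vector_derivative k') (at (w $ 1))"
  shows "D (\<lambda>w. rot (w $ 2 / a) (k (w $ 1))) w x
    = rot (w $ 2 / a) (x $ 1 *\<^sub>R k' - (x $ 2 / a) *\<^sub>R JJ (k (w $ 1)))"
proof -
  have k: "((\<lambda>w. k (w $ 1)) has_derivative (\<lambda>x. x $ 1 *\<^sub>R k')) (at w)"
    by (rule has_derivative_compose[OF bounded_linear_imp_has_derivative[OF bounded_linear_vec_nth]
        assms(2)[unfolded has_vector_derivative_def]])
  have l: "((\<lambda>w. w $ 2 / a) has_derivative (\<lambda>x. x $ 2 / a)) (at w)"
    by (rule bounded_linear_imp_has_derivative) (rule bounded_linear_compose[OF bounded_linear_divide bounded_linear_vec_nth])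
  show ?thesis
    using D_unique[OF rot_has_derivative[OF l k]] by (simp add: rot_diff rot_scaleR rot_JJ)
qed

lemma DX: "w \<in> W \<Longrightarrow> D X w x = rot (w $ 2 / a) (x $ 1 *\<^sub>R c1 (w $ 1) - (x $ 2 / a) *\<^sub>R JJ (c (w $ 1)))"
  unfolding X_def[abs_def] by (rule D_rot_field) (auto simp: W_def c_deriv)

text \<open>The phases are isometries that commute with \<open>JJ\<close>, so the covariant derivatives of a
  field of this form reduce to calculations along the curve \<open>c\<close>.\<close>

lemma cov_rot_field:
  assumes "w \<in> W" "(k has_vector_derivative k') (at (w $ 1))"
  shows "ambient_cov a X (\<lambda>w. rot (w $ 2 / a) (k (w $ 1))) w (axis 1 1)
      = rot (w $ 2 / a) (k' + conn_form a (c (w $ 1)) (c1 (w $ 1)) (k (w $ 1)))"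
    "ambient_cov a X (\<lambda>w. rot (w $ 2 / a) (k (w $ 1))) w (axis 2 1)
      = rot (w $ 2 / a) (- ((1 / a) *\<^sub>R JJ (k (w $ 1))) + conn_form a (c (w $ 1)) (- ((1 / a) *\<^sub>R JJ (c (w $ 1)))) (k (w $ 1)))"
  unfolding ambient_cov_def D_rot_field[OF assms] DX[OF assms(1)]
  unfolding X_def rot_conn_form rot_add by (simp_all add: axis_def)

text \<open>The curve is horizontal of unit speed, and the Reeb field is a unit field orthogonal to it.\<close>

lemma induced_X_flat:
  assumes "w \<in> W"
  shows "induced_metric (gS a) X w x y = x \<bullet> y"
proof -
  let ?s = "w $ 1"
  have s: "?s \<in> T" using assms by (simp add: W_def)
  let ?v = "\<lambda>x :: real ^ 2. x $ 1 *\<^sub>R c1 ?s - (x $ 2 / a) *\<^sub>R JJ (c ?s)"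
  have 1: "?v x \<bullet> ?v y = x $ 1 * y $ 1 / a + x $ 2 * y $ 2 / (a * a)"
    using frame[OF s] a by (simp add: inner_diff_left inner_diff_right) (simp add: mult.commute)
  have 2: "?v x \<bullet> JJ (c ?s) = - x $ 2 / a" for x
    using frame[OF s] by (simp add: inner_diff_left)
  have "induced_metric (gS a) X w x y = a * (?v x \<bullet> ?v y) + a * (a - 1) * ((?v x \<bullet> JJ (c ?s)) * (?v y \<bullet> JJ (c ?s)))"
    unfolding induced_metric_def gS_expand DX[OF assms] unfolding X_def rot_JJ[symmetric] rot_inner ..
  also have "\<dots> = x $ 1 * y $ 1 + x $ 2 * y $ 2"
    unfolding 1 2 using a by (simp add: field_simps)
  finally show ?thesis by (simp add: inner_vec_def sum_2)
qed

lemma inj_DX: assumes "w \<in> W" shows "inj (D X w)"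
proof -
  have l: "linear (D X w)" using linear_frechet_derivative[OF smooth_differentiable[OF smooth_X assms]] .
  show ?thesis
  proof (subst linear_injective_0[OF l], intro allI impI)
    fix x assume "D X w x = 0"
    then have "induced_metric (gS a) X w x x = 0" by (simp add: induced_metric_def gS_expand)
    then show "x = 0" by (simp add: induced_X_flat[OF assms])
  qed
qed

lemma conn_form_c1_horizontal:
  assumes "s \<in> T" "k \<bullet> JJ (c s) = 0"
  shows "conn_form a (c s) (c1 s) k = (c1 s \<bullet> k) *\<^sub>R c s"
  using frame[OF assms(1)] assms(2) by (simp add: conn_form_def)

text \<open>The covariant derivative of a horizontal field along the fibres: the Euclidean derivative and
  the deformation add up to a multiple of \<open>JJ\<close> that does not depend on
  \<open>a\<close>.\<close>

lemma xi_op_horizontal: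
  assumes "s \<in> T" "k \<bullet> JJ (c s) = 0" "k \<bullet> c s = 0"
  shows "- ((1 / a) *\<^sub>R JJ k) + conn_form a (c s) (- ((1 / a) *\<^sub>R JJ (c s))) k = - JJ k"
proof -
  have "JJ (c s) \<bullet> k = 0" using assms by (simp add: inner_commute)
  then have "- ((1 / a) *\<^sub>R JJ k) + conn_form a (c s) (- ((1 / a) *\<^sub>R JJ (c s))) k = (- (1 / a) - (a - 1) / a) *\<^sub>R JJ k"
    using assms frame(1)[OF assms(1)] by (simp add: conn_form_def algebra_simps)
  also have "- (1 / a) - (a - 1) / a = - 1" using a by (simp add: field_simps)
  finally show ?thesis by simp
qed

text \<open>The fibres are geodesics, so only the derivative of \<open>c1\<close> along the curve
  contributes.\<close>

lemma tension_X:
  assumes "w \<in> W"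
  shows "(\<Sum>i\<in>Basis. ambient_cov a X (\<lambda>q. D X q i) w i)
    = rot (w $ 2 / a) (- (lam (w $ 1) *\<^sub>R JJ (c1 (w $ 1))))"
proof -
  let ?s = "w $ 1"
  have s: "?s \<in> T" using assms by (simp add: W_def)
  have 1: "ambient_cov a X (\<lambda>q. D X q (axis 1 1)) w (axis 1 1) = ambient_cov a X (\<lambda>w. rot (w $ 2 / a) (c1 (w $ 1))) w (axis 1 1)"
    by (rule cov_cong_open[OF open_W assms]) (simp add: DX axis_def)
  have 2: "ambient_cov a X (\<lambda>q. D X q (axis 2 1)) w (axis 2 1)
      = ambient_cov a X (\<lambda>w. rot (w $ 2 / a) (- ((1 / a) *\<^sub>R JJ (c (w $ 1))))) w (axis 2 1)"
    by (rule cov_cong_open[OF open_W assms]) (simp add: DX axis_def)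
  have d: "((\<lambda>s. - ((1 / a) *\<^sub>R JJ (c s))) has_vector_derivative - ((1 / a) *\<^sub>R JJ (c1 ?s))) (at ?s)"
    using JJ_has_derivative[OF c_deriv(1)[OF s, unfolded has_vector_derivative_def]] unfolding has_vector_derivative_def
    by (auto intro!: derivative_eq_intros)
  have 3: "- ((1 / a) *\<^sub>R JJ (- ((1 / a) *\<^sub>R JJ (c ?s)))) + conn_form a (c ?s) (- ((1 / a) *\<^sub>R JJ (c ?s))) (- ((1 / a) *\<^sub>R JJ (c ?s))) = 0"
    using frame(1)[OF s] by (simp add: conn_form_def vec_eq_iff)
  show ?thesis
    unfolding sum_Basis_2 1 2 cov_rot_field(1)[OF assms c_deriv(2)[OF s]] cov_rot_field(2)[OF assms d] 3
    using frame[OF s] by (simp add: conn_form_c1_horizontal[OF s])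
qed

end

text \<open>The sectional curvature of the horizontal planes is \<open>4 / a - 3\<close>.\<close>

lemma ambient_curvature_horizontal:
  assumes "z \<in> S3" "t \<bullet> z = 0" "t \<bullet> JJ z = 0" "t \<bullet> t = 1 / a"
  shows "ambient_curvature a z t (\<mu> *\<^sub>R JJ t) t = (\<mu> * ((3 * a - 4) / a)) *\<^sub>R JJ t"
proof -
  have 0: "JJ z \<bullet> t = 0" "z \<bullet> t = 0" using assms by (simp_all add: inner_commute)
  then have "z \<bullet> JJ t = 0" using inner_JJ_right[of z t] by simp
  then have 1: "JJ t \<bullet> z = 0" by (simp add: inner_commute)
  note f = 0 1 \<open>z \<bullet> JJ t = 0\<close> inner_S3[OF assms(1)] assms(2-4)
  have q: "conn_form a z (\<mu> *\<^sub>R JJ t) t = 0" "conn_form a z t t = (1 / a) *\<^sub>R z"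
    "conn_form a z (\<mu> *\<^sub>R JJ t) ((1 / a) *\<^sub>R z) = 0" "conn_form a z t 0 = 0"
    using f by (simp_all add: conn_form_def)
  have d: "conn_form_deriv a z t (\<mu> *\<^sub>R JJ t) t = ((a - 1) * \<mu> / a) *\<^sub>R JJ t"
    using f by (simp add: conn_form_deriv_def)
  have "conn_form_deriv a z (\<mu> *\<^sub>R JJ t) t t = (\<mu> / a) *\<^sub>R JJ t + (a - 1) *\<^sub>R (- (\<mu> / a) *\<^sub>R JJ t + - (\<mu> / a) *\<^sub>R JJ t)"
    using f by (simp add: conn_form_deriv_def)
  also have "\<dots> = (\<mu> / a - 2 * (a - 1) * (\<mu> / a)) *\<^sub>R JJ t"
    unfolding scaleR_add_right scaleR_scaleR scaleR_add_left[symmetric]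
    by (rule arg_cong[of _ _ "\<lambda>r. r *\<^sub>R JJ t"]) (cases "a = 0", simp_all add: field_simps)
  finally have d': "conn_form_deriv a z (\<mu> *\<^sub>R JJ t) t t = (\<mu> / a - 2 * (a - 1) * (\<mu> / a)) *\<^sub>R JJ t" .
  have "(a - 1) * \<mu> / a - (\<mu> / a - 2 * (a - 1) * (\<mu> / a)) = \<mu> * ((3 * a - 4) / a)"
    by (cases "a = 0") (simp_all add: field_simps)
  then show ?thesis
    unfolding ambient_curvature_def q d d' by (simp add: scaleR_diff_left[symmetric])
qed

text \<open>The sectional curvature of the planes that contain the Reeb field is one.\<close>

lemma ambient_curvature_vertical:
  assumes "z \<in> S3" "t \<bullet> z = 0" "t \<bullet> JJ z = 0" and a: "a \<noteq> 0"
  shows "ambient_curvature a z (- ((1 / a) *\<^sub>R JJ z)) (\<mu> *\<^sub>R JJ t) (- ((1 / a) *\<^sub>R JJ z)) = - \<mu> *\<^sub>R JJ t"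
proof -
  let ?x = "- ((1 / a) *\<^sub>R JJ z)" and ?n = "\<mu> *\<^sub>R JJ t"
  have 0: "JJ z \<bullet> t = 0" "z \<bullet> t = 0" using assms by (simp_all add: inner_commute)
  then have "z \<bullet> JJ t = 0" using inner_JJ_right[of z t] by simp
  then have 1: "JJ t \<bullet> z = 0" by (simp add: inner_commute)
  note f = 0 1 \<open>z \<bullet> JJ t = 0\<close> inner_S3[OF assms(1)] assms(2-3)
  have q: "conn_form a z ?n ?x = ((a - 1) * \<mu> / a) *\<^sub>R t"
    "conn_form a z ?n ((1 / (a * a)) *\<^sub>R z) = 0"
    using f by (simp_all add: conn_form_def)
  have q': "conn_form a z ?x (r *\<^sub>R t) = - ((a - 1) * r / a) *\<^sub>R JJ t" for r
    using f by (simp add: conn_form_def)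
  have q'': "conn_form a z ?x ?x = (1 / (a * a)) *\<^sub>R z"
    using f by (simp add: conn_form_def vec_eq_iff)
  have d: "conn_form_deriv a z ?x ?n ?x = 0"
    using f by (simp add: conn_form_deriv_def)
  have "conn_form_deriv a z ?n ?x ?x = (1 / (a * a)) *\<^sub>R ?n + (a - 1) *\<^sub>R (2 * (1 / (a * a))) *\<^sub>R ?n"
    using f by (simp add: conn_form_deriv_def)
  also have "\<dots> = ((\<mu> / (a * a)) * (2 * a - 1)) *\<^sub>R JJ t"
    unfolding scaleR_scaleR scaleR_add_left[symmetric]
    by (rule arg_cong[of _ _ "\<lambda>r. r *\<^sub>R JJ t"]) (use a in \<open>simp add: field_simps\<close>)
  finally have d': "conn_form_deriv a z ?n ?x ?x = ((\<mu> / (a * a)) * (2 * a - 1)) *\<^sub>R JJ t" .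
  have e: "- ((\<mu> / (a * a)) * (2 * a - 1)) - (a - 1) * ((a - 1) * \<mu> / a) / a = - \<mu>"
    using a by (simp add: field_simps)
  have "ambient_curvature a z ?x ?n ?x = (- ((\<mu> / (a * a)) * (2 * a - 1)) - (a - 1) * ((a - 1) * \<mu> / a) / a) *\<^sub>R JJ t"
    unfolding ambient_curvature_def q q'' d d' q' by (simp only: scaleR_diff_left scaleR_minus_left) simp
  then show ?thesis unfolding e .
qed

section \<open>Hopf orbits and horizontal lifts\<close>

lemma rot_has_vector_derivative:
  assumes "(\<theta> has_real_derivative \<theta>') (at t)" "(k has_vector_derivative k') (at t)"
  shows "((\<lambda>t. rot (\<theta> t) (k t)) has_vector_derivative rot (\<theta> t) (k' - \<theta>' *\<^sub>R JJ (k t))) (at t)"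
proof -
  have "((\<lambda>t. rot (\<theta> t) (k t)) has_derivative
      (\<lambda>x. rot (\<theta> t) (x *\<^sub>R k') - (\<theta>' * x) *\<^sub>R JJ (rot (\<theta> t) (k t)))) (at t)"
    using rot_has_derivative[of \<theta> "(*) \<theta>'" t k "\<lambda>x. x *\<^sub>R k'"] assms
    by (simp add: has_field_derivative_def has_vector_derivative_def)
  then show ?thesis
    unfolding has_vector_derivative_def
    by (rule has_derivative_eq_rhs) (simp add: fun_eq_iff rot_diff rot_scaleR rot_JJ scaleR_diff_right mult.commute)
qed

text \<open>Turning an integral curve of the Reeb field back by the expected phase makes it constant.\<close>

lemma hopf_orbit:
  assumes a: "a \<noteq> 0"
  shows "hopf a z = range (\<lambda>\<theta>. rot \<theta> z)"
proof (intro equalityI subsetI)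
  fix y assume "y \<in> hopf a z"
  then obtain k s where k: "y = k s" "k 0 = z" "\<And>t. (k has_vector_derivative xi a (k t)) (at t)"
    by (auto simp: hopf_def)
  have "((\<lambda>t. rot (- t / a) (k t)) has_vector_derivative 0) (at t)" for t
  proof -
    have "((\<lambda>t. - t / a) has_real_derivative (- 1 / a)) (at t)"
      using a by (auto intro!: derivative_eq_intros)
    from rot_has_vector_derivative[OF this k(3)]
    show ?thesis by (simp add: xi_def xi0_def)
  qed
  then obtain C where C: "\<And>t. t \<in> UNIV \<Longrightarrow> rot (- t / a) (k t) = C"
    using has_vector_derivative_zero_constant[of UNIV "\<lambda>t. rot (- t / a) (k t)"] by auto
  have "rot (- s / a) (k s) = z" using C[of 0] C[of s] k(2) by simp
  then have "rot (s / a) z = rot (s / a) (rot (- s / a) y)" using k(1) by simp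
  also have "\<dots> = y" by (simp add: rot_rot)
  finally show "y \<in> range (\<lambda>\<theta>. rot \<theta> z)" by (metis rangeI)
next
  fix y assume "y \<in> range (\<lambda>\<theta>. rot \<theta> z)"
  then obtain \<theta> where y: "y = rot \<theta> z" by auto
  have "((\<lambda>t. rot (t / a) z) has_vector_derivative xi a (rot (t / a) z)) (at t)" for t
  proof -
    have "((\<lambda>t. t / a) has_real_derivative (1 / a)) (at t)"
      using a by (auto intro!: derivative_eq_intros)
    from rot_has_vector_derivative[OF this has_vector_derivative_const[of z]]
    show ?thesis by (simp add: xi_def xi0_def rot_diff rot_scaleR rot_minus rot_JJ)
  qed
  then show "y \<in> hopf a z"
    unfolding hopf_def y by (intro CollectI exI[of _ "\<lambda>t. rot (t / a) z"] exI[of _ "a * \<theta>"]) (simp add: a)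
qed

lemma hopf_rot: "a \<noteq> 0 \<Longrightarrow> hopf a (rot \<theta> z) = hopf a z"
proof -
  assume a: "a \<noteq> 0"
  have "rot \<omega> (rot \<theta> z) \<in> range (\<lambda>\<theta>. rot \<theta> z)" "rot \<omega> z \<in> range (\<lambda>\<omega>. rot \<omega> (rot \<theta> z))" for \<omega>
    using rangeI[of "\<lambda>\<theta>. rot \<theta> z" "\<omega> + \<theta>"] rangeI[of "\<lambda>\<omega>. rot \<omega> (rot \<theta> z)" "\<omega> - \<theta>"]
    by (simp_all add: rot_rot)
  then show ?thesis unfolding hopf_orbit[OF a] by blast
qed

lemma hopf_eq_iff: "a \<noteq> 0 \<Longrightarrow> hopf a z = hopf a y \<longleftrightarrow> (\<exists>\<theta>. y = rot \<theta> z)"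
proof
  assume a: "a \<noteq> 0" and "hopf a z = hopf a y"
  then have "rot 0 y \<in> range (\<lambda>\<theta>. rot \<theta> z)" unfolding hopf_orbit[OF a] by (metis rangeI)
  then show "\<exists>\<theta>. y = rot \<theta> z" by auto
qed (auto simp: hopf_rot)

text \<open>Applying \<open>rot \<theta>\<close> to a lift lowers the component of its velocity along the
  fibre direction \<open>JJ c\<close> by the derivative of \<open>\<theta>\<close>; so
  \<open>\<theta>\<close> has to be an antiderivative of this component.\<close>

lemma horizontal_lift_exists:
  assumes \<gamma>: "arc_length_curve a I \<gamma>" and s0: "s0 \<in> I" and a: "a \<noteq> 0"
  obtains e c where "e > 0" "local_lift a I \<gamma> (ball s0 e) c"
    "\<And>s. s \<in> ball s0 e \<Longrightarrow> D c s 1 \<bullet> JJ (c s) = 0"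
proof -
  obtain T k where T: "s0 \<in> T" and lift: "local_lift a I \<gamma> T k"
    using \<gamma> s0 unfolding arc_length_curve_def by blast
  have k: "open T" "smooth_map_on T k" "\<And>s. s \<in> T \<Longrightarrow> k s \<in> S3" "\<And>s. s \<in> T \<inter> I \<Longrightarrow> \<gamma> s = hopf a (k s)"
    using lift by (auto simp: local_lift_def)
  obtain e where e: "e > 0" "cball s0 e \<subseteq> T" using k(1) T open_contains_cball by blast
  define S where "S = ball s0 e"
  have ST: "S \<subseteq> T" using e(2) ball_subset_cball by (auto simp: S_def)
  have oS: "open S" by (simp add: S_def)
  define h where "h s = D k s 1 \<bullet> JJ (k s)" for s
  have smh: "smooth_map_on T h"
    unfolding h_def by (intro smooth_inner smooth_D smooth_JJ k)
  have "continuous_on {s0 - e..s0 + e} h"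
    using smooth_continuous[OF smh] e(2) by (auto simp: cball_eq_atLeastAtMost intro: continuous_on_subset)
  from antiderivative_continuous[OF this]
  obtain \<theta> where \<theta>: "\<And>x. x \<in> {s0 - e..s0 + e} \<Longrightarrow>
      (\<theta> has_vector_derivative h x) (at x within {s0 - e..s0 + e})" by blast
  have \<theta>': "(\<theta> has_real_derivative h x) (at x)" if "x \<in> S" for x
  proof -
    have "x \<in> {s0 - e<..<s0 + e}" using that by (auto simp: S_def ball_eq_greaterThanLessThan)
    then have "at x within {s0 - e..s0 + e} = at x"
      by (metis at_within_interior interior_atLeastAtMost_real)
    then show ?thesis
      using \<theta>[of x] \<open>x \<in> {s0 - e<..<s0 + e}\<close>
      by (simp add: has_real_derivative_iff_has_vector_derivative)
  qed
  have sm\<theta>: "smooth_map_on S \<theta>"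
    by (rule smooth_if_vector_derivative[OF oS _ smooth_subset[OF smh ST]])
      (use \<theta>' in \<open>simp add: has_real_derivative_iff_has_vector_derivative\<close>)
  define c where "c s = rot (\<theta> s) (k s)" for s
  have smc: "smooth_map_on S c"
    unfolding c_def rot_def
    by (intro smooth_diff smooth_scaleR smooth_sin_cos smooth_JJ oS sm\<theta> smooth_subset[OF k(2) ST])
  have c': "(c has_vector_derivative rot (\<theta> s) (D k s 1 - h s *\<^sub>R JJ (k s))) (at s)" if "s \<in> S" for s
    unfolding c_def
    using rot_has_vector_derivative[OF \<theta>'[OF that] smooth_vector_derivative[OF k(2)]] that ST by blast
  have "D c s 1 = rot (\<theta> s) (D k s 1 - h s *\<^sub>R JJ (k s))" if "s \<in> S" for s
    using D_unique[OF c'[OF that, unfolded has_vector_derivative_def]] by simp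
  then have "D c s 1 \<bullet> JJ (c s) = 0" if "s \<in> S" for s
    using that inner_S3[OF k(3)] ST by (auto simp: c_def rot_JJ[symmetric] inner_diff_left h_def)
  moreover have "local_lift a I \<gamma> S c"
    unfolding local_lift_def
    using oS smc k(3,4) ST by (auto simp: c_def hopf_rot[OF a])
  ultimately show thesis using that e(1) S_def by blast
qed

text \<open>The speed is known only at parameters in \<open>I\<close>, and derivatives require an open
  domain; hence the restriction to the interior.\<close>

lemma horizontal_lift_curve:
  assumes a: "0 < a" "a < 1" and \<gamma>: "arc_length_curve a I \<gamma>"
    and lift: "local_lift a I \<gamma> S c" and h: "\<And>s. s \<in> S \<Longrightarrow> D c s 1 \<bullet> JJ (c s) = 0"
  shows "horizontal_curve a (S \<inter> interior I) c"
proof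
  have L: "open S" "smooth_map_on S c" "\<And>s. s \<in> S \<Longrightarrow> c s \<in> S3"
    using lift by (auto simp: local_lift_def)
  show "open (S \<inter> interior I)" "smooth_map_on (S \<inter> interior I) c"
    using L by (auto intro: smooth_subset)
  fix s assume s: "s \<in> S \<inter> interior I"
  show "c s \<in> S3" "D c s 1 \<bullet> JJ (c s) = 0" using s L h by auto
  have "projected_speed a c s = 1"
    using \<gamma> lift s interior_subset unfolding arc_length_curve_def by blast
  moreover have "vector_derivative c (at s) = D c s 1"
    using smooth_vector_derivative[OF L(2)] s vector_derivative_at by blast
  moreover have "eta a (c s) (D c s 1) = 0"
    using h s by (simp add: eta_def eta0_def xi0_def)
  ultimately have "gS a (c s) (D c s 1) (D c s 1) = 1"
    by (simp add: projected_speed_def horizontal_part_def Let_def)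
  then show "a * (D c s 1 \<bullet> D c s 1) = 1" using h s by (simp add: gS_expand)
qed (use a in auto)

section \<open>The biharmonic equation along a horizontal lift\<close>

context horizontal_curve
begin

definition "lam1 s = D lam s 1"
definition "lam2 s = D lam1 s 1"

lemma smooth_lam1: "smooth_map_on T lam1" unfolding lam1_def by (intro smooth_D smooth_lam)

lemma lam_deriv: "s \<in> T \<Longrightarrow> (lam has_vector_derivative lam1 s) (at s)"
  "s \<in> T \<Longrightarrow> (lam1 has_vector_derivative lam2 s) (at s)"
  using smooth_vector_derivative[OF smooth_lam] smooth_vector_derivative[OF smooth_lam1]
  by (simp_all only: lam1_def[symmetric] lam2_def[symmetric])

abbreviation "tau \<equiv> \<lambda>w. \<Sum>i\<in>Basis. ambient_cov a X (\<lambda>q. D X q i) w i"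

lemma JJ_c_deriv: assumes "s \<in> T"
  shows "((\<lambda>s. JJ (c s)) has_vector_derivative JJ (c1 s)) (at s)"
    "((\<lambda>s. JJ (c1 s)) has_vector_derivative JJ (c2 s)) (at s)"
  using JJ_has_derivative[OF c_deriv(1)[OF assms, unfolded has_vector_derivative_def]]
    JJ_has_derivative[OF c_deriv(2)[OF assms, unfolded has_vector_derivative_def]]
  by (simp_all add: has_vector_derivative_def)

text \<open>The covariant derivative of the tension field along the curve, with the phase removed.\<close>

definition "k1 s = - (lam1 s *\<^sub>R JJ (c1 s)) - (lam s * lam s) *\<^sub>R c1 s + (lam s / a) *\<^sub>R JJ (c s)"

lemma JJ_c2: "s \<in> T \<Longrightarrow> JJ (c2 s) = lam s *\<^sub>R c1 s - (1 / a) *\<^sub>R JJ (c s)"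
  using frame(9)[of s] by simp

lemma cov_tau:
  assumes "w \<in> W"
  shows "ambient_cov a X tau w (axis 1 1) = rot (w $ 2 / a) (k1 (w $ 1))"
    "ambient_cov a X tau w (axis 2 1) = rot (w $ 2 / a) (- (lam (w $ 1) *\<^sub>R c1 (w $ 1)))"
proof -
  let ?s = "w $ 1"
  let ?k = "\<lambda>s. - (lam s *\<^sub>R JJ (c1 s))"
  have s: "?s \<in> T" using assms by (simp add: W_def)
  note f = frame[OF s]
  have d: "(?k has_vector_derivative - (lam1 ?s *\<^sub>R JJ (c1 ?s) + lam ?s *\<^sub>R JJ (c2 ?s))) (at ?s)"
    using lam_deriv(1)[OF s] JJ_c_deriv(2)[OF s]
    by (auto intro!: derivative_eq_intros simp: has_real_derivative_iff_has_vector_derivative algebra_simps)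
  have tau: "ambient_cov a X tau w x = ambient_cov a X (\<lambda>w. rot (w $ 2 / a) (?k (w $ 1))) w x" for x
    by (rule cov_cong_open[OF open_W assms]) (rule tension_X)
  have k: "?k ?s \<bullet> JJ (c ?s) = 0" "?k ?s \<bullet> c ?s = 0" using f by simp_all
  show "ambient_cov a X tau w (axis 1 1) = rot (w $ 2 / a) (k1 ?s)"
    unfolding tau cov_rot_field(1)[OF assms d] conn_form_c1_horizontal[OF s k(1)]
    using f by (simp add: k1_def JJ_c2[OF s] algebra_simps)
  show "ambient_cov a X tau w (axis 2 1) = rot (w $ 2 / a) (- (lam ?s *\<^sub>R c1 ?s))"
    unfolding tau cov_rot_field(2)[OF assms d] xi_op_horizontal[OF s k] by simp
qed

text \<open>Both summands of the trace of the second covariant derivative and both curvature terms are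
  combinations of the frame vectors; the equation of \<open>frame\<close> eliminates
  \<open>c2\<close>.\<close>

lemma bitension_X:
  assumes "w \<in> W"
  shows "(\<Sum>i\<in>Basis. ambient_cov a X (\<lambda>q. ambient_cov a X tau q i) w i - ambient_curvature a (X w) (D X w i) (tau w) (D X w i))
    = rot (w $ 2 / a) ((- lam2 (w $ 1) + lam (w $ 1) ^ 3 - (4 / a - 4) * lam (w $ 1)) *\<^sub>R JJ (c1 (w $ 1))
       - (3 * lam (w $ 1) * lam1 (w $ 1)) *\<^sub>R c1 (w $ 1) + (2 / a * lam1 (w $ 1)) *\<^sub>R JJ (c (w $ 1)))"
proof -
  let ?s = "w $ 1" and ?\<theta> = "w $ 2 / a"
  have s: "?s \<in> T" using assms by (simp add: W_def)
  note f = frame[OF s]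
  let ?l = "lam ?s" and ?l1 = "lam1 ?s" and ?l2 = "lam2 ?s"
  let ?t = "rot ?\<theta> (c1 ?s)"
  have d1: "(k1 has_vector_derivative - (?l2 *\<^sub>R JJ (c1 ?s) + ?l1 *\<^sub>R JJ (c2 ?s))
      - ((2 * ?l * ?l1) *\<^sub>R c1 ?s + (?l * ?l) *\<^sub>R c2 ?s) + ((?l1 / a) *\<^sub>R JJ (c ?s) + (?l / a) *\<^sub>R JJ (c1 ?s))) (at ?s)"
    unfolding k1_def[abs_def]
    using lam_deriv[OF s] JJ_c_deriv[OF s] c_deriv[OF s] a
    by (auto intro!: derivative_eq_intros simp: has_real_derivative_iff_has_vector_derivative algebra_simps)
  have d2: "((\<lambda>s. - (lam s *\<^sub>R c1 s)) has_vector_derivative - (?l1 *\<^sub>R c1 ?s + ?l *\<^sub>R c2 ?s)) (at ?s)"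
    using lam_deriv[OF s] c_deriv[OF s]
    by (auto intro!: derivative_eq_intros simp: has_real_derivative_iff_has_vector_derivative algebra_simps)
  have q1: "conn_form a (c ?s) (c1 ?s) (k1 ?s) = (- (?l * ?l / a)) *\<^sub>R c ?s + ((a - 1) * ?l / a) *\<^sub>R JJ (c1 ?s)"
    using f by (simp add: conn_form_def k1_def inner_add_left inner_diff_left inner_add_right inner_diff_right)
  have 1: "ambient_cov a X (\<lambda>q. ambient_cov a X tau q (axis 1 1)) w (axis 1 1)
    = ambient_cov a X (\<lambda>w. rot (w $ 2 / a) (k1 (w $ 1))) w (axis 1 1)"
    by (rule cov_cong_open[OF open_W assms]) (rule cov_tau(1))
  have 2: "ambient_cov a X (\<lambda>q. ambient_cov a X tau q (axis 2 1)) w (axis 2 1)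
    = ambient_cov a X (\<lambda>w. rot (w $ 2 / a) (- (lam (w $ 1) *\<^sub>R c1 (w $ 1)))) w (axis 2 1)"
    by (rule cov_cong_open[OF open_W assms]) (rule cov_tau(2))
  have k2: "- (?l *\<^sub>R c1 ?s) \<bullet> JJ (c ?s) = 0" "- (?l *\<^sub>R c1 ?s) \<bullet> c ?s = 0" using f by simp_all
  have X1: "D X w (axis 1 1) = ?t" by (simp add: DX[OF assms] axis_def)
  have X2: "D X w (axis 2 1) = - ((1 / a) *\<^sub>R JJ (X w))"
    by (simp add: DX[OF assms] axis_def X_def rot_JJ rot_scaleR rot_minus)
  have tw: "tau w = (- ?l) *\<^sub>R JJ ?t"
    unfolding tension_X[OF assms] by (simp add: rot_minus rot_scaleR rot_JJ)
  have t: "?t \<bullet> X w = 0" "?t \<bullet> JJ (X w) = 0" "?t \<bullet> ?t = 1 / a"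
    using f unfolding X_def rot_JJ[symmetric] rot_inner by simp_all
  have a0: "a \<noteq> 0" using a by simp
  have r1: "ambient_curvature a (X w) (D X w (axis 1 1)) (tau w) (D X w (axis 1 1)) = rot ?\<theta> (- (?l * ((3 * a - 4) / a)) *\<^sub>R JJ (c1 ?s))"
    unfolding X1 tw ambient_curvature_horizontal[OF X_S3[OF assms] t] by (simp add: rot_minus rot_scaleR rot_JJ)
  have r2: "ambient_curvature a (X w) (D X w (axis 2 1)) (tau w) (D X w (axis 2 1)) = rot ?\<theta> (?l *\<^sub>R JJ (c1 ?s))"
    unfolding X2 tw ambient_curvature_vertical[OF X_S3[OF assms] t(1,2) a0] by (simp add: rot_scaleR rot_JJ)
  let ?V = "- (?l2 *\<^sub>R JJ (c1 ?s) + ?l1 *\<^sub>R JJ (c2 ?s))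
      - ((2 * ?l * ?l1) *\<^sub>R c1 ?s + (?l * ?l) *\<^sub>R c2 ?s) + ((?l1 / a) *\<^sub>R JJ (c ?s) + (?l / a) *\<^sub>R JJ (c1 ?s))
      + ((- (?l * ?l / a)) *\<^sub>R c ?s + ((a - 1) * ?l / a) *\<^sub>R JJ (c1 ?s))
      - (- (?l * ((3 * a - 4) / a)) *\<^sub>R JJ (c1 ?s)) + (?l *\<^sub>R JJ (c1 ?s)) - ?l *\<^sub>R JJ (c1 ?s)"
  have "(\<Sum>i\<in>Basis. ambient_cov a X (\<lambda>q. ambient_cov a X tau q i) w i - ambient_curvature a (X w) (D X w i) (tau w) (D X w i)) = rot ?\<theta> ?V"
    unfolding sum_Basis_2[of "\<lambda>i. ambient_cov a X (\<lambda>q. ambient_cov a X tau q i) w i - ambient_curvature a (X w) (D X w i) (tau w) (D X w i)"]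
      1 2 r1 r2 cov_rot_field(1)[OF assms d1] cov_rot_field(2)[OF assms d2] xi_op_horizontal[OF s k2] q1
    by (simp add: rot_diff rot_add rot_minus rot_scaleR rot_JJ)
  also have "?V = (- ?l2 + ?l ^ 3 - (4 / a - 4) * ?l) *\<^sub>R JJ (c1 ?s)
       - (3 * ?l * ?l1) *\<^sub>R c1 ?s + (2 / a * ?l1) *\<^sub>R JJ (c ?s)"
    unfolding JJ_c2[OF s] f(9) vec_eq_iff using a0
    by (simp add: power3_eq_cube) (simp add: field_simps)
  finally show ?thesis .
qed

text \<open>Being biharmonic is a statement about all coordinate representations, so it may be exploited in
  the most convenient one: the parametrization \<open>X\<close>, restricted to a neighbourhood
  of a point on which it is injective and stays in the hemisphere around that point. The
  components of \<open>bitension_X\<close> along \<open>JJ c\<close> and \<open>JJ c1\<close>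
  give the two equations.\<close>

lemma biharmonic_equations:
  assumes bi: "biharmonic_submanifold TYPE(real ^ 3) S3 (gS a) (hopf_cylinder_params a I \<gamma>)"
    and TI: "T \<subseteq> I" and \<gamma>: "\<And>s. s \<in> T \<Longrightarrow> \<gamma> s = hopf a (c s)" and s: "s \<in> T"
  shows "lam1 s = 0" "lam2 s = lam s ^ 3 - (4 / a - 4) * lam s"
proof -
  note f = frame[OF s]
  have a0: "a \<noteq> 0" using a by simp
  define w0 :: "real ^ 2" where "w0 = vector [s, 0]"
  have w0: "w0 $ 1 = s" "w0 $ 2 = 0" by (simp_all add: w0_def)
  have w0W: "w0 \<in> W" using s w0 by (simp add: W_def)
  have Xw0: "X w0 = c s" by (simp add: X_def w0)
  have nrm: "norm (c1 s) = 1 / sqrt a" using f a by (simp add: norm_eq_sqrt_inner real_sqrt_divide)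
  obtain U :: "(real ^ 3) set" and \<psi> :: "real ^ 3 \<Rightarrow> real ^ 4" and P
    where ch: "local_param S3 (U, \<psi>)" "bounded_linear P" "\<And>q. q \<in> U \<Longrightarrow> P (\<psi> q) = q"
    "\<And>v. v \<in> S3 \<Longrightarrow> v \<bullet> c s > 0 \<Longrightarrow> P v \<in> U \<and> \<psi> (P v) = v"
  proof (rule hemisphere_chart[of "JJ (c s)" "sqrt a *\<^sub>R c1 s" "sqrt a *\<^sub>R JJ (c1 s)" "c s"])
  qed (use f a nrm in \<open>simp_all add: norm_eq_sqrt_inner inner_commute\<close>)
  define W1 where "W1 = W \<inter> (\<lambda>w. X w \<bullet> c s) -` {0<..}"
  have "continuous_on W (\<lambda>w. X w \<bullet> c s)" by (intro continuous_intros smooth_continuous[OF smooth_X])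
  then have oW1: "open W1"
    unfolding W1_def by (rule continuous_open_preimage[OF _ open_W open_greaterThan])
  have w1: "w0 \<in> W1" using w0W Xw0 f by (simp add: W1_def)
  have sub: "W1 \<subseteq> W" by (auto simp: W1_def)
  obtain r where r: "r > 0" "ball w0 r \<subseteq> W1" "inj_on X (ball w0 r)"
    by (rule smooth_immersion_locally_injective[OF oW1 w1 smooth_subset[OF smooth_X sub] inj_DX[OF w0W]])
  define B where "B = ball w0 r"
  have B: "open B" "w0 \<in> B" "B \<subseteq> W" using r sub by (auto simp: B_def)
  have XB: "P (X w) \<in> U" "\<psi> (P (X w)) = X w" if "w \<in> B" for w
  proof -
    have "w \<in> W1" using subsetD[OF r(2)] that unfolding B_def by blast
    then have "w \<in> W" "X w \<bullet> c s > 0" by (auto simp: W1_def)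
    then show "P (X w) \<in> U" "\<psi> (P (X w)) = X w" using ch(4)[OF X_S3] by auto
  qed
  define f' where "f' w = P (X w)" for w
  have smX: "smooth_map_on B X" using smooth_subset[OF smooth_X B(3)] .
  have smf: "smooth_map_on B f'" unfolding f'_def by (rule smooth_compose_linear[OF B(1) ch(2) smX])
  have lp: "local_param S3 (B, X)"
    using B smX r(3) inj_DX X_S3 by (auto simp: local_param_def B_def[symmetric])
  have "(B, X) \<in> hopf_cylinder_params a I \<gamma>"
  proof -
    have "smooth_map_on B (\<lambda>w. w $ 1)" by (rule smooth_linear[OF bounded_linear_vec_nth])
    moreover have "(\<lambda>w. w $ 1) ` B \<subseteq> I" using B(3) TI by (auto simp: W_def)
    moreover have "hopf a (X w) = \<gamma> (w $ 1)" if "w \<in> B" for w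
      using that B(3) \<gamma> by (auto simp: X_def hopf_rot[OF a0] W_def)
    ultimately show ?thesis using lp unfolding hopf_cylinder_params_def by blast
  qed
  then have "coordinate_rep (hopf_cylinder_params a I \<gamma>) S3 B X \<psi> f'"
    using smf ch(1) XB by (auto simp: coordinate_rep_def f'_def)
  then have "bitension_field (induced_metric (gS a) X) (induced_metric (gS a) \<psi>) f' w0 = 0"
    using bi B(2) unfolding biharmonic_submanifold_def by blast
  moreover have "linear (D \<psi> (f' w0))"
    using linear_frechet_derivative[OF smooth_differentiable[OF local_param_properties(2)[OF ch(1)]]] XB[OF B(2)]
    by (simp add: f'_def)
  ultimately have "D \<psi> (f' w0) (bitension_field (induced_metric (gS a) X) (induced_metric (gS a) \<psi>) f' w0) = 0"
    by (simp add: linear_0)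
  moreover have "D \<psi> (f' w0) (bitension_field (induced_metric (gS a) X) (induced_metric (gS a) \<psi>) f' w0)
     = (\<Sum>i\<in>Basis. ambient_cov a X (\<lambda>q. ambient_cov a X tau q i) w0 i - ambient_curvature a (X w0) (D X w0 i) (tau w0) (D X w0 i))"
    by (rule bitension_flat[OF a ch(1-3) B(1,2) _ smf _ smX])
      (use XB B(3) induced_X_flat in \<open>auto simp: f'_def\<close>)
  ultimately have eq: "(- lam2 s + lam s ^ 3 - (4 / a - 4) * lam s) *\<^sub>R JJ (c1 s)
       - (3 * lam s * lam1 s) *\<^sub>R c1 s + (2 / a * lam1 s) *\<^sub>R JJ (c s) = 0"
    unfolding bitension_X[OF w0W] w0 by simp
  from arg_cong[OF eq, of "\<lambda>v. v \<bullet> JJ (c s)"] show "lam1 s = 0"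
    using f a0 by (simp add: inner_add_left inner_diff_left)
  from arg_cong[OF eq, of "\<lambda>v. v \<bullet> JJ (c1 s)"] show "lam2 s = lam s ^ 3 - (4 / a - 4) * lam s"
    using f a0 by (simp add: inner_add_left inner_diff_left)
qed

end

section \<open>Hopf cylinders over geodesics are minimal\<close>

lemma two_functionals_dual:
  fixes m t :: "real ^ 2 \<Rightarrow> real"
  assumes "linear m" "linear t" and ker: "\<And>z. m z = 0 \<Longrightarrow> t z = 0 \<Longrightarrow> z = 0"
  obtains y z where "m y = 1" "t y = 0" "m z = 0" "t z = 1"
proof -
  define L where "L z = (vector [m z, t z] :: real ^ 2)" for z
  have Ln: "L z $ 1 = m z" "L z $ 2 = t z" for z by (simp_all add: L_def)
  have "linear L"
    by (rule linearI) (simp_all add: vec_eq_iff forall_2 Ln linear_add[OF assms(1)] linear_add[OF assms(2)]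
        linear_scale[OF assms(1)] linear_scale[OF assms(2)])
  moreover have "inj L"
    unfolding linear_injective_0[OF \<open>linear L\<close>]
    using ker Ln by (metis zero_index)
  ultimately have "surj L" by (rule linear_inj_imp_surj)
  then obtain y z where "L y = vector [1, 0]" "L z = vector [0, 1]" by (metis surjD)
  then have "m y = 1" "t y = 0" "m z = 0" "t z = 1"
    using Ln[of y] Ln[of z] by simp_all
  then show thesis by (rule that)
qed

context horizontal_curve
begin

text \<open>Here an arbitrary parametrization \<open>Y\<close> of the cylinder has to be treated. It is the
  lift at the parameter \<open>t\<close> times a phase with derivative \<open>- \<mu>\<close>,
  where \<open>\<mu>\<close> and the differential of \<open>t\<close> are linearly independent
  and, up to the factor \<open>a\<close> of \<open>\<mu>\<close>, form an orthonormal coframe of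
  the induced metric. For \<open>lam = 0\<close> the second fundamental form is a multiple of
  their symmetric product (fact \<open>II\<close>), whose trace is twice the inner product of
  the two covectors, that is, zero.\<close>

lemma harmonic_if_lam_zero:
  assumes lam0: "\<And>s. s \<in> T \<Longrightarrow> lam s = 0" and IT: "I \<subseteq> T"
    and \<gamma>: "\<And>s. s \<in> I \<Longrightarrow> \<gamma> s = hopf a (c s)"
  shows "harmonic_submanifold TYPE(real ^ 3) S3 (gS a) (hopf_cylinder_params a I \<gamma>)"
  unfolding harmonic_submanifold_def
proof (intro allI impI ballI)
  fix V :: "(real ^ 2) set" and Y :: "real ^ 2 \<Rightarrow> real ^ 4" and \<psi> :: "real ^ 3 \<Rightarrow> real ^ 4" and f w
  assume rep: "coordinate_rep (hopf_cylinder_params a I \<gamma>) S3 V Y \<psi> f" and w: "w \<in> V"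
  have a0: "a \<noteq> 0" using a by simp
  from rep obtain U where U: "local_param S3 (U, \<psi>)" "f ` V \<subseteq> U" and f: "smooth_map_on V f"
    and Yf: "\<And>q. q \<in> V \<Longrightarrow> Y q = \<psi> (f q)" and par: "(V, Y) \<in> hopf_cylinder_params a I \<gamma>"
    unfolding coordinate_rep_def by blast
  from par obtain t where lp: "local_param S3 (V, Y)" and t: "smooth_map_on V t" "\<And>q. q \<in> V \<Longrightarrow> t q \<in> I"
    and hopf: "\<And>q. q \<in> V \<Longrightarrow> hopf a (Y q) = \<gamma> (t q)"
    unfolding hopf_cylinder_params_def by blast
  note Y = local_param_properties[OF lp]
  have tT: "t q \<in> T" if "q \<in> V" for q using t(2)[OF that] IT by blast
  have sm: "smooth_map_on V (\<lambda>q. k (t q))" if "smooth_map_on T k" for k :: "real \<Rightarrow> real ^ 4"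
    using smooth_compose[OF Y(1) that t(1)] tT by blast
  \<comment> \<open>The cosine and minus the sine of the phase, which are smooth although
    the phase itself is defined only up to multiples of a full turn.\<close>
  define \<alpha> \<beta> where "\<alpha> q = Y q \<bullet> c (t q)" "\<beta> q = Y q \<bullet> JJ (c (t q))" for q
  have sm\<alpha>: "smooth_map_on V \<alpha>" and sm\<beta>: "smooth_map_on V \<beta>"
    unfolding \<alpha>_\<beta>_def by (intro smooth_inner smooth_JJ Y sm c)+
  have Yrep: "Y q = \<alpha> q *\<^sub>R c (t q) + \<beta> q *\<^sub>R JJ (c (t q))" "\<alpha> q * \<alpha> q + \<beta> q * \<beta> q = 1" if q: "q \<in> V" for q
  proof -
    have "hopf a (c (t q)) = hopf a (Y q)" using hopf[OF q] \<gamma>[OF t(2)[OF q]] by simp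
    then obtain \<theta> where \<theta>: "Y q = rot \<theta> (c (t q))" using hopf_eq_iff[OF a0] by blast
    have "\<alpha> q = cos \<theta>" "\<beta> q = - sin \<theta>"
      using frame(1)[OF tT[OF q]] by (simp_all add: \<alpha>_\<beta>_def \<theta> rot_def inner_diff_left)
    then show "Y q = \<alpha> q *\<^sub>R c (t q) + \<beta> q *\<^sub>R JJ (c (t q))" "\<alpha> q * \<alpha> q + \<beta> q * \<beta> q = 1"
      by (simp_all add: \<theta> rot_def)
  qed
  define Tn where "Tn q = \<alpha> q *\<^sub>R c1 (t q) + \<beta> q *\<^sub>R JJ (c1 (t q))" for q
  define \<mu> where "\<mu> x q = \<alpha> q * D \<beta> q x - \<beta> q * D \<alpha> q x" for x q
  have sm\<mu>: "smooth_map_on V (\<mu> x)" for x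
    unfolding \<mu>_def using smooth_diff[OF Y(1) smooth_mult smooth_mult] Y(1) sm\<alpha> sm\<beta> smooth_D by blast
  have fr: "Y q \<bullet> Y q = 1" "Tn q \<bullet> Y q = 0" "Tn q \<bullet> JJ (Y q) = 0" "Tn q \<bullet> Tn q = 1 / a"
    "Y q \<bullet> JJ (Tn q) = 0" if q: "q \<in> V" for q
  proof -
    note F = frame[OF tT[OF q]]
    show "Y q \<bullet> Y q = 1" using inner_S3[OF Y(5)[OF q]] .
    show "Tn q \<bullet> Y q = 0" "Tn q \<bullet> JJ (Y q) = 0"
      unfolding Yrep(1)[OF q] Tn_def using F by (simp_all add: inner_add_left inner_add_right inner_diff_left inner_diff_right)
    then show "Y q \<bullet> JJ (Tn q) = 0"
      using inner_JJ_right[of "Y q" "Tn q"] inner_commute[of "JJ (Y q)" "Tn q"] by simp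
    have "Tn q \<bullet> Tn q = (\<alpha> q * \<alpha> q + \<beta> q * \<beta> q) * (1 / a)"
      unfolding Tn_def using F by (simp add: inner_add_left inner_add_right algebra_simps add_divide_distrib)
    then show "Tn q \<bullet> Tn q = 1 / a" using Yrep(2)[OF q] by simp
  qed
  have td: "(t has_derivative D t q) (at q)" if "q \<in> V" for q using smooth_has_D[OF t(1) that] .
  have comp: "((\<lambda>q. k (t q)) has_derivative (\<lambda>x. D t q x *\<^sub>R k')) (at q)"
    if "q \<in> V" "(k has_vector_derivative k') (at (t q))" for k k' q
    using has_derivative_compose[OF td[OF that(1)] that(2)[unfolded has_vector_derivative_def]] .
  have \<alpha>d: "(\<alpha> has_derivative D \<alpha> q) (at q)" "(\<beta> has_derivative D \<beta> q) (at q)" if "q \<in> V" for q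
    using smooth_has_D[OF sm\<alpha> that] smooth_has_D[OF sm\<beta> that] by auto
  have \<alpha>\<mu>: "D \<alpha> q x = - \<beta> q * \<mu> x q" "D \<beta> q x = \<alpha> q * \<mu> x q" if q: "q \<in> V" for q x
  proof -
    have "D (\<lambda>q. \<alpha> q * \<alpha> q + \<beta> q * \<beta> q) q = D (\<lambda>q. 1) q"
      by (rule D_cong_open[OF Y(1) q]) (rule Yrep(2))
    moreover have "D (\<lambda>q. \<alpha> q * \<alpha> q + \<beta> q * \<beta> q) q x = 2 * (\<alpha> q * D \<alpha> q x + \<beta> q * D \<beta> q x)"
      using D_unique[OF has_derivative_add[OF has_derivative_mult[OF \<alpha>d(1) \<alpha>d(1)] has_derivative_mult[OF \<alpha>d(2) \<alpha>d(2)]]] q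
      by simp
    ultimately have z: "\<alpha> q * D \<alpha> q x + \<beta> q * D \<beta> q x = 0" by simp
    have "- \<beta> q * \<mu> x q = (\<beta> q * \<beta> q) * D \<alpha> q x - \<alpha> q * (\<beta> q * D \<beta> q x)" by (simp add: \<mu>_def algebra_simps)
    also have "\<beta> q * D \<beta> q x = - (\<alpha> q * D \<alpha> q x)" using z by simp
    also have "(\<beta> q * \<beta> q) * D \<alpha> q x - \<alpha> q * - (\<alpha> q * D \<alpha> q x) = (\<alpha> q * \<alpha> q + \<beta> q * \<beta> q) * D \<alpha> q x"
      by (simp add: algebra_simps)
    finally show "D \<alpha> q x = - \<beta> q * \<mu> x q" using Yrep(2)[OF q] by simp
    have "\<alpha> q * \<mu> x q = (\<alpha> q * \<alpha> q) * D \<beta> q x - \<beta> q * (\<alpha> q * D \<alpha> q x)" by (simp add: \<mu>_def algebra_simps)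
    also have "\<alpha> q * D \<alpha> q x = - (\<beta> q * D \<beta> q x)" using z by simp
    also have "(\<alpha> q * \<alpha> q) * D \<beta> q x - \<beta> q * - (\<beta> q * D \<beta> q x) = (\<alpha> q * \<alpha> q + \<beta> q * \<beta> q) * D \<beta> q x"
      by (simp add: algebra_simps)
    finally show "D \<beta> q x = \<alpha> q * \<mu> x q" using Yrep(2)[OF q] by simp
  qed
  have DY: "D Y q x = \<mu> x q *\<^sub>R JJ (Y q) + D t q x *\<^sub>R Tn q" if q: "q \<in> V" for q x
  proof -
    note cd = comp[OF q c_deriv(1)[OF tT[OF q]]] comp[OF q JJ_c_deriv(1)[OF tT[OF q]]]
    have "D Y q = D (\<lambda>q. \<alpha> q *\<^sub>R c (t q) + \<beta> q *\<^sub>R JJ (c (t q))) q"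
      by (rule D_cong_open[OF Y(1) q]) (rule Yrep(1))
    then have "D Y q x = D (\<lambda>q. \<alpha> q *\<^sub>R c (t q) + \<beta> q *\<^sub>R JJ (c (t q))) q x" by (rule fun_cong)
    also have "\<dots> = \<alpha> q *\<^sub>R D t q x *\<^sub>R c1 (t q) + D \<alpha> q x *\<^sub>R c (t q)
        + (\<beta> q *\<^sub>R D t q x *\<^sub>R JJ (c1 (t q)) + D \<beta> q x *\<^sub>R JJ (c (t q)))"
      using D_unique[OF has_derivative_add[OF has_derivative_scaleR[OF \<alpha>d(1)[OF q] cd(1)]
         has_derivative_scaleR[OF \<alpha>d(2)[OF q] cd(2)]]] by simp
    finally show ?thesis
      unfolding \<alpha>\<mu>[OF q] Yrep(1)[OF q] Tn_def by (simp add: algebra_simps)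
  qed
  let ?G = "induced_metric (gS a) Y" and ?N = "JJ (Tn w)"
  have NN: "?N \<bullet> ?N = 1 / a" "JJ (Y w) \<bullet> ?N = 0" "Tn w \<bullet> ?N = 0" "Y w \<bullet> ?N = 0" "?N \<bullet> Y w = 0"
    "JJ (Y w) \<bullet> Tn w = 0" "Y w \<bullet> Tn w = 0"
    using fr[OF w] by (simp_all add: inner_commute)
  have smTn: "smooth_map_on V Tn"
    unfolding Tn_def by (intro smooth_add smooth_scaleR smooth_JJ sm smooth_c1 sm\<alpha> sm\<beta> Y)
  have DTn: "D Tn w x \<bullet> ?N = \<mu> x w / a" for x
  proof -
    have s: "t w \<in> T" using tT[OF w] .
    note cd = comp[OF w c_deriv(2)[OF s]] comp[OF w JJ_c_deriv(2)[OF s]]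
    have c2: "c2 (t w) = - ((1 / a) *\<^sub>R c (t w))" using frame(9)[OF s] lam0[OF s] by simp
    have "D Tn w x = \<alpha> w *\<^sub>R D t w x *\<^sub>R c2 (t w) + D \<alpha> w x *\<^sub>R c1 (t w)
        + (\<beta> w *\<^sub>R D t w x *\<^sub>R JJ (c2 (t w)) + D \<beta> w x *\<^sub>R JJ (c1 (t w)))"
      unfolding Tn_def[abs_def]
      using D_unique[OF has_derivative_add[OF has_derivative_scaleR[OF \<alpha>d(1)[OF w] cd(1)]
         has_derivative_scaleR[OF \<alpha>d(2)[OF w] cd(2)]]] by simp
    also have "\<dots> = - ((D t w x / a) *\<^sub>R Y w) + \<mu> x w *\<^sub>R ?N"
      unfolding c2 \<alpha>\<mu>[OF w] Yrep(1)[OF w] Tn_def by (simp add: algebra_simps)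
    finally show ?thesis using NN by (simp add: inner_add_left inner_diff_left)
  qed
  have D2: "D (\<lambda>q. D Y q y) w x \<bullet> ?N = (\<mu> y w * D t w x + D t w y * \<mu> x w) / a" for x y
  proof -
    have \<mu>d: "(\<mu> y has_derivative D (\<mu> y) w) (at w)" using smooth_has_D[OF sm\<mu> w] .
    have tyd: "((\<lambda>q. D t q y) has_derivative D (\<lambda>q. D t q y) w) (at w)"
      using smooth_has_D[OF smooth_D[OF t(1)] w] .
    have "D (\<lambda>q. D Y q y) w = D (\<lambda>q. \<mu> y q *\<^sub>R JJ (Y q) + D t q y *\<^sub>R Tn q) w"
      by (rule D_cong_open[OF Y(1) w]) (rule DY)
    then have "D (\<lambda>q. D Y q y) w x = D (\<lambda>q. \<mu> y q *\<^sub>R JJ (Y q) + D t q y *\<^sub>R Tn q) w x" by (rule fun_cong)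
    also have "\<dots> = \<mu> y w *\<^sub>R JJ (D Y w x) + D (\<mu> y) w x *\<^sub>R JJ (Y w)
        + (D t w y *\<^sub>R D Tn w x + D (\<lambda>q. D t q y) w x *\<^sub>R Tn w)"
      using D_unique[OF has_derivative_add[OF has_derivative_scaleR[OF \<mu>d JJ_has_derivative[OF smooth_has_D[OF Y(2) w]]]
         has_derivative_scaleR[OF tyd smooth_has_D[OF smTn w]]]] by simp
    finally show ?thesis
      using NN fr[OF w] by (simp add: inner_add_left inner_diff_left DTn DY[OF w] add_divide_distrib)
  qed
  have inN: "D Y w x \<bullet> ?N = 0" for x using NN by (simp add: DY[OF w] inner_add_left)
  have covN: "ambient_cov a Y (\<lambda>q. D Y q y) w x \<bullet> ?N = \<mu> y w * D t w x + D t w y * \<mu> x w" for x y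
  proof -
    have u: "D Y w x \<bullet> JJ (Y w) = \<mu> x w" "JJ (D Y w x) \<bullet> ?N = D t w x / a" for x
      using fr[OF w] NN by (simp_all add: DY[OF w] inner_add_left inner_diff_left)
    have "conn_form a (Y w) (D Y w x) (D Y w y) \<bullet> ?N = (a - 1) * (\<mu> y w * (D t w x / a) + \<mu> x w * (D t w y / a))"
      unfolding conn_form_def using NN by (simp only: inner_add_left inner_scaleR_left u) simp
    then show ?thesis
      unfolding ambient_cov_def inner_add_left D2 using a0 by (simp add: field_simps)
  qed
  have l: "linear (D Y w)" using linear_frechet_derivative[OF smooth_differentiable[OF Y(2) w]] .
  have lt: "linear (D t w)" using linear_frechet_derivative[OF smooth_differentiable[OF t(1) w]] .
  have \<mu>Y: "\<mu> x w = D Y w x \<bullet> JJ (Y w)" for x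
    using fr[OF w] by (simp add: DY[OF w] inner_add_left)
  have lm: "linear (\<lambda>x. \<mu> x w)"
    by (rule linearI) (simp_all add: \<mu>Y linear_add[OF l] linear_scale[OF l] inner_add_left)
  \<comment> \<open>Vectors dual to the coframe; testing orthogonality against them shows
    that the second fundamental form is normal.\<close>
  obtain y z where yz: "\<mu> y w = 1" "D t w y = 0" "\<mu> z w = 0" "D t w z = 1"
  proof (rule two_functionals_dual[OF lm lt])
    fix z assume "\<mu> z w = 0" "D t w z = 0"
    then have "D Y w z = 0" by (simp add: DY[OF w])
    then show "z = 0" using Y(4)[OF w] linear_injective_0[OF l] by blast
  qed
  have Gw: "?G w x x' = a * a * (\<mu> x w * \<mu> x' w) + D t w x * D t w x'" for x x'
  proof -
    have "D Y w x \<bullet> D Y w x' = \<mu> x w * \<mu> x' w + D t w x * D t w x' / a"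
      using fr[OF w] NN by (simp add: DY[OF w] inner_add_left inner_add_right)
    then show ?thesis
      unfolding induced_metric_def gS_expand \<mu>Y[symmetric] using a0 by (simp add: field_simps)
  qed
  define II where "II x x' = ambient_cov a Y (\<lambda>q. D Y q x') w x - D Y w (christoffel ?G w x x')" for x x'
  have II: "II x x' = (a * (\<mu> x' w * D t w x + D t w x' * \<mu> x w)) *\<^sub>R ?N" for x x'
  proof -
    have g0: "gS a (Y w) (II x x') (D Y w v) = 0" for v
      unfolding II_def gS_diff_left using christoffel_gS[OF a lp w] by simp
    from g0[of y] have 1: "II x x' \<bullet> JJ (Y w) = 0"
      using yz a0 inner_S3[OF Y(5)[OF w]] by (simp add: DY[OF w] gS_expand algebra_simps)
    from g0[of z] have 2: "II x x' \<bullet> Tn w = 0"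
      using yz a0 1 by (simp add: DY[OF w] gS_expand)
    have tan: "D Y q x \<bullet> Y q = 0" if "q \<in> V" for q x
      using D_tangent[OF Y(1) that smooth_differentiable[OF Y(2) that] Y(5)] .
    have 3: "II x x' \<bullet> Y w = 0"
      unfolding II_def inner_diff_left tan[OF w]
      using cov_tangent[OF Y(1) w smooth_differentiable[OF Y(2) w] Y(5) smooth_differentiable[OF smooth_D[OF Y(2)] w] tan]
      by simp
    have 4: "II x x' \<bullet> ?N = \<mu> x' w * D t w x + D t w x' * \<mu> x w"
      unfolding II_def inner_diff_left inN covN by simp
    let ?r = "sqrt a"
    have r: "?r * ?r = a" using a by simp
    have nrm: "norm (Tn w) = 1 / ?r" using fr[OF w] a by (simp add: norm_eq_sqrt_inner real_sqrt_divide)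
    have "II x x' = (II x x' \<bullet> Y w) *\<^sub>R Y w + (II x x' \<bullet> JJ (Y w)) *\<^sub>R JJ (Y w)
        + (II x x' \<bullet> (?r *\<^sub>R Tn w)) *\<^sub>R (?r *\<^sub>R Tn w) + (II x x' \<bullet> (?r *\<^sub>R ?N)) *\<^sub>R (?r *\<^sub>R ?N)"
      by (rule orthonormal_4_expansion) (use fr[OF w] NN nrm a in \<open>simp_all add: norm_eq_sqrt_inner\<close>)
    also have "\<dots> = (a * (II x x' \<bullet> ?N)) *\<^sub>R ?N"
      using 1 2 3 r a by (simp add: mult.assoc[symmetric])
    finally show ?thesis unfolding 4 .
  qed
  have lin: "linear (\<lambda>z. i \<bullet> z)" for i :: "real ^ 2" by (rule bounded_linear.linear[OF bounded_linear_inner_right])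
  \<comment> \<open>The metric trace pairs each basis vector \<open>i\<close> with its
    dual \<open>S i\<close>; the sums of \<open>S i\<close> weighted by the values of a
    covector represent that covector.\<close>
  define S where "S i = (THE y. \<forall>z. ?G w y z = i \<bullet> z)" for i
  have S: "?G w (S i) z = i \<bullet> z" for i z
    using theI'[OF induced_metric_representation[OF a lp w lin]] unfolding S_def by blast
  have lG: "linear (\<lambda>x. ?G w x z)" for z
    using induced_metric_bilinear(1)[OF a lp w] by (simp add: bilinear_def)
  have dual: "?G w (\<Sum>i\<in>Basis. m i *\<^sub>R S i) z = m z" if "linear m" for m :: "real ^ 2 \<Rightarrow> real" and z
    unfolding linear_sum[OF lG] linear_scale[OF lG] S
    using linear_Basis_expand[OF that, of z] by (simp add: mult.commute inner_commute)
  have "\<mu> (\<Sum>i\<in>Basis. D t w i *\<^sub>R S i) w = 0"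
    using dual[OF lt, of y] yz a0 by (simp add: Gw)
  then have s1: "(\<Sum>i\<in>Basis. D t w i * \<mu> (S i) w) = 0"
    by (simp add: linear_sum[OF lm] linear_scale[OF lm])
  have "D t w (\<Sum>i\<in>Basis. \<mu> i w *\<^sub>R S i) = 0"
    using dual[OF lm, of z] yz by (simp add: Gw)
  then have s2: "(\<Sum>i\<in>Basis. \<mu> i w * D t w (S i)) = 0"
    by (simp add: linear_sum[OF lt] linear_scale[OF lt])
  have fw: "f w \<in> U" using U(2) w by auto
  have "D \<psi> (f w) (tension_field ?G (induced_metric (gS a) \<psi>) f w) = metric_trace ?G w II"
    unfolding II_def by (rule tension_chart[OF a U(1) Y(1) w U(2) f Yf])
  also have "\<dots> = (\<Sum>i\<in>Basis. (a * (\<mu> (S i) w * D t w i + D t w (S i) * \<mu> i w)) *\<^sub>R ?N)"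
    unfolding metric_trace_def S_def[symmetric] II ..
  also have "\<dots> = (a * ((\<Sum>i\<in>Basis. D t w i * \<mu> (S i) w) + (\<Sum>i\<in>Basis. \<mu> i w * D t w (S i)))) *\<^sub>R ?N"
    by (simp add: scaleR_sum_left[symmetric] sum_distrib_left[symmetric] sum.distrib[symmetric] mult.commute)
  finally have "D \<psi> (f w) (tension_field ?G (induced_metric (gS a) \<psi>) f w) = 0"
    unfolding s1 s2 by simp
  moreover have "linear (D \<psi> (f w))"
    using linear_frechet_derivative[OF smooth_differentiable[OF local_param_properties(2)[OF U(1)] fw]] .
  ultimately show "tension_field ?G (induced_metric (gS a) \<psi>) f w = 0"
    using local_param_properties(4)[OF U(1) fw] linear_injective_0 by blast
qed

end

section \<open>Horizontal curves of constant curvature\<close>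

text \<open>The general solution of \<open>c'' + (A - B) i c' + A B c = 0\<close>, whose characteristic
  roots are \<open>- i A\<close> and \<open>i B\<close>.\<close>

definition sol :: "real \<Rightarrow> real \<Rightarrow> real ^ 4 \<Rightarrow> real ^ 4 \<Rightarrow> real \<Rightarrow> real ^ 4" where
  "sol A B p q u = rot (A * u) p + rot (- (B * u)) q"

text \<open>The conditions on the amplitudes under which \<open>sol\<close> is a horizontal curve in the
  sphere with unit projected speed: \<open>p\<close> and \<open>q\<close> are Hermitian
  orthogonal, and their lengths balance the two opposite vertical velocities.\<close>

definition admissible :: "real \<Rightarrow> real \<Rightarrow> real \<Rightarrow> real ^ 4 \<Rightarrow> real ^ 4 \<Rightarrow> bool" where
  "admissible a A B p q \<longleftrightarrow> A > 0 \<and> B > 0 \<and> A * B = 1 / a \<and> p \<bullet> p = B / (A + B) \<and> q \<bullet> q = A / (A + B)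
     \<and> p \<bullet> q = 0 \<and> p \<bullet> JJ q = 0"

lemma sol_has_vector_derivative:
  "(sol A B p q has_vector_derivative sol A B (- (A *\<^sub>R JJ p)) (B *\<^sub>R JJ q) u) (at u)"
proof -
  have 1: "((\<lambda>u. A * u) has_real_derivative A) (at u)" "((\<lambda>u. - (B * u)) has_real_derivative (- B)) (at u)"
    by (auto intro!: derivative_eq_intros)
  show ?thesis
    using has_vector_derivative_add[OF rot_has_vector_derivative[OF 1(1) has_vector_derivative_const[of p]]
        rot_has_vector_derivative[OF 1(2) has_vector_derivative_const[of q]]]
    by (simp add: sol_def[abs_def])
qed

lemma D_sol: "D (sol A B p q) u 1 = sol A B (- (A *\<^sub>R JJ p)) (B *\<^sub>R JJ q) u"
  using D_unique[OF sol_has_vector_derivative[unfolded has_vector_derivative_def]] by simp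

lemma smooth_sol: "smooth_map_on UNIV (sol A B p q)"
proof -
  have l: "smooth_map_on UNIV (\<lambda>u::real. r * u)" for r by (rule smooth_linear[OF bounded_linear_mult_right])
  have r: "smooth_map_on UNIV (\<lambda>u. rot (r * u) p)" for r p
    unfolding rot_def by (intro smooth_diff smooth_scaleR smooth_sin_cos smooth_const l open_UNIV)
  show ?thesis
    unfolding sol_def[abs_def] using smooth_add[OF open_UNIV r[of A p] r[of "- B" q]] by simp
qed

lemma JJ_sol: "JJ (sol A B p q u) = sol A B (JJ p) (JJ q) u"
  by (simp add: sol_def rot_JJ)

lemma rot_sol: "rot \<theta> (sol A B p q u) = sol A B (rot \<theta> p) (rot \<theta> q) u"
  by (simp add: sol_def rot_add rot_rot add.commute)

lemma rot_orthogonal: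
  assumes "p \<bullet> q = 0" "p \<bullet> JJ q = 0"
  shows "rot \<theta> p \<bullet> rot \<omega> q = 0"
  using assms by (simp add: rot_def inner_diff_left inner_diff_right inner_JJ_left[of p q])

lemma sol_inner:
  assumes "p \<bullet> q' = 0" "p \<bullet> JJ q' = 0" "p' \<bullet> q = 0" "p' \<bullet> JJ q = 0"
  shows "sol A B p q u \<bullet> sol A B p' q' u = p \<bullet> p' + q \<bullet> q'"
  using rot_orthogonal[OF assms(1,2), of "A * u" "- (B * u)"] rot_orthogonal[OF assms(3,4), of "A * u" "- (B * u)"]
  by (simp add: sol_def inner_add_left inner_add_right inner_commute)

lemma sol_horizontal_curve:
  assumes a: "0 < a" "a < 1" and ad: "admissible a A B p q"
  shows "horizontal_curve a UNIV (sol A B p q)"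
    and "horizontal_curve.lam a (sol A B p q) u = A - B"
proof -
  from ad have A: "A > 0" "B > 0" "A * B = 1 / a" and pq: "p \<bullet> p = B / (A + B)" "q \<bullet> q = A / (A + B)"
    "p \<bullet> q = 0" "p \<bullet> JJ q = 0"
    by (auto simp: admissible_def)
  have AB: "A + B \<noteq> 0" "a * (A * B) = 1" using A a by auto
  have o: "JJ p \<bullet> q = 0" "JJ p \<bullet> JJ q = 0" using pq by (simp_all add: inner_JJ_left[of p q])
  have x1: "sol A B p q u \<bullet> sol A B p q u = 1" for u
    using pq AB by (simp add: sol_inner add_divide_distrib[symmetric])
  have x2: "D (sol A B p q) u 1 \<bullet> JJ (sol A B p q u) = 0" for u
    using pq o by (simp add: D_sol JJ_sol sol_inner)
  have x3: "a * (D (sol A B p q) u 1 \<bullet> D (sol A B p q) u 1) = 1" for u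
  proof -
    have "D (sol A B p q) u 1 \<bullet> D (sol A B p q) u 1 = A * A * (B / (A + B)) + B * B * (A / (A + B))"
      using pq o by (simp add: D_sol sol_inner)
    also have "\<dots> = (A * A * B + B * B * A) / (A + B)"
      by (simp only: add_divide_distrib times_divide_eq_right)
    also have "A * A * B + B * B * A = A * B * (A + B)" by (simp add: algebra_simps)
    finally show ?thesis using AB by simp
  qed
  show hc: "horizontal_curve a UNIV (sol A B p q)"
    by standard (use a smooth_sol x1 x2 x3 in \<open>auto simp: norm_eq_sqrt_inner\<close>)
  interpret S: horizontal_curve a UNIV "sol A B p q" by (rule hc)
  have c1: "S.c1 = sol A B (- (A *\<^sub>R JJ p)) (B *\<^sub>R JJ q)"
    by (rule ext) (simp add: S.c1_def D_sol)
  have c2: "S.c2 u = sol A B (- ((A * A) *\<^sub>R p)) (- ((B * B) *\<^sub>R q)) u"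
    by (simp add: S.c2_def c1 D_sol)
  have "S.c2 u \<bullet> JJ (S.c1 u) = - (A * A * A) * (B / (A + B)) + B * B * B * (A / (A + B))"
    unfolding c2 unfolding c1 using pq o by (simp add: JJ_sol sol_inner)
  also have "\<dots> = (- (A * A * A) * B + B * B * B * A) / (A + B)"
    by (simp only: add_divide_distrib times_divide_eq_right)
  also have "- (A * A * A) * B + B * B * B * A = A * B * (B - A) * (A + B)" by (simp add: algebra_simps)
  also have "\<dots> / (A + B) = A * B * (B - A)" using AB(1) by simp
  finally have "S.lam u = - (a * (A * B)) * (B - A)" by (simp add: S.lam_def)
  then show "S.lam u = A - B" using AB(2) by simp
qed

context horizontal_curve
begin

text \<open>The combinations \<open>B c + i c'\<close> and \<open>A c - i c'\<close> are \<open>A +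
  B\<close> times the two summands of a solution, so they rotate with constant speeds
  \<open>A\<close> and \<open>B\<close>. Turned back, they are constant and give the amplitudes.\<close>

lemma constant_curvature_solution:
  assumes S: "S \<subseteq> T" "convex S" "S \<noteq> {}" and l: "\<And>s. s \<in> S \<Longrightarrow> lam s = A - B"
    and A: "A > 0" "B > 0" "A * B = 1 / a"
  obtains p q where "admissible a A B p q" "\<And>s. s \<in> S \<Longrightarrow> c s = sol A B p q s"
proof -
  define P where "P s = rot (- (A * s)) (B *\<^sub>R c s + JJ (c1 s))" for s
  define Q where "Q s = rot (B * s) (A *\<^sub>R c s - JJ (c1 s))" for s
  have P': "(P has_vector_derivative 0) (at s within S)" and Q': "(Q has_vector_derivative 0) (at s within S)"
    if s: "s \<in> S" for s
  proof -
    have sT: "s \<in> T" using s S by auto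
    have th: "((\<lambda>s. - (A * s)) has_real_derivative (- A)) (at s)" "((\<lambda>s. B * s) has_real_derivative B) (at s)"
      by (auto intro!: derivative_eq_intros)
    have kP: "((\<lambda>s. B *\<^sub>R c s + JJ (c1 s)) has_vector_derivative (B *\<^sub>R c1 s + JJ (c2 s))) (at s)"
      using c_deriv(1)[OF sT] JJ_c_deriv(2)[OF sT] by (auto intro!: derivative_eq_intros)
    have kQ: "((\<lambda>s. A *\<^sub>R c s - JJ (c1 s)) has_vector_derivative (A *\<^sub>R c1 s - JJ (c2 s))) (at s)"
      using c_deriv(1)[OF sT] JJ_c_deriv(2)[OF sT] by (auto intro!: derivative_eq_intros)
    have "(B *\<^sub>R c1 s + JJ (c2 s)) - (- A) *\<^sub>R JJ (B *\<^sub>R c s + JJ (c1 s)) = (A * B - 1 / a) *\<^sub>R JJ (c s)"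
      unfolding JJ_c2[OF sT] l[OF s] by (simp add: algebra_simps)
    then have "(P has_vector_derivative 0) (at s)"
      using rot_has_vector_derivative[OF th(1) kP] A(3) by (simp add: P_def[abs_def])
    then show "(P has_vector_derivative 0) (at s within S)" by (rule has_vector_derivative_at_within)
    have "(A *\<^sub>R c1 s - JJ (c2 s)) - B *\<^sub>R JJ (A *\<^sub>R c s - JJ (c1 s)) = (1 / a - A * B) *\<^sub>R JJ (c s)"
      unfolding JJ_c2[OF sT] l[OF s] by (simp add: algebra_simps)
    then have "(Q has_vector_derivative 0) (at s)"
      using rot_has_vector_derivative[OF th(2) kQ] A(3) by (simp add: Q_def[abs_def])
    then show "(Q has_vector_derivative 0) (at s within S)" by (rule has_vector_derivative_at_within)
  qed
  obtain P0 where P0: "\<And>s. s \<in> S \<Longrightarrow> P s = P0" using has_vector_derivative_zero_constant[OF S(2) P'] by blast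
  obtain Q0 where Q0: "\<And>s. s \<in> S \<Longrightarrow> Q s = Q0" using has_vector_derivative_zero_constant[OF S(2) Q'] by blast
  define r where "r = 1 / (A + B)"
  have r: "r * (A + B) = 1" using A by (simp add: r_def)
  have csol: "c s = sol A B (r *\<^sub>R P0) (r *\<^sub>R Q0) s" if "s \<in> S" for s
  proof -
    have "sol A B (r *\<^sub>R P0) (r *\<^sub>R Q0) s = r *\<^sub>R (rot (A * s) (P s) + rot (- (B * s)) (Q s))"
      by (simp add: sol_def P0[OF that] Q0[OF that] rot_scaleR scaleR_add_right)
    also have "\<dots> = (r * (A + B)) *\<^sub>R c s"
      by (simp add: P_def Q_def rot_rot algebra_simps)
    finally show ?thesis using r by simp
  qed
  obtain s where s: "s \<in> S" using S(3) by auto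
  then have sT: "s \<in> T" using S by auto
  note f = frame[OF sT]
  have Pi: "P0 = rot (- (A * s)) (B *\<^sub>R c s + JJ (c1 s))" and Qi: "Q0 = rot (B * s) (A *\<^sub>R c s - JJ (c1 s))"
    using P0[OF s] Q0[OF s] by (simp_all add: P_def Q_def)
  have c1J: "c1 s \<bullet> JJ (c1 s) = 0" "JJ (c s) \<bullet> JJ (c1 s) = 0" "JJ (c1 s) \<bullet> JJ (c s) = 0" using f by simp_all
  have pp: "P0 \<bullet> P0 = B * (A + B)"
    unfolding Pi using f A(3) by (simp add: inner_add_left inner_add_right algebra_simps)
  have qq: "Q0 \<bullet> Q0 = A * (A + B)"
    unfolding Qi using f A(3) by (simp add: inner_diff_left inner_diff_right algebra_simps)
  have pq: "P0 \<bullet> Q0 = 0" "P0 \<bullet> JJ Q0 = 0"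
    unfolding Pi Qi rot_JJ[symmetric]
    by (rule rot_orthogonal; use f c1J A(3) in \<open>simp add: inner_add_left inner_add_right inner_diff_left inner_diff_right algebra_simps\<close>)+
  have AB: "A + B \<noteq> 0" using A by simp
  have "admissible a A B (r *\<^sub>R P0) (r *\<^sub>R Q0)"
    unfolding admissible_def using A AB pp qq pq by (simp add: r_def)
  then show thesis using csol by (rule that)
qed

end

lemma roots_exist:
  fixes a l :: real
  assumes "0 < a"
  obtains A B where "A > 0" "B > 0" "A * B = 1 / a" "A - B = l"
proof -
  let ?s = "sqrt (l\<^sup>2 + 4 / a)"
  have s2: "?s * ?s = l\<^sup>2 + 4 / a" using assms by simp
  have "sqrt (l\<^sup>2) < ?s" using assms by (intro real_sqrt_less_mono) simp
  then have "\<bar>l\<bar> < ?s" by simp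
  then have "(?s + l) / 2 > 0" "(?s - l) / 2 > 0" by auto
  moreover have "(?s + l) / 2 * ((?s - l) / 2) = (?s * ?s - l\<^sup>2) / 4"
    by (simp add: field_simps power2_eq_square)
  then have "(?s + l) / 2 * ((?s - l) / 2) = 1 / a" unfolding s2 by simp
  moreover have "(?s + l) / 2 - (?s - l) / 2 = l" by (simp add: field_simps)
  ultimately show thesis by (rule that)
qed

lemma roots_unique:
  fixes A B :: real
  assumes "A > 0" "B > 0" "A' > 0" "B' > 0" "A * B = A' * B'" "A - B = A' - B'"
  shows "A = A'" "B = B'"
proof -
  have "(A + B)\<^sup>2 = (A - B)\<^sup>2 + 4 * (A * B)" "(A' + B')\<^sup>2 = (A' - B')\<^sup>2 + 4 * (A' * B')"
    by (simp_all add: power2_eq_square algebra_simps)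
  then have "(A + B)\<^sup>2 = (A' + B')\<^sup>2" using assms by simp
  then have "A + B = A' + B'" using assms by (simp add: power2_eq_iff_nonneg)
  then show "A = A'" "B = B'" using assms(6) by auto
qed

section \<open>From local to global lifts\<close>

text \<open>The differential equation is available only at interior parameters; the resulting formula
  extends to an end point that belongs to \<open>I\<close> by the continuity of the lift there.\<close>

lemma local_solution:
  assumes a: "0 < a" "a < 1" and \<gamma>: "arc_length_curve a I \<gamma>"
    and bi: "biharmonic_submanifold TYPE(real ^ 3) S3 (gS a) (hopf_cylinder_params a I \<gamma>)"
    and s0: "s0 \<in> I"
  shows "\<exists>e A B p q. e > 0 \<and> admissible a A B p q \<and> (A = B \<or> (A - B)\<^sup>2 = 4 / a - 4) \<and>
    (\<forall>u\<in>I. \<bar>u - s0\<bar> < e \<longrightarrow> \<gamma> u = hopf a (sol A B p q u))"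
proof -
  have a0: "a \<noteq> 0" using a by simp
  obtain e c where e: "e > 0" and lift: "local_lift a I \<gamma> (ball s0 e) c"
    and h: "\<And>s. s \<in> ball s0 e \<Longrightarrow> D c s 1 \<bullet> JJ (c s) = 0"
    using horizontal_lift_exists[OF \<gamma> s0 a0] by blast
  define O' where "O' = ball s0 e \<inter> interior I"
  interpret C: horizontal_curve a O' c
    unfolding O'_def by (rule horizontal_lift_curve[OF a \<gamma> lift h])
  have cI: "convex I" "interior I \<noteq> {}"
    using \<gamma> by (auto simp: arc_length_curve_def is_interval_convex)
  have I_cl: "I \<subseteq> closure (interior I)"
    using convex_closure_interior[OF cI] closure_subset by blast
  have near: "u \<in> closure O'" if "u \<in> I" "u \<in> ball s0 e" for u
    using open_Int_closure_subset[OF open_ball, of s0 e "interior I"] I_cl that unfolding O'_def by blast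
  have "O' \<noteq> {}" using near[OF s0] e by auto
  have cO: "convex O'" unfolding O'_def by (intro convex_Int convex_ball convex_interior cI)
  have OI: "O' \<subseteq> I" using interior_subset by (auto simp: O'_def)
  have \<gamma>c: "\<gamma> s = hopf a (c s)" if "s \<in> ball s0 e \<inter> I" for s
    using lift that by (auto simp: local_lift_def)
  have \<gamma>O: "\<gamma> s = hopf a (c s)" if "s \<in> O'" for s
    using \<gamma>c that OI by (auto simp: O'_def)
  have eq: "C.lam1 s = 0" "C.lam2 s = C.lam s ^ 3 - (4 / a - 4) * C.lam s" if "s \<in> O'" for s
    using \<gamma>O by (auto intro: C.biharmonic_equations(1)[OF bi OI _ that] C.biharmonic_equations(2)[OF bi OI _ that])
  have "(C.lam has_vector_derivative 0) (at s within O')" if "s \<in> O'" for s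
    using C.lam_deriv(1)[OF that] eq(1)[OF that] by (simp add: has_vector_derivative_at_within)
  then obtain l where l: "\<And>s. s \<in> O' \<Longrightarrow> C.lam s = l"
    using has_vector_derivative_zero_constant[OF cO] by blast
  obtain s where s: "s \<in> O'" using \<open>O' \<noteq> {}\<close> by blast
  have "D C.lam1 s = D (\<lambda>_. 0) s" by (rule D_cong_open[OF C.T s]) (rule eq(1))
  then have "C.lam2 s = 0" by (simp add: C.lam2_def)
  then have "l * (l\<^sup>2 - (4 / a - 4)) = 0"
    using eq(2)[OF s] by (simp add: l[OF s] power2_eq_square power3_eq_cube algebra_simps)
  then have l2: "l = 0 \<or> l\<^sup>2 = 4 / a - 4" by simp
  obtain A B where AB: "A > 0" "B > 0" "A * B = 1 / a" "A - B = l"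
    using roots_exist[OF a(1)] by blast
  obtain p q where pq: "admissible a A B p q" "\<And>s. s \<in> O' \<Longrightarrow> c s = sol A B p q s"
    using C.constant_curvature_solution[OF order_refl cO \<open>O' \<noteq> {}\<close> _ AB(1-3)] l AB(4) by blast
  have cc: "continuous_on (ball s0 e) (\<lambda>u. c u - sol A B p q u)"
    using lift smooth_continuous smooth_sol smooth_subset[OF smooth_sol]
    by (intro continuous_on_diff) (auto simp: local_lift_def intro: smooth_continuous)
  have "c u = sol A B p q u" if u: "u \<in> I" "u \<in> ball s0 e" for u
  proof -
    have cont: "isCont (\<lambda>u. c u - sol A B p q u) u"
      using cc u by (simp add: continuous_on_eq_continuous_at)
    obtain x where x: "\<And>n. x n \<in> O'" "x \<longlonglongrightarrow> u"
      using near[OF u] by (auto simp: closure_sequential)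
    have "(\<lambda>n. c (x n) - sol A B p q (x n)) \<longlonglongrightarrow> c u - sol A B p q u"
      by (rule isCont_tendsto_compose[OF cont x(2)])
    then have "(\<lambda>n. 0) \<longlonglongrightarrow> c u - sol A B p q u" by (simp add: pq(2)[OF x(1)])
    then show ?thesis using LIMSEQ_unique[OF tendsto_const] by fastforce
  qed
  then have "\<gamma> u = hopf a (sol A B p q u)" if "u \<in> I" "\<bar>u - s0\<bar> < e" for u
    using \<gamma>c[of u] that by (auto simp: dist_real_def abs_minus_commute)
  moreover have "A = B \<or> (A - B)\<^sup>2 = 4 / a - 4" using l2 AB(4) by auto
  ultimately show ?thesis using e pq(1) by blast
qed

lemma sol_recover:
  "rot (- (A * u)) (B *\<^sub>R sol A B p q u + JJ (sol A B (- (A *\<^sub>R JJ p)) (B *\<^sub>R JJ q) u)) = (A + B) *\<^sub>R p"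
  "rot (B * u) (A *\<^sub>R sol A B p q u - JJ (sol A B (- (A *\<^sub>R JJ p)) (B *\<^sub>R JJ q) u)) = (A + B) *\<^sub>R q"
  by (simp_all add: JJ_sol sol_def rot_add rot_diff rot_minus rot_scaleR rot_rot rot_JJ algebra_simps)

text \<open>Two horizontal lifts of one curve differ by a phase whose derivative is vertical as well as
  horizontal, so the phase is constant. Then the two solutions have the same curvature, hence
  the same \<open>A\<close> and \<open>B\<close>, and amplitudes that differ by this phase.\<close>

lemma sol_agree:
  assumes a: "0 < a" "a < 1" and ad: "admissible a A B p q" "admissible a A' B' p' q'"
    and S: "open S" "convex S" "S \<noteq> {}"
    and eq: "\<And>u. u \<in> S \<Longrightarrow> hopf a (sol A B p q u) = hopf a (sol A' B' p' q' u)"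
  shows "hopf a (sol A B p q u) = hopf a (sol A' B' p' q' u)"
proof -
  have a0: "a \<noteq> 0" using a by simp
  let ?x = "sol A B p q" and ?y = "sol A' B' p' q'"
  interpret X: horizontal_curve a UNIV ?x by (rule sol_horizontal_curve(1)[OF a ad(1)])
  interpret Y: horizontal_curve a UNIV ?y by (rule sol_horizontal_curve(1)[OF a ad(2)])
  define \<alpha> \<beta> where "\<alpha> u = ?y u \<bullet> ?x u" "\<beta> u = ?y u \<bullet> JJ (?x u)" for u
  note fx = X.frame[OF UNIV_I] and fy = Y.frame[OF UNIV_I]
  have d: "(\<alpha> has_vector_derivative 0) (at u within S)" "(\<beta> has_vector_derivative 0) (at u within S)"
    if u: "u \<in> S" for u
  proof -
    obtain \<theta> where \<theta>: "?y u = rot \<theta> (?x u)" using eq[OF u] hopf_eq_iff[OF a0] by blast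
    then have \<theta>': "?x u = rot (- \<theta>) (?y u)" by (simp add: rot_rot)
    have 1: "X.c1 u \<bullet> ?y u = 0" "JJ (X.c1 u) \<bullet> ?y u = 0"
      unfolding \<theta> using fx[of u] by (simp_all add: rot_def inner_diff_right inner_add_right)
    have 2: "Y.c1 u \<bullet> ?x u = 0" "Y.c1 u \<bullet> JJ (?x u) = 0"
      unfolding \<theta>' using fy[of u] by (simp_all add: rot_def inner_diff_right inner_add_right)
    have dx: "(?x has_derivative (\<lambda>t. t *\<^sub>R X.c1 u)) (at u)" "(?y has_derivative (\<lambda>t. t *\<^sub>R Y.c1 u)) (at u)"
      using X.c_deriv(1)[of u] Y.c_deriv(1)[of u] by (simp_all add: has_vector_derivative_def)
    have "(\<alpha> has_derivative (\<lambda>t. 0)) (at u)"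
      unfolding \<alpha>_\<beta>_def[abs_def]
      by (rule has_derivative_eq_rhs[OF has_derivative_inner[OF dx(2,1)]]) (use 1 2 in \<open>simp add: inner_commute\<close>)
    moreover have "(\<beta> has_derivative (\<lambda>t. 0)) (at u)"
      unfolding \<alpha>_\<beta>_def[abs_def]
      by (rule has_derivative_eq_rhs[OF has_derivative_inner[OF dx(2) JJ_has_derivative[OF dx(1)]]])
        (use 1 2 in \<open>simp add: inner_commute\<close>)
    ultimately show "(\<alpha> has_vector_derivative 0) (at u within S)" "(\<beta> has_vector_derivative 0) (at u within S)"
      by (auto simp: has_vector_derivative_def intro: has_derivative_at_withinI)
  qed
  obtain \<alpha>0 where \<alpha>0: "\<And>u. u \<in> S \<Longrightarrow> \<alpha> u = \<alpha>0" using has_vector_derivative_zero_constant[OF S(2) d(1)] by blast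
  obtain \<beta>0 where \<beta>0: "\<And>u. u \<in> S \<Longrightarrow> \<beta> u = \<beta>0" using has_vector_derivative_zero_constant[OF S(2) d(2)] by blast
  obtain u0 where u0: "u0 \<in> S" using S(3) by auto
  have ex: "\<exists>\<theta>. ?y u = rot \<theta> (?x u) \<and> cos \<theta> = \<alpha>0 \<and> - sin \<theta> = \<beta>0" if u: "u \<in> S" for u
  proof -
    obtain \<theta> where \<theta>: "?y u = rot \<theta> (?x u)" using eq[OF u] hopf_eq_iff[OF a0] by blast
    have "\<alpha> u = cos \<theta>" "\<beta> u = - sin \<theta>"
      using fx(1)[of u] by (simp_all add: \<alpha>_\<beta>_def \<theta> rot_def inner_diff_left)
    then show ?thesis using \<theta> \<alpha>0[OF u] \<beta>0[OF u] by auto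
  qed
  obtain \<theta> where \<theta>: "cos \<theta> = \<alpha>0" "- sin \<theta> = \<beta>0" using ex[OF u0] by blast
  have yx: "?y u = sol A B (rot \<theta> p) (rot \<theta> q) u" if u: "u \<in> S" for u
  proof -
    obtain \<omega> where "?y u = rot \<omega> (?x u)" "cos \<omega> = cos \<theta>" "sin \<omega> = sin \<theta>"
      using ex[OF u] \<theta> by auto
    then have "?y u = rot \<theta> (?x u)" by (simp add: rot_def)
    then show ?thesis by (simp only: rot_sol)
  qed
  have D1: "sol A' B' (- (A' *\<^sub>R JJ p')) (B' *\<^sub>R JJ q') u = sol A B (- (A *\<^sub>R JJ (rot \<theta> p))) (B *\<^sub>R JJ (rot \<theta> q)) u"
    if "u \<in> S" for u
    using D_cong_open[OF S(1) that, of ?y "sol A B (rot \<theta> p) (rot \<theta> q)"] yx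
      D_sol[of A' B' p' q' u] D_sol[of A B "rot \<theta> p" "rot \<theta> q" u] by simp
  have D2: "sol A' B' (- ((A' * A') *\<^sub>R p')) (- ((B' * B') *\<^sub>R q')) u0
      = sol A B (- ((A * A) *\<^sub>R rot \<theta> p)) (- ((B * B) *\<^sub>R rot \<theta> q)) u0"
    using D_cong_open[OF S(1) u0, of "sol A' B' (- (A' *\<^sub>R JJ p')) (B' *\<^sub>R JJ q')"
        "sol A B (- (A *\<^sub>R JJ (rot \<theta> p))) (B *\<^sub>R JJ (rot \<theta> q))"] D1 D_sol[of A' B' "- (A' *\<^sub>R JJ p')" "B' *\<^sub>R JJ q'" u0]
      D_sol[of A B "- (A *\<^sub>R JJ (rot \<theta> p))" "B *\<^sub>R JJ (rot \<theta> q)" u0] by simp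
  have c12: "X.c1 = sol A B (- (A *\<^sub>R JJ p)) (B *\<^sub>R JJ q)" "Y.c1 = sol A' B' (- (A' *\<^sub>R JJ p')) (B' *\<^sub>R JJ q')"
    by (auto simp: X.c1_def Y.c1_def D_sol)
  have "X.c2 u0 = sol A B (- ((A * A) *\<^sub>R p)) (- ((B * B) *\<^sub>R q)) u0"
    "Y.c2 u0 = sol A' B' (- ((A' * A') *\<^sub>R p')) (- ((B' * B') *\<^sub>R q')) u0"
    by (simp_all add: X.c2_def Y.c2_def c12 D_sol)
  then have "Y.c2 u0 = rot \<theta> (X.c2 u0)" "Y.c1 u0 = rot \<theta> (X.c1 u0)"
    using D1[OF u0] D2 by (simp_all add: c12 rot_sol rot_minus rot_scaleR rot_JJ)
  then have "Y.lam u0 = X.lam u0"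
    by (simp add: X.lam_def Y.lam_def rot_JJ[symmetric])
  then have "A' - B' = A - B" using sol_horizontal_curve(2)[OF a] ad by metis
  then have AB: "A' = A" "B' = B"
    using roots_unique[of A' B' A B] ad by (auto simp: admissible_def)
  have "A + B \<noteq> 0" using ad(1) by (simp add: admissible_def)
  moreover have "(A + B) *\<^sub>R p' = (A + B) *\<^sub>R rot \<theta> p"
    using sol_recover(1)[where A=A and B=B and u=u0 and p=p' and q=q'] D1[OF u0] yx[OF u0]
      sol_recover(1)[where A=A and B=B and u=u0 and p="rot \<theta> p" and q="rot \<theta> q"]
    unfolding AB by argo
  moreover have "(A + B) *\<^sub>R q' = (A + B) *\<^sub>R rot \<theta> q"
    using sol_recover(2)[where A=A and B=B and u=u0 and p=p' and q=q'] D1[OF u0] yx[OF u0]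
      sol_recover(2)[where A=A and B=B and u=u0 and p="rot \<theta> p" and q="rot \<theta> q"]
    unfolding AB by argo
  ultimately have "p' = rot \<theta> p" "q' = rot \<theta> q" by simp_all
  then have "?y u = rot \<theta> (?x u)" by (simp add: AB rot_sol)
  then show ?thesis by (simp add: hopf_rot[OF a0])
qed

text \<open>The set of parameters near which one fixed solution projects to \<open>\<gamma>\<close> is open
  in \<open>I\<close>, and it is closed by \<open>sol_agree\<close>, applied to the interior
  part of an overlap.\<close>

lemma global_solution:
  assumes a: "0 < a" "a < 1" and \<gamma>: "arc_length_curve a I \<gamma>"
    and bi: "biharmonic_submanifold TYPE(real ^ 3) S3 (gS a) (hopf_cylinder_params a I \<gamma>)"
  obtains A B p q where "admissible a A B p q" "A = B \<or> (A - B)\<^sup>2 = 4 / a - 4"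
    "\<And>u. u \<in> I \<Longrightarrow> \<gamma> u = hopf a (sol A B p q u)"
proof -
  have I: "is_interval I" "interior I \<noteq> {}" using \<gamma> by (auto simp: arc_length_curve_def)
  then have cI: "convex I" "connected I" by (auto simp: is_interval_convex is_interval_connected)
  obtain s0 where s0: "s0 \<in> I" using I(2) interior_subset by blast
  obtain e A B p q where e: "e > 0" and ad: "admissible a A B p q" and AB: "A = B \<or> (A - B)\<^sup>2 = 4 / a - 4"
    and base: "\<forall>u\<in>I. \<bar>u - s0\<bar> < e \<longrightarrow> \<gamma> u = hopf a (sol A B p q u)"
    using local_solution[OF a \<gamma> bi s0] by blast
  define Pr where "Pr s \<longleftrightarrow> (\<exists>e>0. \<forall>u\<in>I. \<bar>u - s\<bar> < e \<longrightarrow> \<gamma> u = hopf a (sol A B p q u))" for s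
  have I_cl: "I \<subseteq> closure (interior I)"
    using convex_closure_interior[OF cI(1) I(2)] closure_subset by blast
  have "Pr s" if "s \<in> I" for s
  proof (rule connected_induction_simple[where P = Pr, OF cI(2) s0 that])
    show "Pr s0" unfolding Pr_def using e base by blast
    fix t assume t: "t \<in> I"
    obtain e' A' B' p' q' where e': "e' > 0" and ad': "admissible a A' B' p' q'"
      and loc: "\<forall>u\<in>I. \<bar>u - t\<bar> < e' \<longrightarrow> \<gamma> u = hopf a (sol A' B' p' q' u)"
      using local_solution[OF a \<gamma> bi t] by blast
    have "Pr y" if x: "x \<in> I \<inter> ball t e'" and y: "y \<in> I \<inter> ball t e'" and Px: "Pr x" for x y
    proof -
      obtain d where d: "d > 0" "\<forall>u\<in>I. \<bar>u - x\<bar> < d \<longrightarrow> \<gamma> u = hopf a (sol A B p q u)"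
        using Px[unfolded Pr_def] by auto
      define S where "S = ball t e' \<inter> ball x d \<inter> interior I"
      have "x \<in> closure S"
        using open_Int_closure_subset[OF open_Int[OF open_ball open_ball], of t e' x d "interior I"] I_cl x d(1)
        unfolding S_def by auto
      then have "S \<noteq> {}" by auto
      moreover have "open S" "convex S" unfolding S_def
        by (auto intro!: convex_Int convex_ball convex_interior cI)
      moreover have "hopf a (sol A B p q u) = hopf a (sol A' B' p' q' u)" if "u \<in> S" for u
      proof -
        have "u \<in> I" "\<bar>u - t\<bar> < e'" "\<bar>u - x\<bar> < d"
          using that interior_subset by (auto simp: S_def dist_real_def abs_minus_commute)
        then show ?thesis using bspec[OF loc, of u] bspec[OF d(2), of u] by simp
      qed
      ultimately have glob: "hopf a (sol A B p q u) = hopf a (sol A' B' p' q' u)" for u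
        using sol_agree[OF a ad ad'] by blast
      obtain d' where d': "d' > 0" "ball y d' \<subseteq> ball t e'" using y openE[OF open_ball, of y t e'] by blast
      have "\<gamma> u = hopf a (sol A B p q u)" if "u \<in> I" "\<bar>u - y\<bar> < d'" for u
      proof -
        have "u \<in> ball y d'" using that(2) by (simp add: dist_real_def abs_minus_commute)
        then have "u \<in> ball t e'" using d'(2) by blast
        then show ?thesis using bspec[OF loc that(1)] glob by (simp add: dist_real_def abs_minus_commute)
      qed
      then show "Pr y" unfolding Pr_def by (intro exI[of _ d'] conjI ballI impI d'(1))
    qed
    then have "\<forall>x\<in>I \<inter> ball t e'. \<forall>y\<in>I \<inter> ball t e'. Pr x \<longrightarrow> Pr y" by blast
    moreover have "openin (top_of_set I) (I \<inter> ball t e')" by (rule openin_open_Int[OF open_ball])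
    moreover have "t \<in> I \<inter> ball t e'" using t e' by simp
    ultimately show "\<exists>T. openin (top_of_set I) T \<and> t \<in> T \<and> (\<forall>x\<in>T. \<forall>y\<in>T. Pr x \<longrightarrow> Pr y)" by blast
  qed
  then have "\<gamma> u = hopf a (sol A B p q u)" if "u \<in> I" for u
    using \<open>\<And>s. s \<in> I \<Longrightarrow> Pr s\<close>[OF that, unfolded Pr_def] that by force
  then show thesis using that ad AB by blast
qed

section \<open>The parametric equation\<close>

lemma rot_neg: "rot (- \<theta>) v = cos \<theta> *\<^sub>R v + sin \<theta> *\<^sub>R JJ v"
  by (simp add: rot_def)

text \<open>The fibre through a point of the lift is swept out by its phases \<open>v / a\<close>.\<close>

lemma cylinder_parametrization:
  assumes a: "0 < a" and ad: "admissible a A B p q"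
  shows "{z \<in> S3. \<exists>u\<in>K. hopf a z = hopf a (sol A B p q u)} =
     {  sqrt (B / (A + B)) *\<^sub>R cos (A * u + 1 / a * v) *\<^sub>R (p /\<^sub>R norm p)
        - sqrt (B / (A + B)) *\<^sub>R sin (A * u + 1 / a * v) *\<^sub>R JJ (p /\<^sub>R norm p)
        + sqrt (A / (A + B)) *\<^sub>R cos (B * u - 1 / a * v) *\<^sub>R (q /\<^sub>R norm q)
        + sqrt (A / (A + B)) *\<^sub>R sin (B * u - 1 / a * v) *\<^sub>R JJ (q /\<^sub>R norm q)
       | u v. u \<in> K \<and> v \<in> (UNIV :: real set)}" (is "?L = ?R")
proof -
  have a0: "a \<noteq> 0" using a by simp
  from ad have A: "A > 0" "B > 0" and pq: "p \<bullet> p = B / (A + B)" "q \<bullet> q = A / (A + B)"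
    "p \<bullet> q = 0" "p \<bullet> JJ q = 0"
    by (auto simp: admissible_def)
  have np: "sqrt (B / (A + B)) = norm p" "sqrt (A / (A + B)) = norm q"
    using pq by (simp_all add: norm_eq_sqrt_inner)
  have "p \<bullet> p > 0" "q \<bullet> q > 0" using pq A by simp_all
  then have n0: "norm p \<noteq> 0" "norm q \<noteq> 0" by auto
  have point: "sqrt (B / (A + B)) *\<^sub>R cos (A * u + 1 / a * v) *\<^sub>R (p /\<^sub>R norm p)
        - sqrt (B / (A + B)) *\<^sub>R sin (A * u + 1 / a * v) *\<^sub>R JJ (p /\<^sub>R norm p)
        + sqrt (A / (A + B)) *\<^sub>R cos (B * u - 1 / a * v) *\<^sub>R (q /\<^sub>R norm q)
        + sqrt (A / (A + B)) *\<^sub>R sin (B * u - 1 / a * v) *\<^sub>R JJ (q /\<^sub>R norm q)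
      = rot (v / a) (sol A B p q u)" for u v
  proof -
    have "rot (v / a) (sol A B p q u) = rot (A * u + 1 / a * v) p + rot (- (B * u - 1 / a * v)) q"
      by (simp add: sol_def rot_add rot_rot add.commute)
    also have "\<dots> = cos (A * u + 1 / a * v) *\<^sub>R p - sin (A * u + 1 / a * v) *\<^sub>R JJ p
        + (cos (B * u - 1 / a * v) *\<^sub>R q + sin (B * u - 1 / a * v) *\<^sub>R JJ q)"
      unfolding rot_neg by (simp add: rot_def)
    finally show ?thesis
      unfolding np using n0 by (simp add: mult.left_commute[of "norm p"] mult.left_commute[of "norm q"])
  qed
  have S3: "rot \<theta> (sol A B p q u) \<in> S3" for \<theta> u
    using sol_inner[OF pq(3,4,3,4), of A B u] pq A
    by (simp add: norm_eq_sqrt_inner add_divide_distrib[symmetric])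
  show ?thesis
    unfolding point
  proof (intro equalityI subsetI)
    fix z assume "z \<in> {z \<in> S3. \<exists>u\<in>K. hopf a z = hopf a (sol A B p q u)}"
    then obtain u where u: "u \<in> K" "hopf a (sol A B p q u) = hopf a z" by auto
    then obtain \<theta> where "z = rot \<theta> (sol A B p q u)" using hopf_eq_iff[OF a0] by blast
    then have "z = rot ((a * \<theta>) / a) (sol A B p q u)" using a0 by simp
    then show "z \<in> {rot (v / a) (sol A B p q u) |u v. u \<in> K \<and> v \<in> UNIV}" using u(1) by blast
  next
    fix z assume "z \<in> {rot (v / a) (sol A B p q u) |u v. u \<in> K \<and> v \<in> UNIV}"
    then obtain u v where "z = rot (v / a) (sol A B p q u)" "u \<in> K" by blast
    then show "z \<in> {z \<in> S3. \<exists>u\<in>K. hopf a z = hopf a (sol A B p q u)}"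
      using S3 hopf_rot[OF a0] by blast
  qed
qed

lemma rotation_speeds:
  assumes a: "0 < a" "a < (1::real)"
    and A: "A = sqrt ((3 - 2 * a - 2 * sqrt ((a - 1) * (a - 2))) / a)"
    and B: "B = sqrt ((3 - 2 * a + 2 * sqrt ((a - 1) * (a - 2))) / a)"
  shows "A > 0" "B > 0" "A * B = 1 / a" "A < B" "(A - B)\<^sup>2 = 4 / a - 4"
proof -
  define r where "r = sqrt ((a - 1) * (a - 2))"
  have pos: "(a - 1) * (a - 2) > 0" using a by (simp add: mult_neg_neg)
  then have r: "r > 0" "r\<^sup>2 = (a - 1) * (a - 2)" by (simp_all add: r_def)
  have "(2 * r)\<^sup>2 < (3 - 2 * a)\<^sup>2"
    using r(2) by (simp add: power_mult_distrib) (simp add: power2_eq_square algebra_simps)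
  then have lt: "2 * r < 3 - 2 * a" using power_less_imp_less_base[of "2 * r" 2 "3 - 2 * a"] a by simp
  have A': "A = sqrt ((3 - 2 * a - 2 * r) / a)" and B': "B = sqrt ((3 - 2 * a + 2 * r) / a)"
    using A B by (simp_all add: r_def)
  have p: "(3 - 2 * a - 2 * r) / a > 0" "(3 - 2 * a + 2 * r) / a > 0" using lt r a by simp_all
  show AB: "A > 0" "B > 0" unfolding A' B' using p by simp_all
  show "A < B" unfolding A' B' using r a by (intro real_sqrt_less_mono divide_strict_right_mono) auto
  have "(3 - 2 * a - 2 * r) * (3 - 2 * a + 2 * r) = (3 - 2 * a)\<^sup>2 - 4 * r\<^sup>2"
    by (simp add: power2_eq_square algebra_simps)
  also have "\<dots> = 1" unfolding r(2) by (simp add: power2_eq_square algebra_simps)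
  finally have one: "(3 - 2 * a - 2 * r) / a * ((3 - 2 * a + 2 * r) / a) = (1 / a)\<^sup>2"
    by (simp add: power2_eq_square)
  have "A * B = sqrt ((3 - 2 * a - 2 * r) / a * ((3 - 2 * a + 2 * r) / a))"
    unfolding A' B' by (rule real_sqrt_mult[symmetric])
  then show ab: "A * B = 1 / a" unfolding one using a by simp
  have "A\<^sup>2 = (3 - 2 * a - 2 * r) / a" "B\<^sup>2 = (3 - 2 * a + 2 * r) / a"
    unfolding A' B' using p by simp_all
  then have "(A - B)\<^sup>2 = (3 - 2 * a - 2 * r) / a + (3 - 2 * a + 2 * r) / a - 2 * (1 / a)"
    by (simp add: power2_diff mult.assoc ab)
  also have "\<dots> = 4 / a - 4" using a by (simp add: field_simps)
  finally show "(A - B)\<^sup>2 = 4 / a - 4" .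
qed

theorem theorem4p1:
  fixes a A B :: real and I :: "real set" and \<gamma> :: "real \<Rightarrow> (real ^ 4) set"
  assumes a: "0 < a" "a < 1"
    and A: "A = sqrt ((3 - 2 * a - 2 * sqrt ((a - 1) * (a - 2))) / a)"
    and B: "B = sqrt ((3 - 2 * a + 2 * sqrt ((a - 1) * (a - 2))) / a)"
    and \<gamma>: "arc_length_curve a I \<gamma>"
    and S: "proper_biharmonic_hopf_cylinder a I \<gamma>"
  shows "\<exists>(e1 :: real ^ 4) (e3 :: real ^ 4) K.
     norm e1 = 1 \<and> norm e3 = 1 \<and> e1 \<bullet> e3 = 0 \<and> e3 \<bullet> JJ e1 = 0 \<and> is_interval K \<and>
     hopf_cylinder a I \<gamma> =
       {  sqrt (B / (A + B)) *\<^sub>R cos (A * u + 1 / a * v) *\<^sub>R e1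
        - sqrt (B / (A + B)) *\<^sub>R sin (A * u + 1 / a * v) *\<^sub>R JJ e1
        + sqrt (A / (A + B)) *\<^sub>R cos (B * u - 1 / a * v) *\<^sub>R e3
        + sqrt (A / (A + B)) *\<^sub>R sin (B * u - 1 / a * v) *\<^sub>R JJ e3
       | u v. u \<in> K \<and> v \<in> (UNIV :: real set)}"
proof -
  have bi: "biharmonic_submanifold TYPE(real ^ 3) S3 (gS a) (hopf_cylinder_params a I \<gamma>)"
    and nh: "\<not> harmonic_submanifold TYPE(real ^ 3) S3 (gS a) (hopf_cylinder_params a I \<gamma>)"
    using S by (auto simp: proper_biharmonic_hopf_cylinder_def proper_biharmonic_submanifold_def)
  note AB = rotation_speeds[OF a A B]
  have I: "is_interval I" using \<gamma> by (simp add: arc_length_curve_def)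
  obtain A0 B0 p q where ad: "admissible a A0 B0 p q" and cs: "A0 = B0 \<or> (A0 - B0)\<^sup>2 = 4 / a - 4"
    and \<gamma>sol: "\<And>u. u \<in> I \<Longrightarrow> \<gamma> u = hopf a (sol A0 B0 p q u)"
    using global_solution[OF a \<gamma> bi] by blast
  have AB0: "A0 > 0" "B0 > 0" "A0 * B0 = A * B" using ad AB(3) by (simp_all add: admissible_def)
  have "A0 \<noteq> B0"
  proof
    assume "A0 = B0"
    then have "horizontal_curve.lam a (sol A0 B0 p q) s = 0" for s
      using sol_horizontal_curve(2)[OF a ad] by simp
    then have "harmonic_submanifold TYPE(real ^ 3) S3 (gS a) (hopf_cylinder_params a I \<gamma>)"
      by (rule horizontal_curve.harmonic_if_lam_zero[OF sol_horizontal_curve(1)[OF a ad] _ subset_UNIV \<gamma>sol])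
    with nh show False by contradiction
  qed
  then have "(A0 - B0)\<^sup>2 = (A - B)\<^sup>2" using cs AB(5) by simp
  then have "A0 - B0 = A - B \<or> A0 - B0 = B - A" by (auto simp: power2_eq_iff)
  then have "\<exists>K p' q'. is_interval K \<and> admissible a A B p' q' \<and>
    hopf_cylinder a I \<gamma> = {z \<in> S3. \<exists>u\<in>K. hopf a z = hopf a (sol A B p' q' u)}"
  proof (elim disjE)
    assume "A0 - B0 = A - B"
    then have e: "A0 = A" "B0 = B"
      using roots_unique[OF AB0(1,2) AB(1,2) AB0(3)] by simp_all
    show ?thesis
    proof (intro exI conjI)
      show "is_interval I" by (rule I)
      show "admissible a A B p q" using ad e by simp
      show "hopf_cylinder a I \<gamma> = {z \<in> S3. \<exists>u\<in>I. hopf a z = hopf a (sol A B p q u)}"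
        using \<gamma>sol e by (auto simp: hopf_cylinder_def)
    qed
  next
    \<comment> \<open>The curve turns the other way: reversing its parameter exchanges the
      two summands.\<close>
    assume "A0 - B0 = B - A"
    then have e: "A0 = B" "B0 = A"
      using roots_unique[OF AB0(1,2) AB(2,1)] AB0(3) by (simp_all add: mult.commute)
    have sw: "sol B A p q u = sol A B q p (- u)" for u
      by (simp add: sol_def add.commute)
    show ?thesis
    proof (intro exI conjI)
      show "is_interval (uminus ` I)" using I by simp
      have "q \<bullet> JJ p = - (p \<bullet> JJ q)" using inner_JJ_right[of q p] by (simp add: inner_commute)
      then show "admissible a A B q p" using ad e by (auto simp: admissible_def add.commute mult.commute inner_commute)
      show "hopf_cylinder a I \<gamma> = {z \<in> S3. \<exists>u\<in>uminus ` I. hopf a z = hopf a (sol A B q p u)}"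
        using \<gamma>sol e by (auto simp: hopf_cylinder_def sw)
    qed
  qed
  then obtain K p' q' where K: "is_interval K" and ad': "admissible a A B p' q'"
    and set: "hopf_cylinder a I \<gamma> = {z \<in> S3. \<exists>u\<in>K. hopf a z = hopf a (sol A B p' q' u)}"
    by blast
  from ad' have pq: "p' \<bullet> p' > 0" "q' \<bullet> q' > 0" "p' \<bullet> q' = 0" "p' \<bullet> JJ q' = 0"
    by (auto simp: admissible_def)
  have "q' \<bullet> JJ p' = 0" using pq(4) inner_JJ_right[of q' p'] by (simp add: inner_commute)
  then show ?thesis
    unfolding set cylinder_parametrization[OF a(1) ad', of K]
    using pq K by (intro exI[of _ "p' /\<^sub>R norm p'"] exI[of _ "q' /\<^sub>R norm q'"] exI[of _ K]) auto
qed

end
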